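(* Let $T>0$, let $\omega_0\in L^1_c(\mathbb{R}^2)$ (i.e. $\omega_0\in L^1(\mathbb{R}^2)$ with compact support) and let $\omega_0^\varepsilon=\omega_0*j_{\delta(\varepsilon)}$. Then the approximate vorticities $\{\omega^\varepsilon\}_{\varepsilon\in(0,1)}$ constructed from $\omega_0$ by the vortex-blob approximation are equi-integrable in $L^1((0,T)\times\mathbb{R}^2)$.
   Context: **Equi-integrability.** A bounded family in $L^1((0,T)\times\mathbb{R}^2)$ is equi-integrable if for every $\eta>0$ there are $\gamma>0$ and $R>0$ such that every member $f$ satisfies $\iint_A|f|\,dx\,dt\le\eta$ for all measurable $A\subset(0,T)\times\mathbb{R}^2$ of Lebesgue measure at most $\gamma$, and $\int_0^T\int_{\mathbb{R}^2\setminus B_R}|f|\,dx\,dt\le\eta$. **Vortex-blob approximation.** $K(x)=\frac{1}{2\pi}\frac{(-x_2,x_1)}{|x|^2}$. Let $j$ and $\varphi$ be standard mollifiers on $\mathbb{R}^2$ (smooth, nonnegative, radial, supported in the unit ball, with integral $1$), $j_\delta(x)=\delta^{-2}j(x/\delta)$, $\varphi_\varepsilon(x)=\varepsilon^{-2}\varphi(x/\varepsilon)$. For $\varepsilon\in(0,1)$ let $\delta=\delta(\varepsilon)$, $h=h(\varepsilon)\in(0,1)$, with $\delta(\varepsilon)\to0$ as $\varepsilon\to0$. Put $\omega_0^\varepsilon=\omega_0*j_{\delta(\varepsilon)}$. Let $R_1,\dots,R_{N(\varepsilon)}$ be the squares with sides of length $h$ parallel to the axes, centered at points $\alpha_i$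 of the lattice $h\mathbb{Z}^2$, that tile the support of $\omega_0^\varepsilon$, and $\Gamma_i^\varepsilon=\int_{R_i}\omega_0^\varepsilon\,dx$. Put $K_\varepsilon=K*\varphi_\varepsilon$ and let $\{X_i^\varepsilon(t)\}$ be the unique solution of the ODE system $\dot X_i^\varepsilon(t)=v^\varepsilon(t,X_i^\varepsilon(t))$, $X_i^\varepsilon(0)=\alpha_i$, where $$v^\varepsilon(t,x)=\sum_{i=1}^{N(\varepsilon)}\Gamma_i^\varepsilon K_\varepsilon(x-X_i^\varepsilon(t)),\qquad \omega^\varepsilon(t,x)=\sum_{i=1}^{N(\varepsilon)}\Gamma_i^\varepsilon\varphi_\varepsilon(x-X_i^\varepsilon(t)).$$ **Parameter $h$.** $h(\varepsilon)\le C\varepsilon^4\exp(-C_0\varepsilon^{-2})$, where $C>0$ and $C_0$ is a sufficiently large constant depending only on $\varphi$, $\|\omega_0\|_{L^1}$ and $T$. *)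

theory Defs
  imports "HOL-Analysis.Analysis"
begin

primrec C_k :: "nat \<Rightarrow> ('a::real_normed_vector \<Rightarrow> 'b::real_normed_vector) \<Rightarrow> bool" where
  "C_k 0 f \<longleftrightarrow> continuous_on UNIV f"
| "C_k (Suc k) f \<longleftrightarrow>
     (\<forall>x. f differentiable (at x)) \<and> (\<forall>v. C_k k (\<lambda>x. frechet_derivative f (at x) v))"

definition smooth :: "('a::real_normed_vector \<Rightarrow> 'b::real_normed_vector) \<Rightarrow> bool" where
  "smooth f \<longleftrightarrow> (\<forall>k. C_k k f)"

definition supp :: "(real^2 \<Rightarrow> real) \<Rightarrow> (real^2) set" where
  "supp f = closure (support_on UNIV f)"

definition standard_mollifier :: "(real^2 \<Rightarrow> real) \<Rightarrow> bool" where
  "standard_mollifier \<phi> \<longleftrightarrow>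
     smooth \<phi> \<and>
     (\<forall>x. 0 \<le> \<phi> x) \<and>
     (\<forall>x y. norm x = norm y \<longrightarrow> \<phi> x = \<phi> y) \<and>
     supp \<phi> \<subseteq> cball 0 1 \<and>
     (LINT x|lebesgue. \<phi> x) = 1"

definition rescale :: "real \<Rightarrow> (real^2 \<Rightarrow> real) \<Rightarrow> real^2 \<Rightarrow> real" where
  "rescale \<epsilon> \<phi> x = \<phi> (x /\<^sub>R \<epsilon>) / \<epsilon>\<^sup>2"

text \<open>One convolution serves both scalar functions and the vector-valued kernel; on the reals
  \<open>*\<^sub>R\<close> is multiplication.\<close>

definition convolve ::
  "(real^2 \<Rightarrow> 'b::{banach, second_countable_topology}) \<Rightarrow> (real^2 \<Rightarrow> real) \<Rightarrow> real^2 \<Rightarrow> 'b" where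
  "convolve f g x = (LINT y|lebesgue. g y *\<^sub>R f (x - y))"

text \<open>At the origin, where the formula is singular, division by zero gives the irrelevant value
  \<open>0\<close>.\<close>

definition biot_savart :: "real^2 \<Rightarrow> real^2" where
  "biot_savart x = (1 / (2 * pi * (norm x)\<^sup>2)) *\<^sub>R vector [- x $ 2, x $ 1]"

text \<open>Compact support of an \<open>L\<^sup>1\<close> class is meant up to null sets.\<close>

definition L1_compact_support :: "(real^2 \<Rightarrow> real) \<Rightarrow> bool" where
  "L1_compact_support f \<longleftrightarrow>
     integrable lebesgue f \<and> (\<exists>S. compact S \<and> (AE x in lebesgue. x \<notin> S \<longrightarrow> f x = 0))"

definition lattice_points :: "real \<Rightarrow> (real^2) set" where
  "lattice_points h = {\<alpha>. \<forall>i. \<exists>k::int. \<alpha> $ i = h * of_int k}"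

definition lattice_square :: "real \<Rightarrow> real^2 \<Rightarrow> (real^2) set" where
  "lattice_square h \<alpha> = {x. \<forall>i. \<bar>x $ i - \<alpha> $ i\<bar> \<le> h / 2}"

text \<open>The vortices are indexed by the centers \<open>\<alpha>\<close> of the squares that meet the support of \<open>w\<close>,
  instead of by \<open>1, \<dots>, N\<close>. The squares are closed, so they overlap in null sets only; a square
  meeting the support only along its boundary has circulation \<open>0\<close>. The index set is finite whenever
  \<open>w\<close> has compact support and \<open>h > 0\<close>.\<close>

definition blob_centers :: "real \<Rightarrow> (real^2 \<Rightarrow> real) \<Rightarrow> (real^2) set" where
  "blob_centers h w = {\<alpha> \<in> lattice_points h. lattice_square h \<alpha> \<inter> supp w \<noteq> {}}"

definition circulation :: "real \<Rightarrow> (real^2 \<Rightarrow> real) \<Rightarrow> real^2 \<Rightarrow> real" where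
  "circulation h w \<alpha> = (LINT x:lattice_square h \<alpha>|lebesgue. w x)"

text \<open>Below, \<open>w\<close> is the regularized initial vorticity and \<open>Y \<alpha>\<close> is the position, at the time
  considered, of the vortex that started at \<open>\<alpha>\<close>.\<close>

definition blob_velocity ::
  "(real^2 \<Rightarrow> real) \<Rightarrow> real \<Rightarrow> real \<Rightarrow> (real^2 \<Rightarrow> real) \<Rightarrow> (real^2 \<Rightarrow> real^2) \<Rightarrow> real^2 \<Rightarrow> real^2" where
  "blob_velocity \<phi> \<epsilon> h w Y x =
     (\<Sum>\<alpha>\<in>blob_centers h w. circulation h w \<alpha> *\<^sub>R convolve biot_savart (rescale \<epsilon> \<phi>) (x - Y \<alpha>))"

definition blob_vorticity ::
  "(real^2 \<Rightarrow> real) \<Rightarrow> real \<Rightarrow> real \<Rightarrow> (real^2 \<Rightarrow> real) \<Rightarrow> (real^2 \<Rightarrow> real^2) \<Rightarrow> real^2 \<Rightarrow> real" where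
  "blob_vorticity \<phi> \<epsilon> h w Y x =
     (\<Sum>\<alpha>\<in>blob_centers h w. circulation h w \<alpha> * rescale \<epsilon> \<phi> (x - Y \<alpha>))"

definition blob_trajectories ::
  "real \<Rightarrow> (real^2 \<Rightarrow> real) \<Rightarrow> real \<Rightarrow> real \<Rightarrow> (real^2 \<Rightarrow> real) \<Rightarrow> (real \<Rightarrow> real^2 \<Rightarrow> real^2) \<Rightarrow> bool" where
  "blob_trajectories T \<phi> \<epsilon> h w X \<longleftrightarrow>
     (\<forall>\<alpha>\<in>blob_centers h w.
        X 0 \<alpha> = \<alpha> \<and>
        (\<forall>t\<in>{0..T}. ((\<lambda>s. X s \<alpha>) has_vector_derivative blob_velocity \<phi> \<epsilon> h w (X t) (X t \<alpha>))
                       (at t within {0..T})))"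

text \<open>Not to be confused with \<open>equiintegrable_on\<close>, which concerns gauges. The first two
  conditions say that \<open>F\<close> is a bounded family in \<open>L\<^sup>1((0,T) \<times> \<real>\<^sup>2)\<close>.\<close>

definition equi_integrable :: "real \<Rightarrow> (real \<times> (real^2) \<Rightarrow> real) set \<Rightarrow> bool" where
  "equi_integrable T F \<longleftrightarrow>
     (\<forall>f\<in>F. set_integrable lebesgue ({0<..<T} \<times> UNIV) f) \<and>
     (\<exists>B. \<forall>f\<in>F. (LINT z:{0<..<T} \<times> UNIV|lebesgue. \<bar>f z\<bar>) \<le> B) \<and>
     (\<forall>\<eta>>0. \<exists>\<gamma>>0. \<exists>R>0. \<forall>f\<in>F.
        (\<forall>A\<in>sets lebesgue. A \<subseteq> {0<..<T} \<times> UNIV \<longrightarrow> emeasure lebesgue A \<le> ennreal \<gamma> \<longrightarrow>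
           (LINT z:A|lebesgue. \<bar>f z\<bar>) \<le> \<eta>) \<and>
        (LINT z:{0<..<T} \<times> (UNIV - ball 0 R)|lebesgue. \<bar>f z\<bar>) \<le> \<eta>)"

end

theory Submission
  imports Defs
begin

text \<open>The vorticity is compared with the transport of the regularized initial vorticity \<open>w\<close> by the
  velocity field of the blobs. Instead of the flow of that field, which would have to be constructed,
  we use a map \<open>\<Phi>\<close>, the composition of sufficiently many explicit Euler steps: the field has trace-free
  derivative, so one step of length \<open>\<tau>\<close> has Jacobian \<open>1 + O(\<tau>\<^sup>2)\<close> and \<open>\<Phi>\<close> at most doubles the
  measure of preimages. The bound on \<open>h\<close> makes the vortices follow \<open>\<Phi>\<close> up to an error
  \<open>O(\<epsilon>)\<close>, whence \<open>\<bar>\<omega>\<^sup>\<epsilon>(t, x)\<bar> \<le> \<integral> \<bar>w(y)\<bar> \<psi>\<^sub>\<epsilon>(x - \<Phi>(y)) dy\<close> for a bump \<open>\<psi>\<^sub>\<epsilon>\<close> of bounded mass supported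
  in a ball of radius \<open>O(\<epsilon>)\<close>.

  Splitting \<open>w\<close> into a part bounded by \<open>L\<close> and a part that is small in \<open>L\<^sup>1\<close>, uniformly in \<open>\<epsilon>\<close>,
  the almost preservation of measure bounds the mass on small sets. For the tails, the
  velocity is dominated by an integrable function plus a constant, so \<open>\<integral> q \<bar>\<Phi> - id\<bar>\<close> is bounded for the
  bounded part \<open>q\<close>, and Chebyshev's inequality applies.\<close>

subsection \<open>Change of variables\<close>

text \<open>The kernel is homogeneous of degree -1, so mollification at scale
  \<open>\<epsilon>\<close> yields a field with gradient of order
  \<open>1 / \<epsilon>\<^sup>2\<close>, and Gronwall over time \<open>T\<close> costs the
  exponential of a constant over \<open>\<epsilon>\<^sup>2\<close>. The bound on \<open>h\<close>
  has the shape that cancels this factor. Every bound that must be uniform in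
  \<open>\<epsilon>\<close> therefore has to avoid the Lipschitz constant. The number of Euler steps
  may depend on \<open>\<epsilon>\<close>, on the time and on the trajectories, since no final bound
  contains it. The speed near a vortex may grow like \<open>1 / \<epsilon>\<close>, so displacement
  is controlled only on average against a bounded density; the concentrated part of the vorticity is
  not followed at all, its small mass suffices. That the derivative is trace-free is not read off
  from the singular kernel. It follows from symmetry: a reflection of the plane leaves the radial
  mollifier unchanged and reverses the kernel.\<close>

lemma emeasure_vimage_injective_differentiable_le:
  fixes f :: "real^'n::{finite,wellorder} \<Rightarrow> real^'n::_"
  assumes der: "\<And>x. (f has_derivative f' x) (at x)"
    and inj: "inj f" and "0 < d" and d: "\<And>x. d \<le> \<bar>det (matrix (f' x))\<bar>"
    and B: "B \<in> sets borel"
  shows "ennreal d * emeasure lborel (f -` B) \<le> emeasure lborel B"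
proof (cases "emeasure lborel B = \<infinity>")
  case False
  have cont: "continuous_on UNIV f"
    by (meson der continuous_at_imp_continuous_on has_derivative_continuous)
  then have [measurable]: "f \<in> borel_measurable borel"
    by (rule borel_measurable_continuous_onI)
  define A where "A = f -` B"
  have A: "A \<in> sets borel"
    unfolding A_def using measurable_sets_borel[OF \<open>f \<in> borel_measurable borel\<close> B] .
  then have Al: "A \<in> sets lebesgue" by simp
  have derA: "\<And>x. x \<in> A \<Longrightarrow> (f has_derivative f' x) (at x within A)"
    using der has_derivative_at_withinI by blast
  have Bm: "B \<in> lmeasurable"
    using B False by (intro fmeasurableI) (auto simp: top.not_eq_extremum)
  have "f ` A \<in> sets lebesgue"
    using derA Al by (intro differentiable_image_in_sets_lebesgue)
      (auto simp: differentiable_on_def differentiable_def)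
  moreover have sub: "f ` A \<subseteq> B" by (auto simp: A_def)
  ultimately have fA: "f ` A \<in> lmeasurable"
    using Bm fmeasurableI2 by blast
  have injA: "inj_on f A" using inj inj_on_subset by blast
  have int: "(\<lambda>x. \<bar>det (matrix (f' x))\<bar>) integrable_on A"
    using measurable_differentiable_image_eq[OF Al derA injA] fA by simp
  \<comment> \<open>Finiteness of the measure of \<open>A\<close> is not known in advance. On
    \<open>A\<close> the constant \<open>d\<close> is dominated by the Jacobian, which is integrable
    because the image of \<open>A\<close> lies in \<open>B\<close>.\<close>
  have "(\<lambda>x. d) absolutely_integrable_on A"
    using int d \<open>0 < d\<close> Al
    by (intro measurable_bounded_by_integrable_imp_absolutely_integrable[OF _ _ int]) auto
  then have "(\<lambda>x. (1/d) *\<^sub>R d) absolutely_integrable_on A"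
    by (rule absolutely_integrable_scaleR_left)
  then have Am: "A \<in> lmeasurable"
    using \<open>0 < d\<close> by (auto simp: lmeasurable_iff_integrable_on absolutely_integrable_on_def)
  have "d * measure lebesgue A = integral A (\<lambda>x. d)"
    using Am by (simp add: lmeasure_integral flip: integral_mult_right)
  also have "\<dots> \<le> integral A (\<lambda>x. \<bar>det (matrix (f' x))\<bar>)"
    by (rule integral_le) (use d int integrable_on_const[OF Am] in auto)
  also have "\<dots> = measure lebesgue (f ` A)"
    using measure_differentiable_image_eq[OF Al derA injA int] by simp
  also have "\<dots> \<le> measure lebesgue B"
    using sub fA Bm by (intro measure_mono_fmeasurable) auto
  finally have "ennreal (d * measure lebesgue A) \<le> ennreal (measure lebesgue B)"
    by (rule ennreal_leI)
  then have "ennreal d * emeasure lebesgue A \<le> emeasure lebesgue B"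
    using \<open>0 < d\<close> Am Bm by (simp add: ennreal_mult emeasure_eq_measure2)
  then show ?thesis using A B by (simp add: A_def)
qed simp

text \<open>The estimate on preimages compares the push-forward of \<open>lborel\<close> with a
  multiple of \<open>lborel\<close> as measures, and the nonnegative integral is monotone in the
  measure.\<close>

lemma nn_integral_injective_differentiable_le:
  fixes f :: "real^'n::{finite,wellorder} \<Rightarrow> real^'n::_"
  assumes der: "\<And>x. (f has_derivative f' x) (at x)"
    and inj: "inj f" and "0 < d" and d: "\<And>x. d \<le> \<bar>det (matrix (f' x))\<bar>"
    and F: "F \<in> borel_measurable borel"
  shows "(\<integral>\<^sup>+x. F (f x) \<partial>lborel) \<le> ennreal (1 / d) * (\<integral>\<^sup>+x. F x \<partial>lborel)"
proof -
  have cont: "continuous_on UNIV f"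
    by (meson der continuous_at_imp_continuous_on has_derivative_continuous)
  then have fm[measurable]: "f \<in> borel_measurable borel"
    by (rule borel_measurable_continuous_onI)
  have "emeasure lborel (f -` B) \<le> ennreal (1 / d) * emeasure lborel B" if "B \<in> sets borel" for B
  proof -
    have "ennreal (1 / d) * (ennreal d * emeasure lborel (f -` B)) \<le> ennreal (1 / d) * emeasure lborel B"
      by (intro mult_left_mono emeasure_vimage_injective_differentiable_le[OF der inj \<open>0 < d\<close> d that]) simp
    moreover have "ennreal (1 / d) * ennreal d = 1"
      using \<open>0 < d\<close> by (simp flip: ennreal_mult)
    ultimately show ?thesis by (simp flip: mult.assoc)
  qed
  then have le: "distr lborel borel f \<le> scale_measure (ennreal (1 / d)) lborel"
    by (intro le_measure[THEN iffD2]) (auto simp: le_fun_def emeasure_distr)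
  have "(\<integral>\<^sup>+x. F (f x) \<partial>lborel) = nn_integral (distr lborel borel f) F"
    using F by (subst nn_integral_distr) auto
  also have "\<dots> \<le> nn_integral (scale_measure (ennreal (1 / d)) lborel) F"
    by (rule nn_integral_mono_measure[OF _ le]) simp
  also have "\<dots> = ennreal (1 / d) * (\<integral>\<^sup>+x. F x \<partial>lborel)"
    using F by (simp add: nn_integral_scale_measure)
  finally show ?thesis .
qed

text \<open>The inequality for preimages is enough: it is applied to \<open>B\<close> and to the
  preimage of \<open>B\<close>, whose own preimage is \<open>B\<close> again.\<close>

lemma distr_lborel_linear_involution:
  fixes S :: "real^'n::{finite,wellorder} \<Rightarrow> real^'n::_"
  assumes "orthogonal_transformation S" "\<And>x. S (S x) = x"
  shows "distr lborel borel S = lborel"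
proof (rule measure_eqI)
  have lin: "linear S" using assms by (simp add: orthogonal_transformation_linear)
  then have [measurable]: "S \<in> borel_measurable borel"
    by (simp add: borel_measurable_continuous_onI linear_continuous_on linear_conv_bounded_linear)
  have inj: "inj S" by (metis assms(2) injI)
  have det: "1 \<le> \<bar>det (matrix S)\<bar>"
    using assms(1) by (simp add: orthogonal_transformation_det)
  have le: "emeasure lborel (S -` B) \<le> emeasure lborel B" if "B \<in> sets borel" for B
    using emeasure_vimage_injective_differentiable_le[of S "\<lambda>_. S" 1 B] lin inj det that
    by (simp add: linear_imp_has_derivative)
  show "emeasure (distr lborel borel S) B = emeasure lborel B"
    if "B \<in> sets (distr lborel borel S)" for B
  proof -
    have B: "B \<in> sets borel" using that by simp
    have SB: "S -` B \<in> sets borel" using measurable_sets_borel[OF \<open>S \<in> borel_measurable borel\<close> B] .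
    have "S -` (S -` B) = B" using assms(2) by auto
    then show ?thesis using le[OF B] le[OF SB] B by (simp add: emeasure_distr antisym)
  qed
qed simp

subsection \<open>The Biot--Savart kernel\<close>

lemma norm_real2: "norm (x :: real^2) = sqrt ((x $ 1)\<^sup>2 + (x $ 2)\<^sup>2)"
  by (simp add: norm_vec_def L2_set_def UNIV_2)

lemma inner_real2: "(x :: real^2) \<bullet> y = x $ 1 * y $ 1 + x $ 2 * y $ 2"
  by (simp add: inner_vec_def UNIV_2)

lemma vec2_eq_iff: "(x :: 'a^2) = y \<longleftrightarrow> x $ 1 = y $ 1 \<and> x $ 2 = y $ 2"
  by (simp add: vec_eq_iff forall_2)

lemma norm_biot_savart: "norm (biot_savart x) = 1 / (2 * pi * norm x)"
proof -
  have "norm (vector [- x $ 2, x $ 1] :: real^2) = norm x"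
    by (simp add: norm_real2)
  then show ?thesis
    by (simp add: biot_savart_def power2_eq_square field_simps)
qed

lemma borel_measurable_vector2 [measurable]:
  fixes f g :: "'a \<Rightarrow> real"
  assumes [measurable]: "f \<in> borel_measurable M" "g \<in> borel_measurable M"
  shows "(\<lambda>x. vector [f x, g x] :: real^2) \<in> borel_measurable M"
proof -
  have "(\<lambda>x. vector [f x, g x] :: real^2) = (\<lambda>x. f x *\<^sub>R axis 1 1 + g x *\<^sub>R axis 2 1)"
    by (auto simp: vec2_eq_iff axis_def)
  then show ?thesis by simp
qed

lemma borel_measurable_nth [measurable]: "(\<lambda>x :: real^2. x $ i) \<in> borel_measurable borel"
  by (intro borel_measurable_continuous_onI continuous_intros)

lemma sets_cball [measurable]: "cball c r \<in> sets borel"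
  by simp

lemma borel_measurable_biot_savart [measurable]: "biot_savart \<in> borel_measurable borel"
  unfolding biot_savart_def by measurable

lemma emeasure_cball_real2:
  "0 \<le> r \<Longrightarrow> emeasure lborel (cball (c :: real^2) r) = ennreal (pi * r\<^sup>2)"
  by (simp add: emeasure_cball unit_ball_vol_2)

definition near_kernel :: "real^2 \<Rightarrow> ennreal" where
  "near_kernel x = indicator (cball 0 1) x * ennreal (norm (biot_savart x))"

text \<open>\<open>enn2real\<close> would turn an infinite integral into 0; the value is the true
  one because finiteness is proved below.\<close>

definition near_mass :: real where
  "near_mass = enn2real (\<integral>\<^sup>+x. near_kernel x \<partial>lborel)"

lemma borel_measurable_near_kernel [measurable]: "near_kernel \<in> borel_measurable borel"
  unfolding near_kernel_def by measurable

text \<open>Dyadic shells: on the shell \<open>2\<^sup>-\<^sup>n\<^sup>-\<^sup>1 < \<bar>x\<bar> \<le> 2\<^sup>-\<^sup>n\<close> the kernel is at most \<open>2\<^sup>n\<close>, while the area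
  of the shell is of order \<open>4\<^sup>-\<^sup>n\<close>.\<close>

lemma near_kernel_le_dyadic:
  "near_kernel x \<le> (\<Sum>n. ennreal (2 ^ n) * indicator (cball 0 ((1/2) ^ n)) x)"
proof (cases "x \<in> cball 0 1 - {0}")
  case True
  then have x: "0 < norm x" "norm x \<le> 1" by auto
  obtain m where m: "(1/2::real) ^ m < norm x"
    using real_arch_pow_inv[of "norm x" "1/2"] x by auto
  \<comment> \<open>Since \<open>x\<close> has norm at most 1, the minimal exponent is positive, and
    its predecessor \<open>k\<close> is the index of the dyadic shell containing
    \<open>x\<close>.\<close>
  define n where "n = (LEAST m. (1/2::real) ^ m < norm x)"
  have n: "(1/2::real) ^ n < norm x" unfolding n_def by (rule LeastI[of _ m]) (use m in auto)
  have "n \<noteq> 0" using n x by (auto intro: ccontr)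
  then obtain k where k: "n = Suc k" by (cases n) auto
  have le: "norm x \<le> (1/2) ^ k"
    using not_less_Least[of k "\<lambda>m. (1/2::real) ^ m < norm x"] k by (simp add: n_def[symmetric])
  have "norm (biot_savart x) \<le> 1 / (2 * norm x)"
    unfolding norm_biot_savart using x pi_ge_two by (intro divide_left_mono) auto
  also have "\<dots> \<le> 2 ^ k"
    using n x by (simp add: k field_simps power_divide)
  finally have "near_kernel x \<le> ennreal (2 ^ k)"
    using True by (simp add: near_kernel_def ennreal_leI)
  also have "\<dots> = (\<Sum>n\<in>{k}. ennreal (2 ^ n) * indicator (cball 0 ((1/2) ^ n)) x)"
    using le by simp
  also have "\<dots> \<le> (\<Sum>n. ennreal (2 ^ n) * indicator (cball 0 ((1/2) ^ n)) x)"
    by (intro sum_le_suminf) auto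
  finally show ?thesis .
\<comment> \<open>At the origin the kernel is 0 by the convention for division by zero.\<close>
qed (auto simp: near_kernel_def norm_biot_savart)

lemma nn_integral_near_kernel_finite: "(\<integral>\<^sup>+x. near_kernel x \<partial>lborel) < \<infinity>"
proof -
  have "(\<integral>\<^sup>+x. near_kernel x \<partial>lborel) \<le>
      (\<integral>\<^sup>+x. (\<Sum>n. ennreal (2 ^ n) * indicator (cball 0 ((1/2) ^ n) :: (real^2) set) x) \<partial>lborel)"
    by (intro nn_integral_mono near_kernel_le_dyadic)
  also have "\<dots> = (\<Sum>n. \<integral>\<^sup>+x. ennreal (2 ^ n) * indicator (cball 0 ((1/2) ^ n) :: (real^2) set) x \<partial>lborel)"
    by (rule nn_integral_suminf) auto
  also have "\<dots> = (\<Sum>n. ennreal (pi * (1/2) ^ n))"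
  proof (rule suminf_cong)
    fix n
    have "2 ^ n * (pi * ((1/2) ^ n)\<^sup>2) = pi * (1/2 :: real) ^ n"
      by (simp add: power2_eq_square power_divide)
    then show "(\<integral>\<^sup>+x. ennreal (2 ^ n) * indicator (cball 0 ((1/2) ^ n) :: (real^2) set) x \<partial>lborel)
        = ennreal (pi * (1/2) ^ n)"
      by (simp add: nn_integral_cmult_indicator emeasure_cball_real2 flip: ennreal_mult)
  qed
  also have "\<dots> = ennreal (\<Sum>n. pi * (1/2) ^ n)"
    by (rule suminf_ennreal2) (auto intro: summable_mult)
  finally show ?thesis by (simp add: order_le_less_trans)
qed

lemma near_mass_nonneg: "0 \<le> near_mass"
  by (simp add: near_mass_def)

lemma nn_integral_near_kernel: "(\<integral>\<^sup>+x. near_kernel x \<partial>lborel) = ennreal near_mass"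
  using nn_integral_near_kernel_finite by (simp add: near_mass_def)

lemma norm_biot_savart_le: "ennreal (norm (biot_savart x)) \<le> near_kernel x + 1"
proof (cases "norm x \<le> 1")
  case False
  then have "0 < pi * norm x" by (intro mult_pos_pos) auto
  then have "1 / (2 * pi * norm x) \<le> 1 / (2 * 2 * 1)"
    using False pi_ge_two by (intro divide_left_mono mult_mono) auto
  then have "norm (biot_savart x) \<le> 1" by (simp add: norm_biot_savart)
  then have "ennreal (norm (biot_savart x)) \<le> 1" by (metis ennreal_1 ennreal_leI)
  then show ?thesis by (simp add: add_increasing)
qed (simp add: near_kernel_def)

text \<open>The summand \<open>4 * pi\<close> is the area of a ball of radius 2. This radius lets
  the unit support of the mollifier move by less than 1 without leaving the ball.\<close>

definition local_mass :: real where
  "local_mass = near_mass + 4 * pi"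

lemma nn_integral_biot_savart_cball:
  "(\<integral>\<^sup>+y. indicator (cball x 2) y * ennreal (norm (biot_savart y)) \<partial>lborel) \<le> ennreal local_mass"
proof -
  have "(\<integral>\<^sup>+y. indicator (cball x 2) y * ennreal (norm (biot_savart y)) \<partial>lborel)
      \<le> (\<integral>\<^sup>+y. near_kernel y + indicator (cball x 2) y \<partial>lborel)"
    using norm_biot_savart_le by (intro nn_integral_mono) (auto simp: indicator_def)
  also have "\<dots> = ennreal near_mass + emeasure lborel (cball x 2)"
    by (subst nn_integral_add) (auto simp: nn_integral_near_kernel)
  also have "\<dots> = ennreal local_mass"
    using near_mass_nonneg by (simp add: emeasure_cball_real2 local_mass_def mult.commute flip: ennreal_plus)
  finally show ?thesis .
qed

text \<open>The single estimate against the singular kernel that differentiation uses: it serves the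
  mollifier, its directional derivatives and its first-order remainder alike.\<close>

lemma integrable_times_biot_savart:
  fixes g :: "real^2 \<Rightarrow> real"
  assumes g[measurable]: "g \<in> borel_measurable borel"
    and B: "\<And>y. \<bar>g y\<bar> \<le> B" and z: "\<And>y. 2 < dist x y \<Longrightarrow> g y = 0"
  shows "integrable lborel (\<lambda>y. g y *\<^sub>R biot_savart y)"
    and "norm (LINT y|lborel. g y *\<^sub>R biot_savart y) \<le> B * local_mass"
proof -
  have B0: "0 \<le> B" using B[of x] by simp
  have "(\<integral>\<^sup>+y. ennreal (norm (g y *\<^sub>R biot_savart y)) \<partial>lborel) \<le>
      (\<integral>\<^sup>+y. ennreal B * (indicator (cball x 2) y * ennreal (norm (biot_savart y))) \<partial>lborel)"
  proof (rule nn_integral_mono)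
    fix y
    show "ennreal (norm (g y *\<^sub>R biot_savart y)) \<le>
        ennreal B * (indicator (cball x 2) y * ennreal (norm (biot_savart y)))"
    proof (cases "y \<in> cball x 2")
      case True
      then show ?thesis using B0 B[of y]
        by (auto simp flip: ennreal_mult intro!: ennreal_leI mult_right_mono)
    qed (use z in auto)
  qed
  also have "\<dots> = ennreal B * (\<integral>\<^sup>+y. indicator (cball x 2) y * ennreal (norm (biot_savart y)) \<partial>lborel)"
    by (rule nn_integral_cmult) measurable
  also have "\<dots> \<le> ennreal B * ennreal local_mass"
    by (intro mult_left_mono nn_integral_biot_savart_cball) auto
  also have "\<dots> = ennreal (B * local_mass)"
    using B0 near_mass_nonneg by (simp add: ennreal_mult local_mass_def)
  finally have le: "(\<integral>\<^sup>+y. ennreal (norm (g y *\<^sub>R biot_savart y)) \<partial>lborel) \<le> ennreal (B * local_mass)" .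
  show int: "integrable lborel (\<lambda>y. g y *\<^sub>R biot_savart y)"
    by (rule integrableI_bounded) (use le in \<open>auto simp: order_le_less_trans\<close>)
  have "ennreal (norm (LINT y|lborel. g y *\<^sub>R biot_savart y)) \<le> ennreal (B * local_mass)"
    using integral_norm_bound_ennreal[OF int] le by simp
  then show "norm (LINT y|lborel. g y *\<^sub>R biot_savart y) \<le> B * local_mass"
    using B0 near_mass_nonneg by (simp add: local_mass_def)
qed

lemma distr_lborel_minus: "distr lborel borel (\<lambda>y. x - y) = (lborel :: 'a::euclidean_space measure)"
  using lborel_affine[of "-1" x] by (simp add: density_1)

lemma distr_lborel_translation: "distr lborel borel (\<lambda>y. y + x) = (lborel :: 'a::euclidean_space measure)"
  using lborel_affine[of 1 x] by (simp add: density_1 add.commute)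

lemma integral_lborel_minus:
  fixes f :: "'a::euclidean_space \<Rightarrow> 'b::{banach, second_countable_topology}"
  assumes [measurable]: "f \<in> borel_measurable borel"
  shows "(LINT y|lborel. f (x - y)) = (LINT y|lborel. f y)"
  by (subst (2) distr_lborel_minus[of x, symmetric]) (simp add: integral_distr)

lemma nn_integral_lborel_minus:
  fixes f :: "'a::euclidean_space \<Rightarrow> ennreal"
  assumes [measurable]: "f \<in> borel_measurable borel"
  shows "(\<integral>\<^sup>+y. f (x - y) \<partial>lborel) = (\<integral>\<^sup>+y. f y \<partial>lborel)"
  by (subst (2) distr_lborel_minus[of x, symmetric]) (simp add: nn_integral_distr)

lemma nn_integral_lborel_translation:
  fixes f :: "'a::euclidean_space \<Rightarrow> ennreal"
  assumes [measurable]: "f \<in> borel_measurable borel"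
  shows "(\<integral>\<^sup>+y. f (y - x) \<partial>lborel) = (\<integral>\<^sup>+y. f y \<partial>lborel)"
  by (subst (2) distr_lborel_translation[of "-x", symmetric]) (simp add: nn_integral_distr)

text \<open>With the shift moved onto \<open>g\<close>, differentiation falls on the smooth factor
  while the singular one stays fixed.\<close>

lemma convolve_lborel:
  assumes [measurable]: "f \<in> borel_measurable borel" "g \<in> borel_measurable borel"
  shows "convolve f g x = (LINT y|lborel. g (x - y) *\<^sub>R f y)"
proof -
  have "convolve f g x = (LINT y|lborel. g y *\<^sub>R f (x - y))"
    unfolding convolve_def by (subst integral_completion) auto
  also have "\<dots> = (LINT y|lborel. g (x - y) *\<^sub>R f (x - (x - y)))"
    by (rule integral_lborel_minus[symmetric]) measurable
  finally show ?thesis by simp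
qed

lemma standard_mollifier_outside:
  assumes "standard_mollifier \<phi>" "1 < norm x"
  shows "\<phi> x = 0"
proof (rule ccontr)
  assume "\<phi> x \<noteq> 0"
  then have "x \<in> supp \<phi>"
    unfolding supp_def using closure_subset[of "support_on UNIV \<phi>"] by (auto simp: in_support_on)
  moreover have "supp \<phi> \<subseteq> cball 0 1" using assms(1) unfolding standard_mollifier_def by blast
  ultimately show False using assms(2) by auto
qed

text \<open>\<open>C_k\<close> provides continuity of the derivative in each fixed direction only,
  so a continuous gradient is assembled from the two partial derivatives. It vanishes outside the
  closed unit ball because the mollifier is 0 near each such point, and compactness then bounds
  it.\<close>

lemma standard_mollifier_gradient:
  assumes \<phi>: "standard_mollifier \<phi>"
  obtains G :: "real^2 \<Rightarrow> real^2" and L where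
    "\<And>x. (\<phi> has_derivative (\<lambda>v. G x \<bullet> v)) (at x)" "continuous_on UNIV G"
    "\<And>x. 1 < norm x \<Longrightarrow> G x = 0" "\<And>x. norm (G x) \<le> L"
proof -
  have "C_k (Suc 0) \<phi>" using \<phi> unfolding standard_mollifier_def smooth_def by blast
  then have diff: "\<And>x. \<phi> differentiable (at x)"
    and cont: "\<And>v. continuous_on UNIV (\<lambda>x. frechet_derivative \<phi> (at x) v)"
    by auto
  define G :: "real^2 \<Rightarrow> real^2" where "G x = (\<chi> i. frechet_derivative \<phi> (at x) (axis i 1))" for x
  have der: "(\<phi> has_derivative (\<lambda>v. G x \<bullet> v)) (at x)" for x
  proof -
    have d: "(\<phi> has_derivative frechet_derivative \<phi> (at x)) (at x)"
      using diff frechet_derivative_works by blast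
    then have lin: "linear (frechet_derivative \<phi> (at x))"
      by (rule has_derivative_linear)
    have "frechet_derivative \<phi> (at x) v = G x \<bullet> v" for v
    proof -
      have "v = v $ 1 *\<^sub>R axis 1 1 + v $ 2 *\<^sub>R axis 2 1"
        by (simp add: vec2_eq_iff axis_def)
      then have "frechet_derivative \<phi> (at x) v =
          frechet_derivative \<phi> (at x) (v $ 1 *\<^sub>R axis 1 1 + v $ 2 *\<^sub>R axis 2 1)" by simp
      also have "\<dots> = G x \<bullet> v"
        by (simp add: linear_add[OF lin] linear_scale[OF lin] G_def inner_real2 mult.commute)
      finally show ?thesis .
    qed
    then have "frechet_derivative \<phi> (at x) = (\<lambda>v. G x \<bullet> v)" by (rule ext)
    then show ?thesis using d by simp
  qed
  have Gcont: "continuous_on UNIV G"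
    unfolding G_def by (intro continuous_on_vec_lambda cont)
  have G0: "G x = 0" if "1 < norm x" for x
  proof -
    have "open (- cball (0 :: real^2) 1)" by (simp add: open_Compl)
    then have "((\<lambda>_. 0) has_derivative (\<lambda>v. G x \<bullet> v)) (at x)"
      using has_derivative_transform_within_open[OF der[of x], where s = "- cball 0 1" and g = "\<lambda>_. 0"]
        standard_mollifier_outside[OF \<phi>] that by auto
    then have "(\<lambda>v. G x \<bullet> v) = (\<lambda>v. 0)"
      by (rule has_derivative_unique) (rule has_derivative_const)
    from fun_cong[OF this, of "G x"] show ?thesis by simp
  qed
  have "compact (G ` cball 0 1)"
    by (intro compact_continuous_image continuous_on_subset[OF Gcont]) auto
  then have "bounded (G ` cball 0 1)" by (rule compact_imp_bounded)
  then obtain L where "\<forall>y\<in>G ` cball 0 1. norm y \<le> L"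
    unfolding bounded_iff by blast
  then have L: "\<And>x. x \<in> cball 0 1 \<Longrightarrow> norm (G x) \<le> L" by blast
  have "0 \<le> L" using L[of 0] by (simp add: order_trans[OF norm_ge_zero])
  then have "norm (G x) \<le> L" for x
    using L[of x] G0[of x] by (cases "norm x \<le> 1") auto
  from that[OF der Gcont G0 this] show thesis .
qed

lemma standard_mollifier_borel:
  assumes "standard_mollifier \<phi>"
  shows "\<phi> \<in> borel_measurable borel"
proof -
  have "C_k 0 \<phi>" using assms unfolding standard_mollifier_def smooth_def by blast
  then show ?thesis by (simp add: borel_measurable_continuous_onI)
qed

lemma standard_mollifier_bounded:
  assumes \<phi>: "standard_mollifier \<phi>"
  obtains B where "\<And>x. \<bar>\<phi> x\<bar> \<le> B"
proof -
  have "C_k 0 \<phi>" using assms unfolding standard_mollifier_def smooth_def by blast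
  then have c: "continuous_on UNIV \<phi>" by simp
  have "bounded (\<phi> ` cball 0 1)"
    by (intro compact_imp_bounded compact_continuous_image continuous_on_subset[OF c]) auto
  moreover have "range \<phi> \<subseteq> insert 0 (\<phi> ` cball 0 1)"
    using standard_mollifier_outside[OF \<phi>] by (force simp: not_le)
  ultimately have "bounded (range \<phi>)" using bounded_insert bounded_subset by blast
  then show thesis using that by (auto simp: bounded_iff)
qed

lemma integrable_mollifier_biot_savart:
  assumes \<phi>: "standard_mollifier \<phi>"
  shows "integrable lborel (\<lambda>y. \<phi> (x - y) *\<^sub>R biot_savart y)"
proof -
  note [measurable] = standard_mollifier_borel[OF \<phi>]
  obtain B where B: "\<And>x. \<bar>\<phi> x\<bar> \<le> B" using standard_mollifier_bounded[OF \<phi>] by blast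
  show ?thesis
    by (rule integrable_times_biot_savart[where x = x and B = B])
      (use B standard_mollifier_outside[OF \<phi>] in \<open>auto simp: dist_norm\<close>)
qed

section \<open>Differentiability of the mollified kernel\<close>

lemma compact_support_uniformly_continuous:
  fixes G :: "'a::euclidean_space \<Rightarrow> 'b::metric_space"
  assumes cont: "continuous_on UNIV G" and z: "\<And>x. r < norm x \<Longrightarrow> G x = c" and "0 < e"
  obtains d where "0 < d" "\<And>x y. dist x y < d \<Longrightarrow> dist (G x) (G y) < e"
proof -
  have "uniformly_continuous_on (cball 0 (r + 2)) G"
    by (intro compact_uniformly_continuous continuous_on_subset[OF cont]) auto
  then obtain d where d: "0 < d"
    "\<And>x y. x \<in> cball 0 (r + 2) \<Longrightarrow> y \<in> cball 0 (r + 2) \<Longrightarrow> dist y x < d \<Longrightarrow> dist (G y) (G x) < e"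
    using \<open>0 < e\<close> unfolding uniformly_continuous_on_def by metis
  show thesis
  \<comment> \<open>Two points at distance less than 1 either both lie in the ball of radius
    \<open>r + 2\<close> or both lie where \<open>G\<close> is constant.\<close>
  proof (rule that[of "min d 1"])
    fix x y :: 'a assume xy: "dist x y < min d 1"
    then have n: "norm x \<le> norm y + 1" "norm y \<le> norm x + 1"
      using norm_triangle_ineq2[of x y] norm_triangle_ineq2[of y x] by (auto simp: dist_norm norm_minus_commute)
    show "dist (G x) (G y) < e"
    proof (cases "norm x \<le> r + 1")
      case True
      then show ?thesis using d(2)[of y x] xy n by auto
    next
      case False
      then show ?thesis using z[of x] z[of y] n \<open>0 < e\<close> by auto
    qed
  qed (use d in auto)
qed

text \<open>The mean value inequality for \<open>\<phi>\<close> minus its linear part at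
  \<open>a\<close>, a function with gradient \<open>G z - G a\<close>.\<close>

lemma gradient_remainder_le:
  fixes \<phi> :: "'a::real_inner \<Rightarrow> real"
  assumes der: "\<And>x. (\<phi> has_derivative (\<lambda>v. G x \<bullet> v)) (at x)"
    and close: "\<And>z. dist z a \<le> norm v \<Longrightarrow> norm (G z - G a) \<le> e"
  shows "\<bar>\<phi> (a + v) - \<phi> a - G a \<bullet> v\<bar> \<le> norm v * e"
proof -
  define g where "g z = \<phi> z - G a \<bullet> z" for z
  have "norm (g (a + v) - g a) \<le> e * norm (a + v - a)"
  proof (rule differentiable_bound[of "cball a (norm v)" g "\<lambda>z u. (G z - G a) \<bullet> u"])
    fix z assume "z \<in> cball a (norm v)"
    then have z: "norm (G z - G a) \<le> e" by (intro close) (simp add: dist_commute)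
    have "(g has_derivative (\<lambda>u. G z \<bullet> u - G a \<bullet> u)) (at z)"
      unfolding g_def by (intro has_derivative_diff der has_derivative_inner_right has_derivative_ident)
    then show "(g has_derivative (\<lambda>u. (G z - G a) \<bullet> u)) (at z within cball a (norm v))"
      by (simp add: inner_diff_left has_derivative_at_withinI)
    have "onorm (\<lambda>u. (G z - G a) \<bullet> u) \<le> norm (G z - G a)"
      by (intro onorm_bound) (simp_all add: Cauchy_Schwarz_ineq2)
    then show "onorm (\<lambda>u. (G z - G a) \<bullet> u) \<le> e" using z by simp
  qed (auto simp: dist_norm)
  then show ?thesis by (simp add: g_def inner_add_right algebra_simps)
qed

text \<open>The derivative integrates the kernel against the directional derivative of the
  mollifier. Uniform continuity of the gradient makes the first-order remainder uniformly small, and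
  for increments shorter than 1 it is supported within distance 2 of \<open>x\<close>, so the bound
  with \<open>local_mass\<close> applies to it.\<close>

lemma has_derivative_convolve_biot_savart:
  assumes \<phi>: "standard_mollifier \<phi>"
  obtains A :: "real^2 \<Rightarrow> real^2 \<Rightarrow> real^2" and C where
    "0 \<le> C" "\<And>x. (convolve biot_savart \<phi> has_derivative A x) (at x)" "\<And>x v. norm (A x v) \<le> C * norm v"
proof -
  obtain G L where der: "\<And>x. (\<phi> has_derivative (\<lambda>v. G x \<bullet> v)) (at x)" and cont: "continuous_on UNIV G"
    and G0: "\<And>x. 1 < norm x \<Longrightarrow> G x = 0" and L: "\<And>x. norm (G x) \<le> L"
    using standard_mollifier_gradient[OF \<phi>] by metis
  note [measurable] = standard_mollifier_borel[OF \<phi>] borel_measurable_continuous_onI[OF cont]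
  have \<phi>0: "\<phi> x = 0" if "1 < norm x" for x
    using standard_mollifier_outside[OF \<phi> that] .
  have L0: "0 \<le> L" using L[of 0] by (simp add: order_trans[OF norm_ge_zero])
  have lm0: "0 < local_mass" by (simp add: local_mass_def near_mass_nonneg add_nonneg_pos)
  obtain B where B: "\<And>x. \<bar>\<phi> x\<bar> \<le> B" using standard_mollifier_bounded[OF \<phi>] by blast
  define A where "A x v = (LINT y|lborel. (G (x - y) \<bullet> v) *\<^sub>R biot_savart y)" for x v
  have far: "1 < norm (x - y)" if "2 < dist x y" for x y :: "real^2"
    using that by (simp add: dist_norm)
  have farv: "1 < norm (x + v - y)" if "2 < dist x y" "norm v < 1" for x y v :: "real^2"
    using that norm_triangle_ineq2[of "x - y" "-v"] by (simp add: dist_norm algebra_simps)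
  have GB: "\<bar>G z \<bullet> v\<bar> \<le> L * norm v" for z v
    using Cauchy_Schwarz_ineq2[of "G z" v] L[of z] mult_right_mono[of "norm (G z)" L "norm v"] by simp
  have Aint: "integrable lborel (\<lambda>y. (G (x - y) \<bullet> v) *\<^sub>R biot_savart y)" for x v
    by (rule integrable_times_biot_savart[where x = x and B = "L * norm v"])
      (use GB G0 far in \<open>auto\<close>)
  have \<phi>int: "integrable lborel (\<lambda>y. \<phi> (x + v - y) *\<^sub>R biot_savart y)" if "norm v < 1" for x v
    by (rule integrable_times_biot_savart[where x = x and B = B])
      (use B \<phi>0 farv that in \<open>auto\<close>)
  have Abound: "norm (A x v) \<le> (L * local_mass) * norm v" for x v
    using integrable_times_biot_savart(2)[where x = x and B = "L * norm v" and g = "\<lambda>y. G (x - y) \<bullet> v"]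
      GB G0 far by (auto simp: A_def ac_simps)
  have Alin: "linear (A x)" for x
  proof (rule linearI)
    show "A x (b + c) = A x b + A x c" for b c
      using Aint by (simp add: A_def inner_add_right scaleR_add_left)
    show "A x (r *\<^sub>R b) = r *\<^sub>R A x b" for r b
      unfolding A_def inner_scaleR_right scaleR_scaleR[symmetric] by (rule integral_scaleR_right)
  qed
  have "(convolve biot_savart \<phi> has_derivative A x) (at x)" for x
    unfolding has_derivative_at_alt
  proof (intro conjI allI impI)
    show "bounded_linear (A x)" using Alin linear_conv_bounded_linear by blast
    fix e :: real assume "0 < e"
    \<comment> \<open>The tolerance is divided by the factor that the integral against the kernel
      will restore.\<close>
    then have e': "0 < e / local_mass" using lm0 by simp
    obtain d where d: "0 < d" "\<And>x y. dist x y < d \<Longrightarrow> dist (G x) (G y) < e / local_mass"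
      using compact_support_uniformly_continuous[OF cont G0 e'] by metis
    show "\<exists>d>0. \<forall>y. norm (y - x) < d \<longrightarrow>
        norm (convolve biot_savart \<phi> y - convolve biot_savart \<phi> x - A x (y - x)) \<le> e * norm (y - x)"
    proof (intro exI[of _ "min d 1"] conjI allI impI)
      fix y assume y: "norm (y - x) < min d 1"
      define v where "v = y - x"
      define g where "g z = \<phi> (x + v - z) - \<phi> (x - z) - G (x - z) \<bullet> v" for z
      have "convolve biot_savart \<phi> y - convolve biot_savart \<phi> x - A x (y - x) =
          (LINT z|lborel. \<phi> (x + v - z) *\<^sub>R biot_savart z) - (LINT z|lborel. \<phi> (x + 0 - z) *\<^sub>R biot_savart z) -
          (LINT z|lborel. (G (x - z) \<bullet> v) *\<^sub>R biot_savart z)"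
        by (simp add: convolve_lborel A_def v_def)
      also have "\<dots> = (LINT z|lborel. g z *\<^sub>R biot_savart z)"
        using y Aint[of x v] \<phi>int[of v x] \<phi>int[of 0 x]
        by (simp add: g_def v_def scaleR_diff_left)
      finally have eq: "convolve biot_savart \<phi> y - convolve biot_savart \<phi> x - A x (y - x) =
        (LINT z|lborel. g z *\<^sub>R biot_savart z)" .
      have "norm (LINT z|lborel. g z *\<^sub>R biot_savart z) \<le> (norm v * (e / local_mass)) * local_mass"
      proof (rule integrable_times_biot_savart)
        show "g \<in> borel_measurable borel" unfolding g_def by measurable
        show "\<bar>g z\<bar> \<le> norm v * (e / local_mass)" for z
        proof -
          have "\<bar>\<phi> (x - z + v) - \<phi> (x - z) - G (x - z) \<bullet> v\<bar> \<le> norm v * (e / local_mass)"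
          proof (rule gradient_remainder_le[OF der])
            fix u assume "dist u (x - z) \<le> norm v"
            then have "dist u (x - z) < d" using y by (simp add: v_def)
            then show "norm (G u - G (x - z)) \<le> e / local_mass"
              using d(2) by (metis dist_norm less_imp_le)
          qed
          then show ?thesis by (simp add: g_def algebra_simps)
        qed
        show "g z = 0" if "2 < dist x z" for z
          using y that \<phi>0[OF farv[of x z v]] \<phi>0[OF far, of x z] G0[OF far, of x z] by (simp add: g_def v_def)
      qed
      then show "norm (convolve biot_savart \<phi> y - convolve biot_savart \<phi> x - A x (y - x)) \<le> e * norm (y - x)"
        using lm0 unfolding eq by (simp add: v_def mult.commute)
    qed (use d in auto)
  qed
  then show thesis using that[of "L * local_mass" A] Abound L0 lm0 by simp
qed

section \<open>Reflections and the vanishing divergence\<close>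

text \<open>When \<open>(a, b)\<close> is a unit vector, this is the reflection in the line whose
  polar angle is half of that of \<open>(a, b)\<close>. Reflections are convenient here as they are
  involutions, and one can be found that maps a given point to any other of the same norm.\<close>

definition reflection2 :: "real \<Rightarrow> real \<Rightarrow> real^2 \<Rightarrow> real^2" where
  "reflection2 a b z = vector [a * z $ 1 + b * z $ 2, b * z $ 1 - a * z $ 2]"

lemma reflection2_nth [simp]:
  "reflection2 a b z $ 1 = a * z $ 1 + b * z $ 2" "reflection2 a b z $ 2 = b * z $ 1 - a * z $ 2"
  by (simp_all add: reflection2_def)

lemma linear_reflection2: "linear (reflection2 a b)"
  by (intro linearI) (auto simp: vec2_eq_iff algebra_simps)

lemma biot_savart_nth [simp]:
  "biot_savart x $ 1 = - x $ 2 / (2 * pi * (norm x)\<^sup>2)" "biot_savart x $ 2 = x $ 1 / (2 * pi * (norm x)\<^sup>2)"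
  by (simp_all add: biot_savart_def)

context
  fixes a b :: real
  assumes ab: "a\<^sup>2 + b\<^sup>2 = 1"
begin

lemma reflection2_involution: "reflection2 a b (reflection2 a b z) = z"
proof -
  have "a * (a * z $ 1 + b * z $ 2) + b * (b * z $ 1 - a * z $ 2) = (a\<^sup>2 + b\<^sup>2) * z $ 1"
    "b * (a * z $ 1 + b * z $ 2) - a * (b * z $ 1 - a * z $ 2) = (a\<^sup>2 + b\<^sup>2) * z $ 2"
    by (simp_all add: algebra_simps power2_eq_square)
  then show ?thesis using ab by (simp add: vec2_eq_iff)
qed

lemma reflection2_inner: "reflection2 a b x \<bullet> reflection2 a b y = x \<bullet> y"
proof -
  have "reflection2 a b x \<bullet> reflection2 a b y = (a\<^sup>2 + b\<^sup>2) * (x \<bullet> y)"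
    by (simp add: inner_real2 algebra_simps power2_eq_square)
  then show ?thesis using ab by simp
qed

lemma orthogonal_reflection2: "orthogonal_transformation (reflection2 a b)"
  by (simp add: orthogonal_transformation_def linear_reflection2 reflection2_inner)

lemma norm_reflection2: "norm (reflection2 a b x) = norm x"
  using orthogonal_reflection2 by (simp add: orthogonal_transformation)

text \<open>The kernel is a radial factor times a rotation by a right angle, and a reflection
  conjugates that rotation into its negative.\<close>

lemma biot_savart_reflection2: "biot_savart (reflection2 a b x) = - reflection2 a b (biot_savart x)"
  by (simp add: vec2_eq_iff norm_reflection2 add_divide_distrib diff_divide_distrib)

text \<open>The antisymmetry of the kernel passes to the convolution by substituting the reflected
  point: the substitution preserves area and the mollifier is radial.\<close>

lemma convolve_biot_savart_reflection2:
  assumes \<phi>: "standard_mollifier \<phi>"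
  shows "convolve biot_savart \<phi> (reflection2 a b x) = - reflection2 a b (convolve biot_savart \<phi> x)"
proof -
  note [measurable] = standard_mollifier_borel[OF \<phi>]
  let ?S = "reflection2 a b"
  have bl: "bounded_linear ?S" using linear_reflection2 linear_conv_bounded_linear by blast
  then have [measurable]: "?S \<in> borel_measurable borel"
    by (simp add: borel_measurable_continuous_onI linear_continuous_on)
  have rad: "\<phi> (?S x - ?S y) = \<phi> (x - y)" for y
  proof -
    have "norm (?S x - ?S y) = norm (x - y)"
      by (metis linear_diff linear_reflection2 norm_reflection2)
    then show ?thesis using \<phi> unfolding standard_mollifier_def by blast
  qed
  have "convolve biot_savart \<phi> (?S x) = (LINT y|distr lborel borel ?S. \<phi> (?S x - y) *\<^sub>R biot_savart y)"
    by (simp add: convolve_lborel distr_lborel_linear_involution orthogonal_reflection2 reflection2_involution)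
  also have "\<dots> = (LINT y|lborel. \<phi> (?S x - ?S y) *\<^sub>R biot_savart (?S y))"
    by (rule integral_distr) measurable
  also have "\<dots> = (LINT y|lborel. - ?S (\<phi> (x - y) *\<^sub>R biot_savart y))"
    by (simp only: rad biot_savart_reflection2 linear_scale[OF linear_reflection2] scaleR_minus_right)
  also have "\<dots> = - (LINT y|lborel. ?S (\<phi> (x - y) *\<^sub>R biot_savart y))"
    by simp
  also have "\<dots> = - ?S (convolve biot_savart \<phi> x)"
    by (simp add: convolve_lborel integral_bounded_linear[OF bl integrable_mollifier_biot_savart[OF \<phi>]])
  finally show ?thesis .
qed

end

text \<open>The reflection that fixes \<open>x\<close> must reverse the value of the field at
  \<open>x\<close>, so this value has no component along \<open>x\<close>.\<close>

lemma convolve_biot_savart_orthogonal: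
  assumes \<phi>: "standard_mollifier \<phi>"
  shows "convolve biot_savart \<phi> x \<bullet> x = 0"
proof (cases "x = 0")
  case False
  define r where "r = (x $ 1)\<^sup>2 + (x $ 2)\<^sup>2"
  have r: "r \<noteq> 0" using False by (auto simp: r_def vec2_eq_iff sum_power2_eq_zero_iff)
  \<comment> \<open>Cosine and sine of twice the polar angle of \<open>x\<close>.\<close>
  define a b where "a = ((x $ 1)\<^sup>2 - (x $ 2)\<^sup>2) / r" and "b = 2 * x $ 1 * x $ 2 / r"
  have "((x $ 1)\<^sup>2 - (x $ 2)\<^sup>2)\<^sup>2 + (2 * x $ 1 * x $ 2)\<^sup>2 = r\<^sup>2"
    unfolding r_def by algebra
  then have ab: "a\<^sup>2 + b\<^sup>2 = 1" using r by (simp add: a_def b_def power_divide flip: add_divide_distrib)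
  have "((x $ 1)\<^sup>2 - (x $ 2)\<^sup>2) * x $ 1 + 2 * x $ 1 * x $ 2 * x $ 2 = r * x $ 1"
    "2 * x $ 1 * x $ 2 * x $ 1 - ((x $ 1)\<^sup>2 - (x $ 2)\<^sup>2) * x $ 2 = r * x $ 2"
    unfolding r_def by algebra+
  then have fixed: "reflection2 a b x = x"
    using r by (simp add: vec2_eq_iff a_def b_def flip: add_divide_distrib diff_divide_distrib)
  let ?M = "convolve biot_savart \<phi> x"
  have M: "?M = - reflection2 a b ?M"
    using convolve_biot_savart_reflection2[OF ab \<phi>, of x] by (simp add: fixed)
  have "?M \<bullet> x = - (reflection2 a b ?M \<bullet> x)"
    by (subst M) simp
  also have "reflection2 a b ?M \<bullet> x = reflection2 a b ?M \<bullet> reflection2 a b x" by (simp add: fixed)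
  also have "\<dots> = ?M \<bullet> x" by (rule reflection2_inner[OF ab])
  finally show ?thesis by simp
qed simp

text \<open>The quantity is the angular component of the field times the radius. Under the
  reflection taking \<open>x\<close> to \<open>y\<close> two signs cancel: the field is reversed and
  so is oriented area.\<close>

lemma convolve_biot_savart_radial:
  assumes \<phi>: "standard_mollifier \<phi>" and xy: "norm x = norm y"
  shows "x $ 1 * convolve biot_savart \<phi> x $ 2 - x $ 2 * convolve biot_savart \<phi> x $ 1 =
    y $ 1 * convolve biot_savart \<phi> y $ 2 - y $ 2 * convolve biot_savart \<phi> y $ 1"
proof (cases "x = 0")
  case True
  then show ?thesis using xy by simp
next
  case False
  define r where "r = (x $ 1)\<^sup>2 + (x $ 2)\<^sup>2"
  have r: "r \<noteq> 0" using False by (auto simp: r_def vec2_eq_iff sum_power2_eq_zero_iff)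
  have ry: "r = (y $ 1)\<^sup>2 + (y $ 2)\<^sup>2" using xy by (simp add: r_def norm_real2)
  \<comment> \<open>Cosine and sine of the sum of the polar angles of \<open>x\<close> and
    \<open>y\<close>.\<close>
  define a b where "a = (x $ 1 * y $ 1 - x $ 2 * y $ 2) / r" and "b = (x $ 1 * y $ 2 + x $ 2 * y $ 1) / r"
  have "(x $ 1 * y $ 1 - x $ 2 * y $ 2)\<^sup>2 + (x $ 1 * y $ 2 + x $ 2 * y $ 1)\<^sup>2 =
      ((x $ 1)\<^sup>2 + (x $ 2)\<^sup>2) * ((y $ 1)\<^sup>2 + (y $ 2)\<^sup>2)"
    by algebra
  also have "\<dots> = r\<^sup>2" unfolding r_def[symmetric] ry[symmetric] by (rule power2_eq_square[symmetric])
  finally have ab: "a\<^sup>2 + b\<^sup>2 = 1"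
    using r by (simp add: a_def b_def power_divide flip: add_divide_distrib)
  have "(x $ 1 * y $ 1 - x $ 2 * y $ 2) * x $ 1 + (x $ 1 * y $ 2 + x $ 2 * y $ 1) * x $ 2 = r * y $ 1"
    "(x $ 1 * y $ 2 + x $ 2 * y $ 1) * x $ 1 - (x $ 1 * y $ 1 - x $ 2 * y $ 2) * x $ 2 = r * y $ 2"
    unfolding r_def by algebra+
  then have y: "reflection2 a b x = y"
    using r by (simp add: vec2_eq_iff a_def b_def flip: add_divide_distrib diff_divide_distrib)
  define M where "M = convolve biot_savart \<phi> x"
  have "convolve biot_savart \<phi> y = - reflection2 a b M"
    using convolve_biot_savart_reflection2[OF ab \<phi>, of x] by (simp add: y M_def)
  then have "y $ 1 * convolve biot_savart \<phi> y $ 2 - y $ 2 * convolve biot_savart \<phi> y $ 1 =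
     (a\<^sup>2 + b\<^sup>2) * (x $ 1 * M $ 2 - x $ 2 * M $ 1)"
    by (simp add: algebra_simps power2_eq_square flip: y)
  then show ?thesis by (simp add: ab M_def)
qed

text \<open>The bound on the derivative doubles as a global Lipschitz constant, and trace zero says
  that the field is divergence-free. Quantifying the derivative away keeps the property easy to pass
  through sums of translates.\<close>

definition solenoidal :: "real \<Rightarrow> (real^2 \<Rightarrow> real^2) \<Rightarrow> bool" where
  "solenoidal \<Lambda> b \<longleftrightarrow> (\<exists>A. \<forall>x. (b has_derivative A x) (at x) \<and> (\<forall>v. norm (A x v) \<le> \<Lambda> * norm v) \<and>
      trace (matrix (A x)) = 0)"

lemma trace_matrix2: "trace (matrix A :: real^2^2) = A (axis 1 1) $ 1 + A (axis 2 1) $ 2"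
  by (simp add: trace_def UNIV_2 matrix_def)

text \<open>In the orthogonal frame \<open>x, J x\<close> the diagonal of the derivative vanishes: along \<open>x\<close> since the
  field is orthogonal to \<open>x\<close>, along \<open>J x\<close> since the angular component is constant on circles.\<close>

lemma trace_derivative_convolve_biot_savart:
  assumes \<phi>: "standard_mollifier \<phi>" and der: "(convolve biot_savart \<phi> has_derivative A) (at x)"
  shows "trace (matrix A) = 0"
proof -
  define M where "M = convolve biot_savart \<phi>"
  have derM: "(M has_derivative A) (at x)" using der by (simp add: M_def)
  have lin: "linear A" using der by (rule has_derivative_linear)
  have A: "A v = v $ 1 *\<^sub>R A (axis 1 1) + v $ 2 *\<^sub>R A (axis 2 1)" for v
  proof -
    have "v = v $ 1 *\<^sub>R axis 1 1 + v $ 2 *\<^sub>R axis 2 1"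
      by (simp add: vec2_eq_iff axis_def)
    then have "A v = A (v $ 1 *\<^sub>R axis 1 1 + v $ 2 *\<^sub>R axis 2 1)" by simp
    then show ?thesis by (simp add: linear_add[OF lin] linear_scale[OF lin])
  qed
  have orth: "M z \<bullet> z = 0" for z
    using convolve_biot_savart_orthogonal[OF \<phi>] by (simp add: M_def)
  have "((\<lambda>z. M z \<bullet> z) has_derivative (\<lambda>v. M x \<bullet> v + A v \<bullet> x)) (at x)"
    by (intro has_derivative_inner derM has_derivative_ident)
  then have "((\<lambda>z. 0) has_derivative (\<lambda>v. M x \<bullet> v + A v \<bullet> x)) (at x)"
    by (simp only: orth)
  then have "(\<lambda>v. M x \<bullet> v + A v \<bullet> x) = (\<lambda>v. 0)"
    by (rule has_derivative_unique) (rule has_derivative_const)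
  then have d1: "M x \<bullet> v + A v \<bullet> x = 0" for v by metis
  show ?thesis
  proof (cases "x = 0")
    case True
    \<comment> \<open>No frame is available at the origin. Instead \<open>A v\<close> is orthogonal
      to \<open>v\<close> for every \<open>v\<close>, since along the line through \<open>v\<close>
      the field stays orthogonal to that line.\<close>
    have "M 0 = 0" using d1[of "M 0"] True by simp
    have "A v \<bullet> v = 0" for v
    proof -
      have "M (s *\<^sub>R v) \<bullet> v = 0" for s
        using orth[of "s *\<^sub>R v"] \<open>M 0 = 0\<close> by (cases "s = 0") auto
      moreover have "((\<lambda>s. M (s *\<^sub>R v) \<bullet> v) has_derivative (\<lambda>s. A (s *\<^sub>R v) \<bullet> v)) (at 0)"
      proof (intro has_derivative_inner_left)
        have "((M \<circ> (\<lambda>s. s *\<^sub>R v)) has_derivative (A \<circ> (\<lambda>s. s *\<^sub>R v))) (at 0)"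
          using derM True by (intro diff_chain_at has_derivative_scaleR_left has_derivative_ident) simp
        then show "((\<lambda>s. M (s *\<^sub>R v)) has_derivative (\<lambda>s. A (s *\<^sub>R v))) (at 0)"
          by (simp add: o_def)
      qed
      ultimately have "((\<lambda>s. 0) has_derivative (\<lambda>s::real. A (s *\<^sub>R v) \<bullet> v)) (at 0)" by simp
      then have "(\<lambda>s::real. A (s *\<^sub>R v) \<bullet> v) = (\<lambda>s. 0)"
        by (rule has_derivative_unique) (rule has_derivative_const)
      from fun_cong[OF this, of 1] show ?thesis by simp
    qed
    from this[of "axis 1 1"] this[of "axis 2 1"] show ?thesis
      by (simp add: trace_matrix2 inner_real2 axis_def)
  next
    case False
    define J where "J v = (vector [- v $ 2, v $ 1] :: real^2)" for v :: "real^2"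
    have linJ: "linear J" by (intro linearI) (auto simp: J_def vec2_eq_iff)
    then have blJ: "bounded_linear J" by (simp add: linear_conv_bounded_linear)
    define g where "g z = J z \<bullet> M z" for z
    \<comment> \<open>The circle through \<open>x\<close> about the origin, with velocity
      \<open>J x\<close> at time 0; the angular component \<open>g\<close> is constant along
      it.\<close>
    define c where "c t = cos t *\<^sub>R x + sin t *\<^sub>R J x" for t
    have "norm (c t) = norm x" for t
    proof -
      have "(c t $ 1)\<^sup>2 + (c t $ 2)\<^sup>2 = ((sin t)\<^sup>2 + (cos t)\<^sup>2) * ((x $ 1)\<^sup>2 + (x $ 2)\<^sup>2)"
        unfolding c_def J_def by (simp del: sin_cos_squared_add) algebra
      then show ?thesis by (simp add: norm_real2)
    qed
    then have gc: "g (c t) = g x" for t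
      using convolve_biot_savart_radial[OF \<phi>, of "c t" x] by (simp add: g_def J_def inner_real2 M_def)
    have dg: "(g has_derivative (\<lambda>v. J x \<bullet> A v + J v \<bullet> M x)) (at x)"
      unfolding g_def
      by (intro has_derivative_inner derM bounded_linear_imp_has_derivative blJ)
    have dc: "(c has_derivative (\<lambda>s. s *\<^sub>R J x)) (at 0)"
      unfolding c_def by (auto intro!: derivative_eq_intros)
    have "((g \<circ> c) has_derivative ((\<lambda>v. J x \<bullet> A v + J v \<bullet> M x) \<circ> (\<lambda>s. s *\<^sub>R J x))) (at 0)"
      by (intro diff_chain_at dc) (use dg in \<open>simp add: c_def\<close>)
    then have "((\<lambda>_. g x) has_derivative ((\<lambda>v. J x \<bullet> A v + J v \<bullet> M x) \<circ> (\<lambda>s. s *\<^sub>R J x))) (at 0)"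
      by (simp add: o_def gc)
    then have "((\<lambda>v. J x \<bullet> A v + J v \<bullet> M x) \<circ> (\<lambda>s. s *\<^sub>R J x)) = (\<lambda>_. 0)"
      by (rule has_derivative_unique) (rule has_derivative_const)
    from fun_cong[OF this, of 1] have d2: "J x \<bullet> A (J x) + J (J x) \<bullet> M x = 0" by simp
    have "J (J x) = - x" by (simp add: J_def vec2_eq_iff)
    then have "J x \<bullet> A (J x) = 0" using d2 orth[of x] by (simp add: inner_commute)
    moreover have "x \<bullet> A x = 0" using d1[of x] orth[of x] by (simp add: inner_commute)
    ultimately have "J x \<bullet> A (J x) + x \<bullet> A x = 0" by simp
    \<comment> \<open>The trace computed in an orthogonal frame whose two vectors have the length of
      \<open>x\<close>, verified by expanding \<open>A\<close> along the axes.\<close>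
    moreover have "J x \<bullet> A (J x) + x \<bullet> A x = ((x $ 1)\<^sup>2 + (x $ 2)\<^sup>2) * trace (matrix A)"
      by (subst A, subst (2) A) (simp add: trace_matrix2 inner_real2 J_def algebra_simps power2_eq_square)
    moreover have "(x $ 1)\<^sup>2 + (x $ 2)\<^sup>2 \<noteq> 0"
      using False by (auto simp: vec2_eq_iff sum_power2_eq_zero_iff)
    ultimately show ?thesis by (metis mult_eq_0_iff)
  qed
qed

section \<open>Scaling to the blob size and superposition\<close>

lemma lborel_scaleR_real2:
  assumes "0 < \<epsilon>"
  shows "(lborel :: (real^2) measure) = density (distr lborel borel (\<lambda>u. \<epsilon> *\<^sub>R u)) (\<lambda>_. ennreal (\<epsilon>\<^sup>2))"
  using lborel_affine[of \<epsilon> "0 :: real^2"] assms by simp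

lemma nn_integral_lborel_scaleR:
  fixes f :: "real^2 \<Rightarrow> ennreal"
  assumes [measurable]: "f \<in> borel_measurable borel" and "0 < \<epsilon>"
  shows "(\<integral>\<^sup>+y. f y \<partial>lborel) = ennreal (\<epsilon>\<^sup>2) * (\<integral>\<^sup>+u. f (\<epsilon> *\<^sub>R u) \<partial>lborel)"
proof -
  have "(\<integral>\<^sup>+y. f y \<partial>lborel) =
      (\<integral>\<^sup>+y. f y \<partial>density (distr lborel borel (\<lambda>u. \<epsilon> *\<^sub>R u)) (\<lambda>_. ennreal (\<epsilon>\<^sup>2)))"
    using lborel_scaleR_real2[OF \<open>0 < \<epsilon>\<close>] by simp
  then show ?thesis by (simp add: nn_integral_density nn_integral_distr nn_integral_cmult)
qed

lemma integral_lborel_scaleR: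
  fixes f :: "real^2 \<Rightarrow> 'b::{banach, second_countable_topology}"
  assumes [measurable]: "f \<in> borel_measurable borel" and "0 < \<epsilon>"
  shows "(LINT y|lborel. f y) = \<epsilon>\<^sup>2 *\<^sub>R (LINT u|lborel. f (\<epsilon> *\<^sub>R u))"
proof -
  have "(LINT y|lborel. f y) =
      (LINT y|density (distr lborel borel (\<lambda>u. \<epsilon> *\<^sub>R u)) (\<lambda>_. ennreal (\<epsilon>\<^sup>2)). f y)"
    using lborel_scaleR_real2[OF \<open>0 < \<epsilon>\<close>] by simp
  then show ?thesis by (simp add: integral_density integral_distr)
qed

lemma borel_measurable_rescale:
  assumes "\<phi> \<in> borel_measurable borel"
  shows "rescale \<epsilon> \<phi> \<in> borel_measurable borel"
proof -
  note [measurable] = assms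
  show ?thesis unfolding rescale_def by measurable
qed

text \<open>The area factor of the substitution cancels the normalization in \<open>rescale\<close>,
  and homogeneity of degree -1 of the kernel leaves one factor
  \<open>1 / \<epsilon>\<close>.\<close>

lemma convolve_biot_savart_rescale:
  assumes \<phi>: "standard_mollifier \<phi>" and "0 < \<epsilon>"
  shows "convolve biot_savart (rescale \<epsilon> \<phi>) x = (1 / \<epsilon>) *\<^sub>R convolve biot_savart \<phi> (x /\<^sub>R \<epsilon>)"
proof -
  note [measurable] = standard_mollifier_borel[OF \<phi>] borel_measurable_rescale[OF standard_mollifier_borel[OF \<phi>]]
  have K: "biot_savart (\<epsilon> *\<^sub>R u) = (1 / \<epsilon>) *\<^sub>R biot_savart u" for u
    using \<open>0 < \<epsilon>\<close> by (auto simp: vec2_eq_iff power2_eq_square field_simps)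
  have "convolve biot_savart (rescale \<epsilon> \<phi>) x = (LINT y|lborel. rescale \<epsilon> \<phi> (x - y) *\<^sub>R biot_savart y)"
    by (simp add: convolve_lborel)
  also have "\<dots> = \<epsilon>\<^sup>2 *\<^sub>R (LINT u|lborel. rescale \<epsilon> \<phi> (x - \<epsilon> *\<^sub>R u) *\<^sub>R biot_savart (\<epsilon> *\<^sub>R u))"
    by (intro integral_lborel_scaleR \<open>0 < \<epsilon>\<close>) measurable
  also have "\<dots> = (LINT u|lborel. \<epsilon>\<^sup>2 *\<^sub>R (rescale \<epsilon> \<phi> (x - \<epsilon> *\<^sub>R u) *\<^sub>R biot_savart (\<epsilon> *\<^sub>R u)))"
    by (rule integral_scaleR_right[symmetric])
  also have "\<dots> = (LINT u|lborel. (1 / \<epsilon>) *\<^sub>R (\<phi> (x /\<^sub>R \<epsilon> - u) *\<^sub>R biot_savart u))"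
    using \<open>0 < \<epsilon>\<close>
    by (intro Bochner_Integration.integral_cong) (auto simp: rescale_def K scaleR_diff_right)
  also have "\<dots> = (1 / \<epsilon>) *\<^sub>R convolve biot_savart \<phi> (x /\<^sub>R \<epsilon>)"
    by (simp only: integral_scaleR_right) (simp add: convolve_lborel)
  finally show ?thesis .
qed

text \<open>One power of \<open>1 / \<epsilon>\<close> is the amplitude of the rescaled field, the
  other comes from the chain rule. The constant depends on \<open>\<phi>\<close> alone and later
  enters the threshold for \<open>C\<^sub>0\<close>.\<close>

lemma solenoidal_convolve_biot_savart:
  assumes \<phi>: "standard_mollifier \<phi>"
  obtains C where "0 \<le> C" "\<And>\<epsilon>. 0 < \<epsilon> \<Longrightarrow> solenoidal (C / \<epsilon>\<^sup>2) (convolve biot_savart (rescale \<epsilon> \<phi>))"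
proof -
  obtain A C where C: "0 \<le> C" and der: "\<And>x. (convolve biot_savart \<phi> has_derivative A x) (at x)"
    and bound: "\<And>x v. norm (A x v) \<le> C * norm v"
    using has_derivative_convolve_biot_savart[OF \<phi>] by metis
  have tr: "trace (matrix (A x)) = 0" for x
    by (rule trace_derivative_convolve_biot_savart[OF \<phi> der])
  have "solenoidal (C / \<epsilon>\<^sup>2) (convolve biot_savart (rescale \<epsilon> \<phi>))" if "0 < \<epsilon>" for \<epsilon>
  proof -
    define D where "D x v = (1 / \<epsilon>) *\<^sub>R A (x /\<^sub>R \<epsilon>) (v /\<^sub>R \<epsilon>)" for x v
    have lin: "linear (A x)" for x using der has_derivative_linear by blast
    have D: "D x v = (1 / \<epsilon>\<^sup>2) *\<^sub>R A (x /\<^sub>R \<epsilon>) v" for x v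
      by (simp add: D_def linear_scale[OF lin] power2_eq_square divide_simps)
    have "(convolve biot_savart (rescale \<epsilon> \<phi>) has_derivative D x) (at x)" for x
    proof -
      have "((convolve biot_savart \<phi> \<circ> (\<lambda>x. x /\<^sub>R \<epsilon>)) has_derivative (A (x /\<^sub>R \<epsilon>) \<circ> (\<lambda>x. x /\<^sub>R \<epsilon>))) (at x)"
        by (intro diff_chain_at der has_derivative_scaleR_right has_derivative_ident)
      then have "((\<lambda>x. (1 / \<epsilon>) *\<^sub>R convolve biot_savart \<phi> (x /\<^sub>R \<epsilon>)) has_derivative D x) (at x)"
        unfolding D_def o_def by (rule has_derivative_scaleR_right)
      then show ?thesis using convolve_biot_savart_rescale[OF \<phi> that] by presburger
    qed
    moreover have "norm (D x v) \<le> C / \<epsilon>\<^sup>2 * norm v" for x v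
      using bound[of "x /\<^sub>R \<epsilon>" v] that by (simp add: D divide_right_mono)
    moreover have "trace (matrix (D x)) = 0" for x
      using tr[of "x /\<^sub>R \<epsilon>"] that by (simp add: trace_matrix2 D flip: add_divide_distrib)
    ultimately show ?thesis unfolding solenoidal_def by blast
  qed
  then show thesis using that C by blast
qed

text \<open>Meant for the blob field at a fixed time, with the circulations as \<open>c\<close> and
  the vortex positions as \<open>p\<close>.\<close>

lemma solenoidal_sum:
  assumes b: "solenoidal \<Lambda> b"
  shows "solenoidal ((\<Sum>i\<in>I. \<bar>c i\<bar>) * \<Lambda>) (\<lambda>x. \<Sum>i\<in>I. c i *\<^sub>R b (x - p i))"
proof -
  obtain A where der: "\<And>x. (b has_derivative A x) (at x)" and bound: "\<And>x v. norm (A x v) \<le> \<Lambda> * norm v"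
    and tr: "\<And>x. trace (matrix (A x)) = 0"
    using b unfolding solenoidal_def by metis
  define D where "D x v = (\<Sum>i\<in>I. c i *\<^sub>R A (x - p i) v)" for x v
  have "((\<lambda>x. \<Sum>i\<in>I. c i *\<^sub>R b (x - p i)) has_derivative D x) (at x)" for x
    unfolding D_def
  proof (intro has_derivative_sum has_derivative_scaleR_right)
    fix i
    have "((b \<circ> (\<lambda>x. x - p i)) has_derivative (A (x - p i) \<circ> (\<lambda>v. v))) (at x)"
      by (intro diff_chain_at der) (auto intro!: derivative_eq_intros)
    then show "((\<lambda>x. b (x - p i)) has_derivative (\<lambda>v. A (x - p i) v)) (at x)"
      by (simp add: o_def)
  qed
  moreover have "norm (D x v) \<le> ((\<Sum>i\<in>I. \<bar>c i\<bar>) * \<Lambda>) * norm v" for x v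
  proof -
    have "norm (D x v) \<le> (\<Sum>i\<in>I. \<bar>c i\<bar> * (\<Lambda> * norm v))"
      unfolding D_def by (rule sum_norm_le) (simp add: bound mult_left_mono)
    then show ?thesis by (simp add: sum_distrib_right mult.assoc)
  qed
  moreover have "trace (matrix (D x)) = 0" for x
  proof -
    have "trace (matrix (D x)) = (\<Sum>i\<in>I. c i * trace (matrix (A (x - p i))))"
      by (simp add: trace_matrix2 D_def sum.distrib distrib_left)
    then show ?thesis by (simp add: tr)
  qed
  ultimately show ?thesis unfolding solenoidal_def by blast
qed

section \<open>An integrable majorant of the mollified kernel, uniform in the blob size\<close>

lemma standard_mollifier_nonneg: "standard_mollifier \<phi> \<Longrightarrow> 0 \<le> \<phi> x"
  unfolding standard_mollifier_def by blast

lemma standard_mollifier_integral: "standard_mollifier \<phi> \<Longrightarrow> (LINT x|lebesgue. \<phi> x) = 1"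
  unfolding standard_mollifier_def by blast

lemma nn_integral_standard_mollifier:
  assumes \<phi>: "standard_mollifier \<phi>"
  shows "(\<integral>\<^sup>+x. ennreal (\<phi> x) \<partial>lborel) = 1"
proof -
  note [measurable] = standard_mollifier_borel[OF \<phi>]
  have 1: "(LINT x|lborel. \<phi> x) = 1"
    using standard_mollifier_integral[OF \<phi>] by (simp add: integral_completion)
  \<comment> \<open>A non-integrable function would have integral 0 by convention, not 1.\<close>
  then have "integrable lborel \<phi>" using not_integrable_integral_eq by fastforce
  moreover have "AE x in lborel. 0 \<le> \<phi> x" by (simp add: standard_mollifier_nonneg[OF \<phi>])
  ultimately show ?thesis using 1 by (simp add: nn_integral_eq_integral)
qed

lemma rescale_nonneg: "standard_mollifier \<phi> \<Longrightarrow> 0 \<le> rescale \<epsilon> \<phi> x"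
  by (simp add: rescale_def standard_mollifier_nonneg)

lemma nn_integral_rescale:
  assumes \<phi>: "standard_mollifier \<phi>" and "0 < \<epsilon>"
  shows "(\<integral>\<^sup>+x. ennreal (rescale \<epsilon> \<phi> x) \<partial>lborel) = 1"
proof -
  note [measurable] = standard_mollifier_borel[OF \<phi>] borel_measurable_rescale[OF standard_mollifier_borel[OF \<phi>]]
  have "(\<integral>\<^sup>+x. ennreal (rescale \<epsilon> \<phi> x) \<partial>lborel) =
      ennreal (\<epsilon>\<^sup>2) * (\<integral>\<^sup>+u. ennreal (rescale \<epsilon> \<phi> (\<epsilon> *\<^sub>R u)) \<partial>lborel)"
    by (intro nn_integral_lborel_scaleR \<open>0 < \<epsilon>\<close>) measurable
  also have "\<dots> = (\<integral>\<^sup>+u. ennreal (\<epsilon>\<^sup>2) * ennreal (rescale \<epsilon> \<phi> (\<epsilon> *\<^sub>R u)) \<partial>lborel)"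
    by (rule nn_integral_cmult[symmetric]) measurable
  also have "\<dots> = (\<integral>\<^sup>+u. ennreal (\<phi> u) \<partial>lborel)"
    using \<open>0 < \<epsilon>\<close> by (intro nn_integral_cong) (simp add: rescale_def flip: ennreal_mult')
  finally show ?thesis using nn_integral_standard_mollifier[OF \<phi>] by simp
qed

text \<open>The singular part of the kernel after mollification. Its mass does not depend on
  \<open>\<epsilon>\<close>, in contrast to the available pointwise bounds.\<close>

definition smeared_kernel :: "real \<Rightarrow> (real^2 \<Rightarrow> real) \<Rightarrow> real^2 \<Rightarrow> ennreal" where
  "smeared_kernel \<epsilon> \<phi> x = (\<integral>\<^sup>+y. ennreal (rescale \<epsilon> \<phi> (x - y)) * near_kernel y \<partial>lborel)"

lemma borel_measurable_smeared_kernel: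
  assumes \<phi>: "standard_mollifier \<phi>"
  shows "smeared_kernel \<epsilon> \<phi> \<in> borel_measurable borel"
proof -
  note [measurable] = borel_measurable_rescale[OF standard_mollifier_borel[OF \<phi>]]
  show ?thesis unfolding smeared_kernel_def by measurable
qed

lemma nn_integral_smeared_kernel:
  assumes \<phi>: "standard_mollifier \<phi>" and "0 < \<epsilon>"
  shows "(\<integral>\<^sup>+x. smeared_kernel \<epsilon> \<phi> x \<partial>lborel) = ennreal near_mass"
proof -
  note [measurable] = borel_measurable_rescale[OF standard_mollifier_borel[OF \<phi>]]
  have "(\<integral>\<^sup>+x. smeared_kernel \<epsilon> \<phi> x \<partial>lborel) =
      (\<integral>\<^sup>+y. \<integral>\<^sup>+x. ennreal (rescale \<epsilon> \<phi> (x - y)) * near_kernel y \<partial>lborel \<partial>lborel)"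
    unfolding smeared_kernel_def by (rule lborel_pair.Fubini') measurable
  also have "\<dots> = (\<integral>\<^sup>+y. near_kernel y \<partial>lborel)"
  proof (rule nn_integral_cong)
    fix y
    have "(\<integral>\<^sup>+x. ennreal (rescale \<epsilon> \<phi> (x - y)) \<partial>lborel) = 1"
      using nn_integral_lborel_translation[of "\<lambda>x. ennreal (rescale \<epsilon> \<phi> x)" y] nn_integral_rescale[OF \<phi> \<open>0 < \<epsilon>\<close>]
      by simp
    then show "(\<integral>\<^sup>+x. ennreal (rescale \<epsilon> \<phi> (x - y)) * near_kernel y \<partial>lborel) = near_kernel y"
      by (simp add: nn_integral_multc)
  qed
  finally show ?thesis by (simp add: nn_integral_near_kernel)
qed

text \<open>Outside the unit ball the kernel is at most 1, and averaging against a density of mass 1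
  preserves this bound; only the near part has to be kept as a function.\<close>

lemma norm_convolve_biot_savart_le:
  assumes \<phi>: "standard_mollifier \<phi>" and "0 < \<epsilon>"
  shows "ennreal (norm (convolve biot_savart (rescale \<epsilon> \<phi>) x)) \<le> smeared_kernel \<epsilon> \<phi> x + 1"
proof -
  note [measurable] = borel_measurable_rescale[OF standard_mollifier_borel[OF \<phi>]]
  let ?f = "\<lambda>y. rescale \<epsilon> \<phi> (x - y) *\<^sub>R biot_savart y"
  have "ennreal (norm (LINT y|lborel. ?f y)) \<le> (\<integral>\<^sup>+y. ennreal (norm (?f y)) \<partial>lborel)"
    by (cases "integrable lborel ?f") (rule integral_norm_bound_ennreal, auto simp: not_integrable_integral_eq)
  also have "\<dots> \<le> (\<integral>\<^sup>+y. ennreal (rescale \<epsilon> \<phi> (x - y)) * near_kernel y + ennreal (rescale \<epsilon> \<phi> (x - y)) \<partial>lborel)"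
  proof (rule nn_integral_mono)
    fix y
    have "ennreal (norm (?f y)) = ennreal (rescale \<epsilon> \<phi> (x - y)) * ennreal (norm (biot_savart y))"
      using rescale_nonneg[OF \<phi>] by (simp add: ennreal_mult)
    also have "\<dots> \<le> ennreal (rescale \<epsilon> \<phi> (x - y)) * (near_kernel y + 1)"
      by (intro mult_left_mono norm_biot_savart_le) simp
    finally show "ennreal (norm (?f y)) \<le> ennreal (rescale \<epsilon> \<phi> (x - y)) * near_kernel y + ennreal (rescale \<epsilon> \<phi> (x - y))"
      by (simp add: distrib_left)
  qed
  also have "\<dots> = smeared_kernel \<epsilon> \<phi> x + (\<integral>\<^sup>+y. ennreal (rescale \<epsilon> \<phi> (x - y)) \<partial>lborel)"
    unfolding smeared_kernel_def by (rule nn_integral_add) measurable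
  also have "(\<integral>\<^sup>+y. ennreal (rescale \<epsilon> \<phi> (x - y)) \<partial>lborel) = 1"
    using nn_integral_lborel_minus[of "\<lambda>x. ennreal (rescale \<epsilon> \<phi> x)" x] nn_integral_rescale[OF \<phi> \<open>0 < \<epsilon>\<close>]
    by simp
  finally show ?thesis by (simp add: convolve_lborel)
qed

subsection \<open>The Euler scheme\<close>

lemma solenoidal_lipschitz:
  assumes "solenoidal \<Lambda> b" "0 \<le> \<Lambda>"
  shows "norm (b x - b y) \<le> \<Lambda> * norm (x - y)"
proof -
  obtain A where der: "\<And>x. (b has_derivative A x) (at x)" and bound: "\<And>x v. norm (A x v) \<le> \<Lambda> * norm v"
    using assms unfolding solenoidal_def by metis
  show ?thesis
  proof (rule differentiable_bound[of UNIV b A])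
    show "(b has_derivative A x) (at x)" for x by (rule der)
    show "onorm (A x) \<le> \<Lambda>" for x by (intro onorm_bound \<open>0 \<le> \<Lambda>\<close> bound)
  qed auto
qed

lemma solenoidal_continuous: "solenoidal \<Lambda> b \<Longrightarrow> continuous_on UNIV b"
  unfolding solenoidal_def by (metis continuous_at_imp_continuous_on has_derivative_continuous)

lemma solenoidal_borel: "solenoidal \<Lambda> b \<Longrightarrow> b \<in> borel_measurable borel"
  by (simp add: borel_measurable_continuous_onI solenoidal_continuous)

text \<open>The determinant is \<open>1\<close> plus \<open>\<tau>\<close> times the trace plus
  \<open>\<tau>\<^sup>2\<close> times the determinant of \<open>A\<close>. The linear term vanishes,
  and the entries of \<open>A\<close> are at most \<open>\<Lambda>\<close> in absolute
  value.\<close>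

lemma det_identity_plus_ge:
  fixes A :: "real^2 \<Rightarrow> real^2"
  assumes tr: "trace (matrix A) = 0" and bound: "\<And>v. norm (A v) \<le> \<Lambda> * norm v"
  shows "1 - 2 * (\<tau> * \<Lambda>)\<^sup>2 \<le> \<bar>det (matrix (\<lambda>v. v + \<tau> *\<^sub>R A v))\<bar>"
proof -
  define a where "a i j = A (axis j 1) $ i" for i j
  have a: "\<bar>a i j\<bar> \<le> \<Lambda>" for i j
    using component_le_norm_cart[of "A (axis j 1)" i] bound[of "axis j 1"]
    by (simp add: a_def norm_axis_1)
  have "0 \<le> \<Lambda>" using a[of 1 1] by (meson abs_ge_zero order_trans)
  then have pr: "\<bar>a i j * a k l\<bar> \<le> \<Lambda>\<^sup>2" for i j k l
    unfolding abs_mult power2_eq_square by (intro mult_mono a) auto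
  have "\<bar>a 1 1 * a 2 2 - a 1 2 * a 2 1\<bar> \<le> 2 * \<Lambda>\<^sup>2"
    using pr[of 1 1 2 2] pr[of 1 2 2 1] by linarith
  then have "\<bar>\<tau>\<^sup>2 * (a 1 1 * a 2 2 - a 1 2 * a 2 1)\<bar> \<le> \<tau>\<^sup>2 * (2 * \<Lambda>\<^sup>2)"
    unfolding abs_mult by (simp add: mult_left_mono)
  moreover have "det (matrix (\<lambda>v. v + \<tau> *\<^sub>R A v)) =
      1 + \<tau> * trace (matrix A) + \<tau>\<^sup>2 * (a 1 1 * a 2 2 - a 1 2 * a 2 1)"
  proof -
    have "det (matrix B :: real^2^2) = B (axis 1 1) $ 1 * B (axis 2 1) $ 2 - B (axis 2 1) $ 1 * B (axis 1 1) $ 2" for B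
      by (simp add: det_2 matrix_def)
    from this[of "\<lambda>v. v + \<tau> *\<^sub>R A v"]
    have "det (matrix (\<lambda>v. v + \<tau> *\<^sub>R A v)) =
        ((axis 1 1 :: real^2) $ 1 + \<tau> * a 1 1) * ((axis 2 1 :: real^2) $ 2 + \<tau> * a 2 2) -
        ((axis 2 1 :: real^2) $ 1 + \<tau> * a 1 2) * ((axis 1 1 :: real^2) $ 2 + \<tau> * a 2 1)"
      by (simp only: vector_add_component vector_scaleR_component real_scaleR_def a_def)
    moreover have "(axis 1 1 :: real^2) $ 1 = 1" "(axis 2 1 :: real^2) $ 2 = 1"
      "(axis 1 1 :: real^2) $ 2 = 0" "(axis 2 1 :: real^2) $ 1 = 0"
      by (simp_all add: axis_def)
    ultimately show ?thesis
      by (simp add: trace_matrix2 a_def[symmetric] power2_eq_square algebra_simps)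
  qed
  ultimately show ?thesis unfolding tr power_mult_distrib by linarith
qed

lemma nn_integral_solenoidal_step_le:
  assumes b: "solenoidal \<Lambda> b" and "0 \<le> \<Lambda>" "0 \<le> \<tau>" "\<tau> * \<Lambda> \<le> 1 / 2"
    and F: "F \<in> borel_measurable borel"
  shows "(\<integral>\<^sup>+y. F (y + \<tau> *\<^sub>R b y) \<partial>lborel) \<le> ennreal (1 / (1 - 2 * (\<tau> * \<Lambda>)\<^sup>2)) * (\<integral>\<^sup>+y. F y \<partial>lborel)"
proof -
  obtain A where der: "\<And>x. (b has_derivative A x) (at x)" and bound: "\<And>x v. norm (A x v) \<le> \<Lambda> * norm v"
    and tr: "\<And>x. trace (matrix (A x)) = 0"
    using b unfolding solenoidal_def by metis
  show ?thesis
  proof (rule nn_integral_injective_differentiable_le[OF _ _ _ _ F])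
    show "((\<lambda>y. y + \<tau> *\<^sub>R b y) has_derivative (\<lambda>v. v + \<tau> *\<^sub>R A x v)) (at x)" for x
      by (intro has_derivative_add has_derivative_ident has_derivative_scaleR_right der)
    \<comment> \<open>The identity perturbed by a map with Lipschitz constant at most 1/2 cannot
      identify two points.\<close>
    show "inj (\<lambda>y. y + \<tau> *\<^sub>R b y)"
    proof (rule injI)
      fix x y assume "x + \<tau> *\<^sub>R b x = y + \<tau> *\<^sub>R b y"
      then have "x - y = \<tau> *\<^sub>R (b y - b x)" by (simp add: algebra_simps)
      then have "norm (x - y) = \<tau> * norm (b y - b x)" using \<open>0 \<le> \<tau>\<close> by simp
      also have "\<dots> \<le> \<tau> * (\<Lambda> * norm (y - x))"
        by (intro mult_left_mono solenoidal_lipschitz[OF b \<open>0 \<le> \<Lambda>\<close>] \<open>0 \<le> \<tau>\<close>)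
      also have "\<dots> = (\<tau> * \<Lambda>) * norm (x - y)" by (simp add: norm_minus_commute)
      also have "\<dots> \<le> 1 / 2 * norm (x - y)" by (intro mult_right_mono assms) simp
      finally show "x = y" by simp
    qed
    have "(\<tau> * \<Lambda>)\<^sup>2 \<le> (1 / 2)\<^sup>2" using assms by (intro power_mono) auto
    then show "0 < 1 - 2 * (\<tau> * \<Lambda>)\<^sup>2" by (simp add: power2_eq_square)
    show "1 - 2 * (\<tau> * \<Lambda>)\<^sup>2 \<le> \<bar>det (matrix (\<lambda>v. v + \<tau> *\<^sub>R A x v))\<bar>" for x
      by (rule det_identity_plus_ge[OF tr bound])
  qed
qed

text \<open>The field depends on the step: \<open>b k\<close> will be the blob field frozen at the
  \<open>k\<close>-th grid time.\<close>

primrec euler :: "real \<Rightarrow> (nat \<Rightarrow> real^2 \<Rightarrow> real^2) \<Rightarrow> nat \<Rightarrow> real^2 \<Rightarrow> real^2" where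
  "euler \<tau> b 0 y = y"
| "euler \<tau> b (Suc k) y = euler \<tau> b k y + \<tau> *\<^sub>R b k (euler \<tau> b k y)"

lemma borel_measurable_euler:
  assumes [measurable]: "\<And>k. b k \<in> borel_measurable borel"
  shows "euler \<tau> b k \<in> borel_measurable borel"
proof (induction k)
  case (Suc k)
  note [measurable] = Suc
  show ?case by simp
qed simp

text \<open>The last step is absorbed into the integrand, which is why \<open>F\<close> must be
  arbitrary in the induction.\<close>

lemma nn_integral_euler_le_power:
  assumes b: "\<And>k. solenoidal \<Lambda> (b k)" and "0 \<le> \<Lambda>" "0 \<le> \<tau>" "\<tau> * \<Lambda> \<le> 1 / 2"
    and F: "F \<in> borel_measurable borel"
  shows "(\<integral>\<^sup>+y. F (euler \<tau> b k y) \<partial>lborel) \<le>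
    ennreal (1 / (1 - 2 * (\<tau> * \<Lambda>)\<^sup>2)) ^ k * (\<integral>\<^sup>+y. F y \<partial>lborel)"
  using F
proof (induction k arbitrary: F)
  case (Suc k)
  note [measurable] = Suc.prems solenoidal_borel[OF b]
  let ?c = "ennreal (1 / (1 - 2 * (\<tau> * \<Lambda>)\<^sup>2))"
  have "(\<integral>\<^sup>+y. F (euler \<tau> b (Suc k) y) \<partial>lborel) =
      (\<integral>\<^sup>+y. (\<lambda>z. F (z + \<tau> *\<^sub>R b k z)) (euler \<tau> b k y) \<partial>lborel)" by simp
  also have "\<dots> \<le> ?c ^ k * (\<integral>\<^sup>+z. F (z + \<tau> *\<^sub>R b k z) \<partial>lborel)"
    by (rule Suc.IH) measurable
  also have "\<dots> \<le> ?c ^ k * (?c * (\<integral>\<^sup>+y. F y \<partial>lborel))"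
    by (intro mult_left_mono nn_integral_solenoidal_step_le assms Suc.prems) simp
  finally show ?case by (simp add: ac_simps)
qed simp

text \<open>Each step costs a factor \<open>1 / (1 - x)\<close> with \<open>x\<close> quadratic in
  the step length. The hypothesis on \<open>n\<close> keeps the sum of these errors below 1/2, and
  Bernoulli's inequality turns this into the factor 2.\<close>

lemma nn_integral_euler_le:
  assumes b: "\<And>k. solenoidal \<Lambda> (b k)" and "0 \<le> \<Lambda>" "0 \<le> \<tau>" "\<tau> * \<Lambda> \<le> 1 / 2"
    and n: "real n * (2 * (\<tau> * \<Lambda>)\<^sup>2) \<le> 1 / 2" and "k \<le> n"
    and F: "F \<in> borel_measurable borel"
  shows "(\<integral>\<^sup>+y. F (euler \<tau> b k y) \<partial>lborel) \<le> 2 * (\<integral>\<^sup>+y. F y \<partial>lborel)"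
proof -
  define x where "x = 2 * (\<tau> * \<Lambda>)\<^sup>2"
  have "(\<tau> * \<Lambda>)\<^sup>2 \<le> (1 / 2)\<^sup>2" using assms by (intro power_mono) auto
  then have x: "0 \<le> x" "x \<le> 1 / 2" by (auto simp: x_def power2_eq_square)
  have "real k * x \<le> real n * x" using \<open>k \<le> n\<close> x by (intro mult_right_mono) auto
  then have "1 / 2 \<le> 1 + real k * (- x)" using n by (simp add: x_def)
  also have "\<dots> \<le> (1 + (- x)) ^ k" using x by (intro Bernoulli_inequality) simp
  finally have "(1 / (1 - x)) ^ k \<le> 2"
    using x by (simp add: power_divide field_simps)
  then have "ennreal (1 / (1 - x)) ^ k \<le> ennreal 2"
    using x by (simp add: ennreal_power ennreal_leI del: ennreal_numeral)
  then have "ennreal (1 / (1 - x)) ^ k * (\<integral>\<^sup>+y. F y \<partial>lborel) \<le> 2 * (\<integral>\<^sup>+y. F y \<partial>lborel)"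
    by (intro mult_right_mono) auto
  with nn_integral_euler_le_power[where b = b, OF assms(1-4) F, of k] show ?thesis
    unfolding x_def by simp
qed

text \<open>The displacement is at most the sum of the steps. Within one step the density
  \<open>q\<close> is replaced by its bound \<open>L\<close> in front of \<open>m\<close>, which can
  then be integrated along the Euler map at the price of a factor 2, whereas the constant part of
  the speed keeps \<open>q\<close> and sees only its mass.\<close>

lemma nn_integral_euler_displacement_le:
  assumes b: "\<And>k. solenoidal \<Lambda> (b k)" and "0 \<le> \<Lambda>" "0 \<le> \<tau>" "\<tau> * \<Lambda> \<le> 1 / 2"
    and n: "real n * (2 * (\<tau> * \<Lambda>)\<^sup>2) \<le> 1 / 2"
    and m[measurable]: "\<And>k. m k \<in> borel_measurable borel" and bm: "\<And>k z. ennreal (norm (b k z)) \<le> m k z + c"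
    and \<kappa>: "\<And>k. (\<integral>\<^sup>+z. m k z \<partial>lborel) \<le> \<kappa>"
    and q[measurable]: "q \<in> borel_measurable borel" and L: "\<And>y. q y \<le> L"
  shows "(\<integral>\<^sup>+y. q y * ennreal (norm (euler \<tau> b n y - y)) \<partial>lborel) \<le>
    ennreal (real n * \<tau>) * (2 * L * \<kappa> + c * (\<integral>\<^sup>+y. q y \<partial>lborel))"
proof -
  note [measurable] = solenoidal_borel[OF b] borel_measurable_euler[OF solenoidal_borel[OF b]]
  let ?I = "2 * L * \<kappa> + c * (\<integral>\<^sup>+y. q y \<partial>lborel)"
  have "(\<integral>\<^sup>+y. q y * ennreal (norm (euler \<tau> b k y - y)) \<partial>lborel) \<le> ennreal (real k * \<tau>) * ?I"
    if "k \<le> n" for k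
    using that
  proof (induction k)
    case (Suc k)
    have "(\<integral>\<^sup>+y. q y * ennreal (norm (euler \<tau> b (Suc k) y - y)) \<partial>lborel) \<le>
      (\<integral>\<^sup>+y. q y * ennreal (norm (euler \<tau> b k y - y)) +
        ennreal \<tau> * (L * m k (euler \<tau> b k y) + c * q y) \<partial>lborel)"
    proof (rule nn_integral_mono)
      fix y
      let ?z = "euler \<tau> b k y"
      have "norm (euler \<tau> b (Suc k) y - y) \<le> norm (?z - y) + \<tau> * norm (b k ?z)"
        using norm_triangle_ineq[of "?z - y" "\<tau> *\<^sub>R b k ?z"] \<open>0 \<le> \<tau>\<close> by (simp add: algebra_simps)
      then have "ennreal (norm (euler \<tau> b (Suc k) y - y)) \<le>
          ennreal (norm (?z - y)) + ennreal \<tau> * ennreal (norm (b k ?z))"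
        using \<open>0 \<le> \<tau>\<close> by (simp add: ennreal_leI flip: ennreal_mult ennreal_plus)
      also have "\<dots> \<le> ennreal (norm (?z - y)) + ennreal \<tau> * (m k ?z + c)"
        by (intro add_left_mono mult_left_mono bm) simp
      finally have "q y * ennreal (norm (euler \<tau> b (Suc k) y - y)) \<le>
          q y * (ennreal (norm (?z - y)) + ennreal \<tau> * (m k ?z + c))"
        by (rule mult_left_mono) simp
      also have "\<dots> = q y * ennreal (norm (?z - y)) + ennreal \<tau> * (q y * m k ?z + c * q y)"
        by (simp add: distrib_left ac_simps)
      also have "\<dots> \<le> q y * ennreal (norm (?z - y)) + ennreal \<tau> * (L * m k ?z + c * q y)"
        by (intro add_left_mono mult_left_mono add_right_mono mult_right_mono L) simp_all
      finally show "q y * ennreal (norm (euler \<tau> b (Suc k) y - y)) \<le>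
        q y * ennreal (norm (?z - y)) + ennreal \<tau> * (L * m k ?z + c * q y)" .
    qed
    also have "\<dots> = (\<integral>\<^sup>+y. q y * ennreal (norm (euler \<tau> b k y - y)) \<partial>lborel) +
        ennreal \<tau> * (L * (\<integral>\<^sup>+y. m k (euler \<tau> b k y) \<partial>lborel) + c * (\<integral>\<^sup>+y. q y \<partial>lborel))"
      by (simp add: nn_integral_add nn_integral_cmult)
    also have "\<dots> \<le> ennreal (real k * \<tau>) * ?I + ennreal \<tau> * ?I"
    proof (intro add_mono mult_left_mono)
      have "(\<integral>\<^sup>+y. m k (euler \<tau> b k y) \<partial>lborel) \<le> 2 * \<kappa>"
        using nn_integral_euler_le[where b = b, OF assms(1-5) Suc_leD[OF Suc.prems] m[of k]]
          mult_left_mono[OF \<kappa>[of k], of 2] by simp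
      then have "L * (\<integral>\<^sup>+y. m k (euler \<tau> b k y) \<partial>lborel) \<le> L * (2 * \<kappa>)"
        by (rule mult_left_mono) simp
      then show "L * (\<integral>\<^sup>+y. m k (euler \<tau> b k y) \<partial>lborel) \<le> 2 * L * \<kappa>" by (simp add: ac_simps)
    qed (use Suc in auto)
    also have "\<dots> = ennreal (real (Suc k) * \<tau>) * ?I"
    proof -
      have "ennreal (real (Suc k) * \<tau>) = ennreal (real k * \<tau>) + ennreal \<tau>"
        using \<open>0 \<le> \<tau>\<close> by (simp add: algebra_simps flip: ennreal_plus)
      then show ?thesis by (simp only: distrib_right)
    qed
    finally show ?case .
  qed simp
  then show ?thesis by simp
qed

lemma discrete_gronwall:
  fixes e :: "nat \<Rightarrow> real"
  assumes "\<And>k. k < n \<Longrightarrow> e (Suc k) \<le> (1 + a) * e k + s" and "0 \<le> a" "0 \<le> s" "0 \<le> e 0" "k \<le> n"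
  shows "e k \<le> exp (real k * a) * (e 0 + real k * s)"
  using \<open>k \<le> n\<close>
proof (induction k)
  case (Suc k)
  have "e (Suc k) \<le> (1 + a) * e k + s" using Suc.prems assms(1) by simp
  also have "\<dots> \<le> (1 + a) * (exp (real k * a) * (e 0 + real k * s)) + s"
    using Suc \<open>0 \<le> a\<close> by (simp add: mult_left_mono)
  also have "\<dots> \<le> exp a * (exp (real k * a) * (e 0 + real k * s)) + exp (real (Suc k) * a) * s"
  proof (rule add_mono)
    show "(1 + a) * (exp (real k * a) * (e 0 + real k * s)) \<le> exp a * (exp (real k * a) * (e 0 + real k * s))"
      using assms by (intro mult_right_mono exp_ge_add_one_self) auto
    have "1 \<le> exp (real (Suc k) * a)" using \<open>0 \<le> a\<close> by simp
    then show "s \<le> exp (real (Suc k) * a) * s" using \<open>0 \<le> s\<close> mult_right_mono by fastforce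
  qed
  also have "\<dots> = exp (real (Suc k) * a) * (e 0 + real (Suc k) * s)"
    by (simp add: distrib_right exp_add algebra_simps)
  finally show ?case .
qed simp

text \<open>The new error in a step is the deviation of the trajectory from its tangent, at most
  \<open>\<tau> * \<sigma>\<close>; the old error grows by the Lipschitz factor. The field has to
  match the trajectory only at grid times, and the arbitrary start \<open>y\<close> allows a vortex
  to be compared with every point of its square.\<close>

lemma euler_error:
  fixes x :: "real \<Rightarrow> real^2"
  assumes b: "\<And>k. solenoidal \<Lambda> (b k)" and "0 \<le> \<Lambda>" "0 \<le> \<tau>" "0 \<le> \<sigma>"
    and T: "real n * \<tau> \<le> T"
    and der: "\<And>s. s \<in> {0..T} \<Longrightarrow> (x has_vector_derivative f s) (at s within {0..T})"
    and f: "\<And>k. k < n \<Longrightarrow> f (real k * \<tau>) = b k (x (real k * \<tau>))"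
    and uc: "\<And>s s'. s \<in> {0..T} \<Longrightarrow> s' \<in> {0..T} \<Longrightarrow> \<bar>s - s'\<bar> \<le> \<tau> \<Longrightarrow> norm (f s - f s') \<le> \<sigma>"
  shows "norm (x (real n * \<tau>) - euler \<tau> b n y) \<le> exp (real n * \<tau> * \<Lambda>) * (norm (x 0 - y) + real n * \<tau> * \<sigma>)"
proof -
  define e where "e k = norm (x (real k * \<tau>) - euler \<tau> b k y)" for k
  have "e n \<le> exp (real n * (\<tau> * \<Lambda>)) * (e 0 + real n * (\<tau> * \<sigma>))"
  proof (rule discrete_gronwall[of n])
    fix k assume k: "k < n"
    let ?t = "real k * \<tau>" and ?t' = "real (Suc k) * \<tau>"
    have "?t' \<le> real n * \<tau>" using k \<open>0 \<le> \<tau>\<close> by (intro mult_right_mono) auto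
    then have t: "0 \<le> ?t" "?t \<le> ?t'" "?t' \<le> T" "?t' - ?t = \<tau>" "?t' = ?t + \<tau>"
      using T \<open>0 \<le> \<tau>\<close> by (auto simp: algebra_simps)
    have sub: "s \<in> {0..T}" if "s \<in> {?t..?t'}" for s
      using that t(1) t(3) unfolding atLeastAtMost_iff by linarith
    have "norm (x ?t' - x ?t - (?t' - ?t) *\<^sub>R f ?t) \<le> norm (?t' - ?t) * \<sigma>"
    proof (rule vector_differentiable_bound_linearization[where S = "{?t..?t'}"])
      show "(x has_vector_derivative f s) (at s within {?t..?t'})" if "s \<in> {?t..?t'}" for s
        by (rule has_vector_derivative_within_subset[OF der[OF sub[OF that]]]) (use sub in blast)
      show "norm (f s - f ?t) \<le> \<sigma>" if "s \<in> {?t..?t'}" for s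
      proof (rule uc)
        show "s \<in> {0..T}" "?t \<in> {0..T}" using sub[of s] sub[of ?t] that t(2) by auto
        show "\<bar>s - ?t\<bar> \<le> \<tau>" using that t(5) unfolding atLeastAtMost_iff by linarith
      qed
      show "closed_segment ?t ?t' \<subseteq> {?t..?t'}" using t by (simp add: closed_segment_eq_real_ivl)
      show "?t \<in> {?t..?t'}" using t by simp
    qed
    then have 1: "norm (x ?t' - x ?t - \<tau> *\<^sub>R b k (x ?t)) \<le> \<tau> * \<sigma>"
      using \<open>0 \<le> \<tau>\<close> unfolding t(4) by (simp add: f[OF k])
    let ?z = "euler \<tau> b k y"
    have 2: "norm (\<tau> *\<^sub>R (b k (x ?t) - b k ?z)) \<le> \<tau> * (\<Lambda> * e k)"
      using solenoidal_lipschitz[OF b \<open>0 \<le> \<Lambda>\<close>, of k "x ?t" ?z] \<open>0 \<le> \<tau>\<close>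
      by (simp add: e_def mult_left_mono)
    have "x ?t' - euler \<tau> b (Suc k) y =
        (x ?t' - x ?t - \<tau> *\<^sub>R b k (x ?t)) + ((x ?t - ?z) + \<tau> *\<^sub>R (b k (x ?t) - b k ?z))"
      by (simp add: algebra_simps)
    then have "e (Suc k) \<le> norm (x ?t' - x ?t - \<tau> *\<^sub>R b k (x ?t)) +
        (norm (x ?t - ?z) + norm (\<tau> *\<^sub>R (b k (x ?t) - b k ?z)))"
      unfolding e_def by (metis add_left_mono norm_triangle_ineq norm_triangle_le)
    then have "e (Suc k) \<le> \<tau> * \<sigma> + (e k + \<tau> * (\<Lambda> * e k))"
      using 1 2 unfolding e_def by linarith
    then show "e (Suc k) \<le> (1 + \<tau> * \<Lambda>) * e k + \<tau> * \<sigma>" by (simp add: algebra_simps)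
  qed (use assms in \<open>auto simp: e_def\<close>)
  then show ?thesis by (simp add: e_def ac_simps)
qed

lemma uniform_modulus:
  fixes f :: "'i \<Rightarrow> real \<Rightarrow> 'b::real_normed_vector"
  assumes "finite I" and cont: "\<And>i. i \<in> I \<Longrightarrow> continuous_on {0..T} (f i)" and "0 < \<sigma>"
  obtains d where "0 < d" "\<And>i s s'. i \<in> I \<Longrightarrow> s \<in> {0..T} \<Longrightarrow> s' \<in> {0..T} \<Longrightarrow> \<bar>s - s'\<bar> < d \<Longrightarrow>
    norm (f i s - f i s') \<le> \<sigma>"
proof -
  have "\<exists>d>0. \<forall>s\<in>{0..T}. \<forall>s'\<in>{0..T}. \<bar>s - s'\<bar> < d \<longrightarrow> norm (f i s - f i s') \<le> \<sigma>" if "i \<in> I" for i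
  proof -
    have "uniformly_continuous_on {0..T} (f i)"
      using cont[OF that] compact_uniformly_continuous by blast
    then obtain d where "0 < d" "\<forall>x\<in>{0..T}. \<forall>x'\<in>{0..T}. dist x' x < d \<longrightarrow> dist (f i x') (f i x) < \<sigma>"
      unfolding uniformly_continuous_on_def using \<open>0 < \<sigma>\<close> by meson
    then show ?thesis
      by (intro exI[of _ d]) (auto simp: dist_norm less_imp_le)
  qed
  then obtain d where d: "\<And>i. i \<in> I \<Longrightarrow> 0 < d i"
    "\<And>i s s'. i \<in> I \<Longrightarrow> s \<in> {0..T} \<Longrightarrow> s' \<in> {0..T} \<Longrightarrow> \<bar>s - s'\<bar> < d i \<Longrightarrow> norm (f i s - f i s') \<le> \<sigma>"
    by metis
  \<comment> \<open>The inserted 1 keeps the minimum meaningful when \<open>I\<close> is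
    empty.\<close>
  show thesis
  proof (rule that[of "Min (insert 1 (d ` I))"])
    show "0 < Min (insert 1 (d ` I))" using d(1) \<open>finite I\<close> by (subst Min_gr_iff) auto
    show "norm (f i s - f i s') \<le> \<sigma>"
      if "i \<in> I" "s \<in> {0..T}" "s' \<in> {0..T}" "\<bar>s - s'\<bar> < Min (insert 1 (d ` I))" for i s s'
    proof (rule d(2)[OF that(1-3)])
      have "Min (insert 1 (d ` I)) \<le> d i" using \<open>finite I\<close> \<open>i \<in> I\<close> by (intro Min_le) auto
      then show "\<bar>s - s'\<bar> < d i" using that(4) by simp
    qed
  qed
qed

section \<open>Approximate flow of finitely many vortices\<close>

lemma nn_integral_superposed_kernel:
  assumes [measurable]: "m \<in> borel_measurable borel"
  shows "(\<integral>\<^sup>+z. (\<Sum>i\<in>I. ennreal \<bar>c i\<bar> * m (z - p i)) \<partial>lborel) = ennreal (\<Sum>i\<in>I. \<bar>c i\<bar>) * (\<integral>\<^sup>+z. m z \<partial>lborel)"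
proof -
  have "(\<integral>\<^sup>+z. (\<Sum>i\<in>I. ennreal \<bar>c i\<bar> * m (z - p i)) \<partial>lborel) =
      (\<Sum>i\<in>I. ennreal \<bar>c i\<bar> * (\<integral>\<^sup>+z. m (z - p i) \<partial>lborel))"
    by (subst nn_integral_sum) (auto simp: nn_integral_cmult)
  also have "\<dots> = (\<Sum>i\<in>I. ennreal \<bar>c i\<bar>) * (\<integral>\<^sup>+z. m z \<partial>lborel)"
    by (simp add: nn_integral_lborel_translation sum_distrib_right del: sum_ennreal)
  finally show ?thesis by (simp add: sum_ennreal)
qed

lemma norm_superposed_kernel_le:
  fixes b :: "'a::real_vector \<Rightarrow> 'b::real_normed_vector"
  assumes "\<And>z. ennreal (norm (b z)) \<le> m z + 1"
  shows "ennreal (norm (\<Sum>i\<in>I. c i *\<^sub>R b (z - p i))) \<le>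
    (\<Sum>i\<in>I. ennreal \<bar>c i\<bar> * m (z - p i)) + ennreal (\<Sum>i\<in>I. \<bar>c i\<bar>)"
proof -
  have "ennreal (norm (\<Sum>i\<in>I. c i *\<^sub>R b (z - p i))) \<le> ennreal (\<Sum>i\<in>I. \<bar>c i\<bar> * norm (b (z - p i)))"
    by (intro ennreal_leI sum_norm_le) simp
  also have "\<dots> = (\<Sum>i\<in>I. ennreal \<bar>c i\<bar> * ennreal (norm (b (z - p i))))"
    by (simp add: ennreal_mult flip: sum_ennreal)
  also have "\<dots> \<le> (\<Sum>i\<in>I. ennreal \<bar>c i\<bar> * (m (z - p i) + 1))"
    by (intro sum_mono mult_left_mono assms) simp
  also have "\<dots> = (\<Sum>i\<in>I. ennreal \<bar>c i\<bar> * m (z - p i)) + ennreal (\<Sum>i\<in>I. \<bar>c i\<bar>)"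
    by (simp add: distrib_left sum.distrib sum_ennreal)
  finally show ?thesis .
qed

text \<open>Once the vortex paths are given, the velocity is a prescribed time-dependent field of
  which the vortices are trajectories, and \<open>\<Phi>\<close> is its Euler scheme up to time
  \<open>t\<close>. The constants involve \<open>M\<close>, \<open>\<Lambda>\<close>,
  \<open>\<kappa>\<close> and \<open>T\<close> but neither the paths nor the number of
  steps.\<close>

lemma point_vortex_flow_approximation:
  fixes X :: "real \<Rightarrow> 'i \<Rightarrow> real^2" and c :: "'i \<Rightarrow> real"
  assumes "finite I" and b: "solenoidal \<Lambda> b" and "0 \<le> \<Lambda>" and c: "(\<Sum>i\<in>I. \<bar>c i\<bar>) \<le> M"
    and m[measurable]: "m \<in> borel_measurable borel" and bm: "\<And>z. ennreal (norm (b z)) \<le> m z + 1"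
    and \<kappa>: "(\<integral>\<^sup>+z. m z \<partial>lborel) \<le> \<kappa>"
    and der: "\<And>i s. i \<in> I \<Longrightarrow> s \<in> {0..T} \<Longrightarrow>
      ((\<lambda>s. X s i) has_vector_derivative (\<Sum>k\<in>I. c k *\<^sub>R b (X s i - X s k))) (at s within {0..T})"
    and t: "t \<in> {0<..T}" and "0 < \<rho>"
  obtains \<Phi> where "\<Phi> \<in> borel_measurable borel"
    "\<And>F. F \<in> borel_measurable borel \<Longrightarrow> (\<integral>\<^sup>+y. F (\<Phi> y) \<partial>lborel) \<le> 2 * (\<integral>\<^sup>+y. F y \<partial>lborel)"
    "\<And>i y. i \<in> I \<Longrightarrow> norm (X t i - \<Phi> y) \<le> exp (T * (M * \<Lambda>)) * (norm (X 0 i - y) + \<rho>)"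
    "\<And>q L. q \<in> borel_measurable borel \<Longrightarrow> (\<And>y. q y \<le> L) \<Longrightarrow>
      (\<integral>\<^sup>+y. q y * ennreal (norm (\<Phi> y - y)) \<partial>lborel) \<le>
        ennreal T * (2 * L * (ennreal M * \<kappa>) + ennreal M * (\<integral>\<^sup>+y. q y \<partial>lborel))"
proof -
  define v where "v s z = (\<Sum>k\<in>I. c k *\<^sub>R b (z - X s k))" for s z
  define \<Gamma> where "\<Gamma> = (\<Sum>i\<in>I. \<bar>c i\<bar>)"
  have \<Gamma>: "0 \<le> \<Gamma>" "\<Gamma> \<le> M" using c by (simp_all add: \<Gamma>_def sum_nonneg)
  define \<Lambda>' where "\<Lambda>' = \<Gamma> * \<Lambda>"
  have \<Lambda>': "0 \<le> \<Lambda>'" "\<Lambda>' \<le> M * \<Lambda>"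
    using \<Gamma> \<open>0 \<le> \<Lambda>\<close> by (auto simp: \<Lambda>'_def intro: mult_right_mono)
  have v: "solenoidal \<Lambda>' (v s)" for s
    unfolding v_def \<Lambda>'_def \<Gamma>_def by (rule solenoidal_sum[OF b])
  have T: "0 < T" "0 < t" "t \<le> T" using t by auto
  have Xcont: "continuous_on {0..T} (\<lambda>s. X s i)" if "i \<in> I" for i
    using der[OF that] has_vector_derivative_continuous continuous_on_eq_continuous_within by blast
  have "continuous_on {0..T} (\<lambda>s. v s (X s i))" if "i \<in> I" for i
    unfolding v_def
    by (intro continuous_intros continuous_on_compose2[OF solenoidal_continuous[OF b]] Xcont that) auto
  \<comment> \<open>A modulus of continuity is needed only along the finitely many vortex paths. The
    tolerance \<open>\<rho> / T\<close> accumulates to at most \<open>\<rho>\<close>.\<close>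
  then obtain d where d: "0 < d" "\<And>i s s'. i \<in> I \<Longrightarrow> s \<in> {0..T} \<Longrightarrow> s' \<in> {0..T} \<Longrightarrow> \<bar>s - s'\<bar> < d \<Longrightarrow>
      norm (v s (X s i) - v s' (X s' i)) \<le> \<rho> / T"
    using uniform_modulus[OF \<open>finite I\<close>, of T "\<lambda>i s. v s (X s i)" "\<rho> / T"] \<open>0 < \<rho>\<close> T by auto
  \<comment> \<open>The summands ensure in turn that \<open>n\<close> is positive, that the step is
    shorter than \<open>d\<close>, that each step is injective, and that the Jacobian factors
    multiply to at most 2.\<close>
  obtain n :: nat where n: "1 + t / d + 2 * (t * \<Lambda>') + 4 * (t * \<Lambda>')\<^sup>2 < real n"
    using reals_Archimedean2 by blast
  have tL: "0 \<le> t * \<Lambda>'" "0 \<le> (t * \<Lambda>')\<^sup>2" "0 < t / d" using T \<Lambda>' d by auto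
  then have n': "1 < real n" "t / d < real n" "2 * (t * \<Lambda>') < real n" "4 * (t * \<Lambda>')\<^sup>2 < real n"
    using n by linarith+
  define \<tau> where "\<tau> = t / real n"
  have \<tau>: "0 \<le> \<tau>" "real n * \<tau> = t" using n' T by (auto simp: \<tau>_def)
  have \<tau>\<Lambda>: "\<tau> * \<Lambda>' \<le> 1 / 2"
    using n' by (simp add: \<tau>_def field_simps)
  have "real n * (2 * (\<tau> * \<Lambda>')\<^sup>2) = 2 * (t * \<Lambda>')\<^sup>2 / real n"
    using n' by (simp add: \<tau>_def field_simps power2_eq_square)
  also have "\<dots> \<le> 1 / 2" using n' by (simp add: field_simps)
  finally have n\<tau>: "real n * (2 * (\<tau> * \<Lambda>')\<^sup>2) \<le> 1 / 2" .
  have \<tau>d: "\<tau> < d" using n' d by (simp add: \<tau>_def field_simps)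
  define bk where "bk k = v (real k * \<tau>)" for k
  have bk: "solenoidal \<Lambda>' (bk k)" for k unfolding bk_def by (rule v)
  note hyps = bk \<Lambda>'(1) \<tau>(1) \<tau>\<Lambda> n\<tau>
  define \<Phi> where "\<Phi> = euler \<tau> bk n"
  show thesis
  proof (rule that[of \<Phi>])
    show "\<Phi> \<in> borel_measurable borel"
      unfolding \<Phi>_def by (intro borel_measurable_euler solenoidal_borel[OF bk])
    show "(\<integral>\<^sup>+y. F (\<Phi> y) \<partial>lborel) \<le> 2 * (\<integral>\<^sup>+y. F y \<partial>lborel)" if "F \<in> borel_measurable borel" for F
      unfolding \<Phi>_def by (rule nn_integral_euler_le[where b = bk, OF hyps order.refl that])
    show "norm (X t i - \<Phi> y) \<le> exp (T * (M * \<Lambda>)) * (norm (X 0 i - y) + \<rho>)" if i: "i \<in> I" for i y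
    proof -
      have "norm (X (real n * \<tau>) i - euler \<tau> bk n y) \<le>
          exp (real n * \<tau> * \<Lambda>') * (norm (X 0 i - y) + real n * \<tau> * (\<rho> / T))"
      proof (rule euler_error[where T = T and f = "\<lambda>s. v s (X s i)"])
        show "real n * \<tau> \<le> T" using T by (simp only: \<tau>(2))
        show "((\<lambda>s. X s i) has_vector_derivative v s (X s i)) (at s within {0..T})" if "s \<in> {0..T}" for s
          using der[OF i that] by (simp add: v_def)
        show "norm (v s (X s i) - v s' (X s' i)) \<le> \<rho> / T"
          if "s \<in> {0..T}" "s' \<in> {0..T}" "\<bar>s - s'\<bar> \<le> \<tau>" for s s'
          using d(2)[OF i] that \<tau>d by simp
      qed (use bk \<Lambda>' \<tau> T \<open>0 < \<rho>\<close> in \<open>auto simp: bk_def\<close>)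
      also have "\<dots> \<le> exp (T * (M * \<Lambda>)) * (norm (X 0 i - y) + \<rho>)"
      proof (intro mult_mono add_left_mono)
        have "t * \<Lambda>' \<le> T * (M * \<Lambda>)" using T \<Lambda>' by (intro mult_mono) auto
        then show "exp (real n * \<tau> * \<Lambda>') \<le> exp (T * (M * \<Lambda>))" by (simp add: \<tau>)
        show "real n * \<tau> * (\<rho> / T) \<le> \<rho>" unfolding \<tau>(2) using T \<open>0 < \<rho>\<close> by (simp add: field_simps)
      qed (use T \<open>0 < \<rho>\<close> in \<open>auto simp: \<tau>(2)\<close>)
      finally show ?thesis by (simp add: \<Phi>_def \<tau>)
    qed
    show "(\<integral>\<^sup>+y. q y * ennreal (norm (\<Phi> y - y)) \<partial>lborel) \<le>
        ennreal T * (2 * L * (ennreal M * \<kappa>) + ennreal M * (\<integral>\<^sup>+y. q y \<partial>lborel))"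
      if q: "q \<in> borel_measurable borel" and L: "\<And>y. q y \<le> L" for q L
    proof -
      \<comment> \<open>Copies of the majorant centered at the vortices at the grid time. Their
        total mass is independent of the positions by translation invariance.\<close>
      define mk where "mk k z = (\<Sum>i\<in>I. ennreal \<bar>c i\<bar> * m (z - X (real k * \<tau>) i))" for k z
      have "(\<integral>\<^sup>+y. q y * ennreal (norm (euler \<tau> bk n y - y)) \<partial>lborel) \<le>
        ennreal (real n * \<tau>) * (2 * L * (ennreal M * \<kappa>) + ennreal M * (\<integral>\<^sup>+y. q y \<partial>lborel))"
      proof (rule nn_integral_euler_displacement_le[where b = bk and m = mk, OF hyps _ _ _ q L])
        show "mk k \<in> borel_measurable borel" for k unfolding mk_def by measurable
        show "ennreal (norm (bk k z)) \<le> mk k z + ennreal M" for k z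
        proof -
          have "ennreal (norm (bk k z)) \<le> mk k z + ennreal \<Gamma>"
            unfolding bk_def v_def mk_def \<Gamma>_def by (rule norm_superposed_kernel_le[OF bm])
          also have "\<dots> \<le> mk k z + ennreal M" by (intro add_left_mono ennreal_leI \<Gamma>)
          finally show ?thesis .
        qed
        show "(\<integral>\<^sup>+z. mk k z \<partial>lborel) \<le> ennreal M * \<kappa>" for k
          unfolding mk_def nn_integral_superposed_kernel[OF m]
          by (intro mult_mono ennreal_leI c \<kappa>) auto
      qed
      also have "\<dots> \<le> ennreal T * (2 * L * (ennreal M * \<kappa>) + ennreal M * (\<integral>\<^sup>+y. q y \<partial>lborel))"
        using T by (intro mult_right_mono ennreal_leI) (simp_all add: \<tau>)
      finally show ?thesis by (simp add: \<Phi>_def)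
    qed
  qed
qed

subsection \<open>The regularized initial vorticity\<close>

lemma AE_lborel_minus:
  assumes "AE z in (lborel :: 'a::euclidean_space measure). P z"
  shows "AE y in lborel. P (x - y)"
proof -
  have "AE z in distr lborel borel (\<lambda>y. x - y). P z" by (subst distr_lborel_minus) (rule assms)
  then show ?thesis by (rule AE_distrD[rotated]) simp
qed

lemma minus_measurable_lebesgue: "(\<lambda>y. x - y) \<in> lebesgue \<rightarrow>\<^sub>M (lebesgue :: 'a::euclidean_space measure)"
  using lebesgue_affine_measurable[where c = "\<lambda>_. -1" and t = x]
  by (simp add: sum_negf euclidean_representation)

text \<open>\<open>f\<close> is only Lebesgue measurable and vanishes only almost everywhere off a
  compact set. A Borel representative cut off to a ball repairs both, and its convolutions agree at
  every point because \<open>y \<mapsto> x - y\<close> preserves null sets.\<close>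

lemma L1_compact_support_borel_representative:
  assumes f: "L1_compact_support f"
  obtains g R where "g \<in> borel_measurable borel" "integrable lborel g" "0 < R"
    "\<And>x. R < norm x \<Longrightarrow> g x = 0"
    "(LINT x|lborel. \<bar>g x\<bar>) = (LINT x|lebesgue. \<bar>f x\<bar>)"
    "\<And>k. k \<in> borel_measurable borel \<Longrightarrow> convolve f k = convolve g k"
proof -
  obtain S where S: "integrable lebesgue f" "compact S" "AE x in lebesgue. x \<notin> S \<longrightarrow> f x = 0"
    using f unfolding L1_compact_support_def by blast
  obtain R0 where R0: "\<And>x. x \<in> S \<Longrightarrow> norm x \<le> R0"
    using compact_imp_bounded[OF S(2)] by (auto simp: bounded_iff)
  define R where "R = max R0 1"
  have f_meas: "f \<in> borel_measurable lebesgue" using S(1) by simp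
  obtain g0 where g0: "g0 \<in> borel_measurable lborel" "AE x in lborel. f x = g0 x"
    using completion_ex_borel_measurable_real[OF f_meas] by blast
  define g where "g x = indicator (cball 0 R) x * g0 x" for x
  have gb[measurable]: "g \<in> borel_measurable borel"
    unfolding g_def using g0(1) by simp
  have S': "AE x in lborel. x \<notin> S \<longrightarrow> f x = 0" using S(3) by (simp add: AE_completion_iff)
  have fg: "AE x in lborel. f x = g x"
    using g0(2) S'
  proof eventually_elim
    case (elim x)
    then show ?case using R0[of x] by (cases "x \<in> S") (auto simp: g_def R_def indicator_def)
  qed
  have fg': "AE x in lebesgue. f x = g x" using fg by (simp add: AE_completion_iff)
  have gl: "g \<in> borel_measurable lebesgue" by (simp add: measurable_completion)
  have "integrable lebesgue g"
    using integrable_cong_AE_imp[OF S(1) gl] fg' by (simp add: eq_commute)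
  then have int: "integrable lborel g"
    by (simp add: integrable_completion)
  have eq: "(LINT x|lebesgue. \<bar>f x\<bar>) = (LINT x|lborel. \<bar>g x\<bar>)"
  proof -
    have "(LINT x|lebesgue. \<bar>f x\<bar>) = (LINT x|lebesgue. \<bar>g x\<bar>)"
      by (rule integral_cong_AE) (use fg' f_meas gl in auto)
    then show ?thesis by (simp add: integral_completion)
  qed
  have conv: "convolve f k = convolve g k" if k: "k \<in> borel_measurable borel" for k
  proof
    fix x
    have fx: "(\<lambda>y. f (x - y)) \<in> borel_measurable lebesgue"
      using measurable_compose[OF minus_measurable_lebesgue f_meas] .
    have kl: "k \<in> borel_measurable lebesgue" using k by (simp add: measurable_completion)
    have gx: "(\<lambda>y. g (x - y)) \<in> borel_measurable lebesgue"
      by (intro measurable_completion) simp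
    have "AE y in lebesgue. f (x - y) = g (x - y)"
      using AE_lborel_minus[OF fg] by (simp add: AE_completion_iff)
    then show "convolve f k x = convolve g k x"
      unfolding convolve_def by (intro integral_cong_AE borel_measurable_scaleR kl fx gx) auto
  qed
  show thesis
    by (rule that[of g R, OF gb int _ _ eq[symmetric] conv]) (auto simp: R_def g_def indicator_def)
qed

text \<open>Dominated convergence as the truncation level tends to infinity.\<close>

lemma truncation_error_small:
  fixes g :: "'a \<Rightarrow> real"
  assumes g: "integrable M g" and "0 < \<eta>"
  obtains L where "0 \<le> L" "(\<integral>\<^sup>+x. ennreal (max 0 (\<bar>g x\<bar> - L)) \<partial>M) \<le> ennreal \<eta>"
proof -
  have [measurable]: "g \<in> borel_measurable M" using g by simp
  have "(\<lambda>n. LINT x|M. max 0 (\<bar>g x\<bar> - real n)) \<longlonglongrightarrow> (LINT x|M. 0)"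
  proof (rule integral_dominated_convergence[where w = "\<lambda>x. \<bar>g x\<bar>"])
    show "AE x in M. (\<lambda>n. max 0 (\<bar>g x\<bar> - real n)) \<longlonglongrightarrow> 0"
    proof (rule AE_I2)
      fix x
      have "\<forall>\<^sub>F n in sequentially. max 0 (\<bar>g x\<bar> - real n) = 0"
        using eventually_ge_at_top[of "nat \<lceil>\<bar>g x\<bar>\<rceil>"] by eventually_elim linarith
      then show "(\<lambda>n. max 0 (\<bar>g x\<bar> - real n)) \<longlonglongrightarrow> 0" by (rule tendsto_eventually)
    qed
  qed (use g in auto)
  then have "\<forall>\<^sub>F n in sequentially. (LINT x|M. max 0 (\<bar>g x\<bar> - real n)) < \<eta>"
    using \<open>0 < \<eta>\<close> by (intro order_tendstoD) auto
  then obtain n where n: "(LINT x|M. max 0 (\<bar>g x\<bar> - real n)) < \<eta>"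
    by (auto simp: eventually_sequentially)
  have "integrable M (\<lambda>x. max 0 (\<bar>g x\<bar> - real n))"
    by (rule Bochner_Integration.integrable_bound[OF integrable_abs[OF g]]) auto
  then have "(\<integral>\<^sup>+x. ennreal (max 0 (\<bar>g x\<bar> - real n)) \<partial>M) = ennreal (LINT x|M. max 0 (\<bar>g x\<bar> - real n))"
    by (intro nn_integral_eq_integral) auto
  with n show thesis by (intro that[of "real n"]) (simp_all add: ennreal_leI)
qed

lemma borel_measurable_convolve:
  fixes g k :: "real^2 \<Rightarrow> real"
  assumes [measurable]: "g \<in> borel_measurable borel" "k \<in> borel_measurable borel"
  shows "convolve g k \<in> borel_measurable borel"
proof -
  have "convolve g k = (\<lambda>x. LINT y|lborel. k (x - y) *\<^sub>R g y)"
    by (rule ext) (simp add: convolve_lborel)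
  then show ?thesis by simp
qed

lemma convolve_le_nn_integral:
  fixes g k :: "real^2 \<Rightarrow> real"
  assumes [measurable]: "g \<in> borel_measurable borel" "k \<in> borel_measurable borel" and k: "\<And>x. 0 \<le> k x"
  shows "ennreal \<bar>convolve g k x\<bar> \<le> (\<integral>\<^sup>+y. ennreal (k (x - y)) * ennreal \<bar>g y\<bar> \<partial>lborel)"
proof -
  let ?f = "\<lambda>y. k (x - y) *\<^sub>R g y"
  have "ennreal (norm (LINT y|lborel. ?f y)) \<le> (\<integral>\<^sup>+y. ennreal (norm (?f y)) \<partial>lborel)"
    by (cases "integrable lborel ?f") (rule integral_norm_bound_ennreal, auto simp: not_integrable_integral_eq)
  also have "\<dots> = (\<integral>\<^sup>+y. ennreal (k (x - y)) * ennreal \<bar>g y\<bar> \<partial>lborel)"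
    using k by (intro nn_integral_cong) (simp add: abs_mult ennreal_mult)
  finally show ?thesis by (simp add: convolve_lborel)
qed

lemma nn_integral_convolution:
  fixes k :: "real^2 \<Rightarrow> real" and u :: "real^2 \<Rightarrow> ennreal"
  assumes [measurable]: "k \<in> borel_measurable borel" "u \<in> borel_measurable borel"
    and k: "(\<integral>\<^sup>+x. ennreal (k x) \<partial>lborel) = 1"
  shows "(\<integral>\<^sup>+x. \<integral>\<^sup>+y. ennreal (k (x - y)) * u y \<partial>lborel \<partial>lborel) = (\<integral>\<^sup>+y. u y \<partial>lborel)"
proof -
  have "(\<integral>\<^sup>+x. \<integral>\<^sup>+y. ennreal (k (x - y)) * u y \<partial>lborel \<partial>lborel) =
      (\<integral>\<^sup>+y. \<integral>\<^sup>+x. ennreal (k (x - y)) * u y \<partial>lborel \<partial>lborel)"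
    by (rule lborel_pair.Fubini') measurable
  also have "\<dots> = (\<integral>\<^sup>+y. u y \<partial>lborel)"
    using nn_integral_lborel_translation[of "\<lambda>x. ennreal (k x)"] k
    by (intro nn_integral_cong) (simp add: nn_integral_multc)
  finally show ?thesis .
qed

text \<open>All bounds are uniform in \<open>\<delta>\<close>. The level \<open>L\<close> is chosen
  for the initial vorticity alone: averaging against a density of mass 1 does not increase the
  integral of the excess above \<open>L\<close>. The support grows by at most 1 because
  \<open>\<delta>\<close> is below 1.\<close>

lemma regularized_vorticity_bounds:
  assumes f: "L1_compact_support f" and j: "standard_mollifier j"
  obtains R where "0 < R"
    "\<And>\<delta>. 0 < \<delta> \<Longrightarrow> convolve f (rescale \<delta> j) \<in> borel_measurable borel"
    "\<And>\<delta>. 0 < \<delta> \<Longrightarrow> (\<integral>\<^sup>+x. ennreal \<bar>convolve f (rescale \<delta> j) x\<bar> \<partial>lborel) \<le> ennreal (LINT x|lebesgue. \<bar>f x\<bar>)"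
    "\<And>\<delta> x. \<delta> \<in> {0<..<1} \<Longrightarrow> R < norm x \<Longrightarrow> convolve f (rescale \<delta> j) x = 0"
    "\<And>\<eta>. 0 < \<eta> \<Longrightarrow> \<exists>L\<ge>0. \<forall>\<delta>>0.
      (\<integral>\<^sup>+x. ennreal (max 0 (\<bar>convolve f (rescale \<delta> j) x\<bar> - L)) \<partial>lborel) \<le> ennreal \<eta>"
proof -
  obtain g R where g[measurable]: "g \<in> borel_measurable borel" and int: "integrable lborel g" and "0 < R"
    and R: "\<And>x. R < norm x \<Longrightarrow> g x = 0" and norm: "(LINT x|lborel. \<bar>g x\<bar>) = (LINT x|lebesgue. \<bar>f x\<bar>)"
    and conv: "\<And>k. k \<in> borel_measurable borel \<Longrightarrow> convolve f k = convolve g k"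
    using L1_compact_support_borel_representative[OF f] by metis
  have jb[measurable]: "rescale \<delta> j \<in> borel_measurable borel" for \<delta>
    by (rule borel_measurable_rescale[OF standard_mollifier_borel[OF j]])
  note j0 = rescale_nonneg[OF j] and j1 = nn_integral_rescale[OF j]
  have fg: "convolve f (rescale \<delta> j) = convolve g (rescale \<delta> j)" for \<delta> by (rule conv[OF jb])
  have le: "ennreal \<bar>convolve g (rescale \<delta> j) x\<bar> \<le> (\<integral>\<^sup>+y. ennreal (rescale \<delta> j (x - y)) * ennreal \<bar>g y\<bar> \<partial>lborel)" for \<delta> x
    by (rule convolve_le_nn_integral[OF g jb j0])
  show thesis
  proof (rule that[of "R + 1"])
    fix \<delta> :: real assume \<delta>: "0 < \<delta>"
    show "convolve f (rescale \<delta> j) \<in> borel_measurable borel"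
      unfolding fg by (rule borel_measurable_convolve[OF g jb])
    have "(\<integral>\<^sup>+x. ennreal \<bar>convolve g (rescale \<delta> j) x\<bar> \<partial>lborel) \<le>
        (\<integral>\<^sup>+x. \<integral>\<^sup>+y. ennreal (rescale \<delta> j (x - y)) * ennreal \<bar>g y\<bar> \<partial>lborel \<partial>lborel)"
      by (intro nn_integral_mono le)
    also have "\<dots> = (\<integral>\<^sup>+y. ennreal \<bar>g y\<bar> \<partial>lborel)"
      by (rule nn_integral_convolution[OF jb _ j1[OF \<delta>]]) measurable
    also have "\<dots> = ennreal (LINT x|lborel. \<bar>g x\<bar>)"
      using int by (intro nn_integral_eq_integral) auto
    finally show "(\<integral>\<^sup>+x. ennreal \<bar>convolve f (rescale \<delta> j) x\<bar> \<partial>lborel) \<le> ennreal (LINT x|lebesgue. \<bar>f x\<bar>)"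
      unfolding fg norm .
  next
    fix \<delta> :: real and x :: "real^2" assume \<delta>: "\<delta> \<in> {0<..<1}" and x: "R + 1 < norm x"
    have z: "rescale \<delta> j (x - y) *\<^sub>R g y = 0" for y
    proof (cases "R < norm y")
      case False
      then have "1 < norm (x - y)" using x norm_triangle_ineq2[of x y] by linarith
      moreover have "norm (x - y) * 1 \<le> norm (x - y) * (1 / \<delta>)" using \<delta> by (intro mult_left_mono) auto
      ultimately have "1 < norm ((x - y) /\<^sub>R \<delta>)" using \<delta> by (simp add: divide_inverse mult.commute)
      then show ?thesis by (simp add: rescale_def standard_mollifier_outside[OF j])
    qed (simp add: R)
    show "convolve f (rescale \<delta> j) x = 0"
      unfolding fg convolve_lborel[OF g jb] z by simp
  next
    fix \<eta> :: real assume "0 < \<eta>"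
    then obtain L where L: "0 \<le> L" "(\<integral>\<^sup>+x. ennreal (max 0 (\<bar>g x\<bar> - L)) \<partial>lborel) \<le> ennreal \<eta>"
      using truncation_error_small[OF int] by metis
    have "(\<integral>\<^sup>+x. ennreal (max 0 (\<bar>convolve g (rescale \<delta> j) x\<bar> - L)) \<partial>lborel) \<le> ennreal \<eta>" if \<delta>: "0 < \<delta>" for \<delta>
    proof -
      define r where "r x = (\<integral>\<^sup>+y. ennreal (rescale \<delta> j (x - y)) * ennreal (max 0 (\<bar>g y\<bar> - L)) \<partial>lborel)" for x
      have "ennreal (max 0 (\<bar>convolve g (rescale \<delta> j) x\<bar> - L)) \<le> r x" for x
      proof -
        have "ennreal \<bar>convolve g (rescale \<delta> j) x\<bar> \<le>
            (\<integral>\<^sup>+y. ennreal (rescale \<delta> j (x - y)) * L + ennreal (rescale \<delta> j (x - y)) * ennreal (max 0 (\<bar>g y\<bar> - L)) \<partial>lborel)"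
        proof (rule order_trans[OF le nn_integral_mono])
          fix y
          have "ennreal \<bar>g y\<bar> \<le> ennreal L + ennreal (max 0 (\<bar>g y\<bar> - L))"
            using L by (auto simp: max_def simp flip: ennreal_plus intro!: ennreal_leI)
          then show "ennreal (rescale \<delta> j (x - y)) * ennreal \<bar>g y\<bar> \<le>
            ennreal (rescale \<delta> j (x - y)) * L + ennreal (rescale \<delta> j (x - y)) * ennreal (max 0 (\<bar>g y\<bar> - L))"
            by (metis distrib_left mult_left_mono zero_le)
        qed
        also have "\<dots> = (\<integral>\<^sup>+y. ennreal (rescale \<delta> j (x - y)) * L \<partial>lborel) + r x"
          unfolding r_def by (rule nn_integral_add) measurable
        also have "(\<integral>\<^sup>+y. ennreal (rescale \<delta> j (x - y)) * L \<partial>lborel) = L"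
          using nn_integral_lborel_minus[of "\<lambda>x. ennreal (rescale \<delta> j x)" x] j1[OF \<delta>]
          by (simp add: nn_integral_multc)
        finally have "ennreal \<bar>convolve g (rescale \<delta> j) x\<bar> \<le> ennreal L + r x" .
        \<comment> \<open>Subtraction in \<open>ennreal\<close> stops at 0 and so agrees with the
          positive part.\<close>
        then have "ennreal \<bar>convolve g (rescale \<delta> j) x\<bar> - ennreal L \<le> r x"
          by (simp add: ennreal_minus_le_iff add.commute)
        then show ?thesis using L(1)
          by (simp add: ennreal_minus max_def ennreal_neg split: if_splits)
      qed
      then have "(\<integral>\<^sup>+x. ennreal (max 0 (\<bar>convolve g (rescale \<delta> j) x\<bar> - L)) \<partial>lborel) \<le> (\<integral>\<^sup>+x. r x \<partial>lborel)"
        by (rule nn_integral_mono)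
      also have "\<dots> = (\<integral>\<^sup>+y. ennreal (max 0 (\<bar>g y\<bar> - L)) \<partial>lborel)"
        unfolding r_def by (rule nn_integral_convolution[OF jb _ j1[OF \<delta>]]) measurable
      finally show ?thesis using L(2) by simp
    qed
    then show "\<exists>L\<ge>0. \<forall>\<delta>>0. (\<integral>\<^sup>+x. ennreal (max 0 (\<bar>convolve f (rescale \<delta> j) x\<bar> - L)) \<partial>lborel) \<le> ennreal \<eta>"
      unfolding fg using L(1) by blast
  qed (use \<open>0 < R\<close> in simp)
qed

subsection \<open>Equi-integrability\<close>

lemma nn_integral_bump_transport:
  fixes \<Phi> :: "real^2 \<Rightarrow> real^2" and \<psi> u :: "real^2 \<Rightarrow> ennreal"
  assumes [measurable]: "\<Phi> \<in> borel_measurable borel" "\<psi> \<in> borel_measurable borel" "u \<in> borel_measurable borel"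
  shows "(\<integral>\<^sup>+x. \<integral>\<^sup>+y. u y * \<psi> (x - \<Phi> y) \<partial>lborel \<partial>lborel) = (\<integral>\<^sup>+x. \<psi> x \<partial>lborel) * (\<integral>\<^sup>+y. u y \<partial>lborel)"
proof -
  have "(\<integral>\<^sup>+x. \<integral>\<^sup>+y. u y * \<psi> (x - \<Phi> y) \<partial>lborel \<partial>lborel) =
      (\<integral>\<^sup>+y. \<integral>\<^sup>+x. u y * \<psi> (x - \<Phi> y) \<partial>lborel \<partial>lborel)"
    by (rule lborel_pair.Fubini') measurable
  also have "\<dots> = (\<integral>\<^sup>+y. (\<integral>\<^sup>+x. \<psi> x \<partial>lborel) * u y \<partial>lborel)"
    by (intro nn_integral_cong) (simp add: nn_integral_cmult nn_integral_lborel_translation mult.commute)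
  finally show ?thesis by (simp add: nn_integral_cmult)
qed

lemma abs_le_truncation:
  assumes "0 \<le> L"
  shows "ennreal \<bar>w\<bar> = ennreal (min \<bar>w\<bar> L) + ennreal (max 0 (\<bar>w\<bar> - L))"
proof -
  have "ennreal (min \<bar>w\<bar> L) + ennreal (max 0 (\<bar>w\<bar> - L)) = ennreal (min \<bar>w\<bar> L + max 0 (\<bar>w\<bar> - L))"
    using assms by (intro ennreal_plus[symmetric]) auto
  also have "min \<bar>w\<bar> L + max 0 (\<bar>w\<bar> - L) = \<bar>w\<bar>" by auto
  finally show ?thesis by (rule sym)
qed

text \<open>The part of \<open>w\<close> below \<open>L\<close> yields a density of at most
  \<open>2 * L * P\<close>, as the integral of \<open>\<psi> (x - \<Phi> y)\<close> over
  \<open>y\<close> is at most \<open>2 * P\<close> for every \<open>x\<close>. For the excess above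
  \<open>L\<close> only the total mass counts.\<close>

lemma transported_mass_on_set:
  fixes \<Phi> :: "real^2 \<Rightarrow> real^2" and \<psi> :: "real^2 \<Rightarrow> ennreal" and w :: "real^2 \<Rightarrow> real"
  assumes [measurable]: "\<Phi> \<in> borel_measurable borel" "\<psi> \<in> borel_measurable borel"
    "w \<in> borel_measurable borel" "A \<in> sets borel"
    and \<Phi>: "\<And>F. F \<in> borel_measurable borel \<Longrightarrow> (\<integral>\<^sup>+y. F (\<Phi> y) \<partial>lborel) \<le> 2 * (\<integral>\<^sup>+y. F y \<partial>lborel)"
    and P: "(\<integral>\<^sup>+x. \<psi> x \<partial>lborel) \<le> P" and "0 \<le> L"
    and \<eta>: "(\<integral>\<^sup>+y. ennreal (max 0 (\<bar>w y\<bar> - L)) \<partial>lborel) \<le> \<eta>"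
  shows "(\<integral>\<^sup>+x. indicator A x * (\<integral>\<^sup>+y. ennreal \<bar>w y\<bar> * \<psi> (x - \<Phi> y) \<partial>lborel) \<partial>lborel) \<le>
    2 * ennreal L * P * emeasure lborel A + P * \<eta>"
proof -
  let ?r = "\<lambda>y. ennreal (max 0 (\<bar>w y\<bar> - L))"
  have "indicator A x * (\<integral>\<^sup>+y. ennreal \<bar>w y\<bar> * \<psi> (x - \<Phi> y) \<partial>lborel) \<le>
      2 * ennreal L * P * indicator A x + (\<integral>\<^sup>+y. ?r y * \<psi> (x - \<Phi> y) \<partial>lborel)" for x
  proof (cases "x \<in> A")
    case True
    have "(\<integral>\<^sup>+y. ennreal \<bar>w y\<bar> * \<psi> (x - \<Phi> y) \<partial>lborel) \<le>
        (\<integral>\<^sup>+y. ennreal L * \<psi> (x - \<Phi> y) + ?r y * \<psi> (x - \<Phi> y) \<partial>lborel)"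
      unfolding abs_le_truncation[OF \<open>0 \<le> L\<close>] distrib_right
      by (intro nn_integral_mono add_right_mono mult_right_mono ennreal_leI) auto
    also have "\<dots> = ennreal L * (\<integral>\<^sup>+y. \<psi> (x - \<Phi> y) \<partial>lborel) + (\<integral>\<^sup>+y. ?r y * \<psi> (x - \<Phi> y) \<partial>lborel)"
      by (subst nn_integral_add) (auto simp: nn_integral_cmult)
    also have "\<dots> \<le> ennreal L * (2 * P) + (\<integral>\<^sup>+y. ?r y * \<psi> (x - \<Phi> y) \<partial>lborel)"
    proof (intro add_right_mono mult_left_mono)
      have "(\<integral>\<^sup>+y. \<psi> (x - \<Phi> y) \<partial>lborel) \<le> 2 * (\<integral>\<^sup>+z. \<psi> (x - z) \<partial>lborel)"
        by (rule \<Phi>[of "\<lambda>z. \<psi> (x - z)"]) measurable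
      also have "\<dots> \<le> 2 * P" using P by (simp add: nn_integral_lborel_minus mult_left_mono)
      finally show "(\<integral>\<^sup>+y. \<psi> (x - \<Phi> y) \<partial>lborel) \<le> 2 * P" .
    qed simp
    finally show ?thesis using True by (simp add: ac_simps)
  qed simp
  then have "(\<integral>\<^sup>+x. indicator A x * (\<integral>\<^sup>+y. ennreal \<bar>w y\<bar> * \<psi> (x - \<Phi> y) \<partial>lborel) \<partial>lborel) \<le>
      (\<integral>\<^sup>+x. 2 * ennreal L * P * indicator A x + (\<integral>\<^sup>+y. ?r y * \<psi> (x - \<Phi> y) \<partial>lborel) \<partial>lborel)"
    by (intro nn_integral_mono)
  also have "\<dots> = 2 * ennreal L * P * emeasure lborel A + (\<integral>\<^sup>+x. \<psi> x \<partial>lborel) * (\<integral>\<^sup>+y. ?r y \<partial>lborel)"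
  proof -
    have "(\<integral>\<^sup>+x. \<integral>\<^sup>+y. ?r y * \<psi> (x - \<Phi> y) \<partial>lborel \<partial>lborel) = (\<integral>\<^sup>+x. \<psi> x \<partial>lborel) * (\<integral>\<^sup>+y. ?r y \<partial>lborel)"
      by (rule nn_integral_bump_transport) measurable
    then show ?thesis by (subst nn_integral_add) (simp_all add: nn_integral_cmult_indicator)
  qed
  also have "\<dots> \<le> 2 * ennreal L * P * emeasure lborel A + P * \<eta>"
    by (intro add_left_mono mult_mono P \<eta>) auto
  finally show ?thesis .
qed

text \<open>If the bump at \<open>\<Phi> y\<close> reaches a point of norm at least
  \<open>R + r + a\<close> and \<open>y\<close> lies in the ball of radius \<open>R\<close>, then
  \<open>y\<close> was moved by at least \<open>a\<close>. The factor
  \<open>norm (\<Phi> y - y) / a\<close> may then be inserted on the bounded part; the excess above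
  \<open>L\<close> is kept without it, since its displacement is not controlled.\<close>

lemma transported_mass_tail:
  fixes \<Phi> :: "real^2 \<Rightarrow> real^2" and \<psi> :: "real^2 \<Rightarrow> ennreal" and w :: "real^2 \<Rightarrow> real"
  assumes [measurable]: "\<Phi> \<in> borel_measurable borel" "\<psi> \<in> borel_measurable borel" "w \<in> borel_measurable borel"
    and P: "(\<integral>\<^sup>+x. \<psi> x \<partial>lborel) \<le> P" and "0 \<le> L"
    and \<eta>: "(\<integral>\<^sup>+y. ennreal (max 0 (\<bar>w y\<bar> - L)) \<partial>lborel) \<le> \<eta>"
    and \<psi>0: "\<And>z. r < norm z \<Longrightarrow> \<psi> z = 0" and w0: "\<And>y. R < norm y \<Longrightarrow> w y = 0" and "0 < a"
    and D: "(\<integral>\<^sup>+y. ennreal (min \<bar>w y\<bar> L) * ennreal (norm (\<Phi> y - y)) \<partial>lborel) \<le> D"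
  shows "(\<integral>\<^sup>+x. indicator (UNIV - ball 0 (R + r + a)) x * (\<integral>\<^sup>+y. ennreal \<bar>w y\<bar> * \<psi> (x - \<Phi> y) \<partial>lborel) \<partial>lborel) \<le>
    P * (\<eta> + ennreal (1 / a) * D)"
proof -
  define u where "u y = ennreal (max 0 (\<bar>w y\<bar> - L)) +
    ennreal (1 / a) * (ennreal (min \<bar>w y\<bar> L) * ennreal (norm (\<Phi> y - y)))" for y
  have [measurable]: "u \<in> borel_measurable borel" unfolding u_def by measurable
  have "indicator (UNIV - ball 0 (R + r + a)) x * (\<integral>\<^sup>+y. ennreal \<bar>w y\<bar> * \<psi> (x - \<Phi> y) \<partial>lborel) \<le>
      (\<integral>\<^sup>+y. u y * \<psi> (x - \<Phi> y) \<partial>lborel)" for x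
  proof (cases "R + r + a \<le> norm x")
    case True
    have "ennreal \<bar>w y\<bar> * \<psi> (x - \<Phi> y) \<le> u y * \<psi> (x - \<Phi> y)" for y
    proof (cases "r < norm (x - \<Phi> y) \<or> R < norm y")
      case False
      then have "a \<le> norm (\<Phi> y - y)"
        using True norm_triangle_ineq[of "x - \<Phi> y" "\<Phi> y - y"] norm_triangle_ineq[of "x - y" y] by simp
      then have "1 \<le> (1 / a) * norm (\<Phi> y - y)" using \<open>0 < a\<close> by (simp add: field_simps)
      then have "min \<bar>w y\<bar> L * 1 \<le> min \<bar>w y\<bar> L * ((1 / a) * norm (\<Phi> y - y))"
        using \<open>0 \<le> L\<close> by (intro mult_left_mono) auto
      then have "ennreal (min \<bar>w y\<bar> L) \<le> ennreal ((1 / a) * (min \<bar>w y\<bar> L * norm (\<Phi> y - y)))"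
        by (intro ennreal_leI) (simp add: ac_simps)
      also have "\<dots> = ennreal (1 / a) * (ennreal (min \<bar>w y\<bar> L) * ennreal (norm (\<Phi> y - y)))"
        using \<open>0 < a\<close> \<open>0 \<le> L\<close> by (subst ennreal_mult, simp, simp, subst ennreal_mult) auto
      finally have "ennreal \<bar>w y\<bar> \<le> u y"
        unfolding abs_le_truncation[OF \<open>0 \<le> L\<close>] u_def by (simp add: add.commute add_left_mono)
      then show ?thesis by (rule mult_right_mono) simp
    qed (use \<psi>0 w0 in auto)
    then show ?thesis using True by (auto intro: nn_integral_mono)
  qed (simp add: indicator_def)
  then have "(\<integral>\<^sup>+x. indicator (UNIV - ball 0 (R + r + a)) x * (\<integral>\<^sup>+y. ennreal \<bar>w y\<bar> * \<psi> (x - \<Phi> y) \<partial>lborel) \<partial>lborel) \<le>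
      (\<integral>\<^sup>+x. \<integral>\<^sup>+y. u y * \<psi> (x - \<Phi> y) \<partial>lborel \<partial>lborel)"
    by (intro nn_integral_mono)
  also have "\<dots> = (\<integral>\<^sup>+x. \<psi> x \<partial>lborel) * (\<integral>\<^sup>+y. u y \<partial>lborel)"
    by (rule nn_integral_bump_transport) measurable
  also have "\<dots> \<le> P * (\<eta> + ennreal (1 / a) * D)"
  proof (rule mult_mono[OF P])
    have "(\<integral>\<^sup>+y. u y \<partial>lborel) = (\<integral>\<^sup>+y. ennreal (max 0 (\<bar>w y\<bar> - L)) \<partial>lborel) +
        ennreal (1 / a) * (\<integral>\<^sup>+y. ennreal (min \<bar>w y\<bar> L) * ennreal (norm (\<Phi> y - y)) \<partial>lborel)"
      unfolding u_def by (subst nn_integral_add) (auto simp: nn_integral_cmult)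
    also have "\<dots> \<le> \<eta> + ennreal (1 / a) * D" by (intro add_mono \<eta> mult_left_mono D) simp
    finally show "(\<integral>\<^sup>+y. u y \<partial>lborel) \<le> \<eta> + ennreal (1 / a) * D" .
  qed auto
  finally show ?thesis .
qed

section \<open>Lattice squares and comparison of the blobs with transported bumps\<close>

text \<open>Interiors of the lattice squares. They are disjoint as sets, so sums of their indicators
  can be bounded at every point.\<close>

definition open_square :: "real \<Rightarrow> real^2 \<Rightarrow> (real^2) set" where
  "open_square h \<alpha> = {x. \<forall>i. \<bar>x $ i - \<alpha> $ i\<bar> < h / 2}"

lemma lattice_square_cbox: "lattice_square h \<alpha> = cbox (\<alpha> - vec (h / 2)) (\<alpha> + vec (h / 2))"
proof -
  have "\<bar>x $ i - \<alpha> $ i\<bar> \<le> h / 2 \<longleftrightarrow> (\<alpha> - vec (h / 2)) $ i \<le> x $ i \<and> x $ i \<le> (\<alpha> + vec (h / 2)) $ i" for x i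
    unfolding abs_le_iff vector_minus_component vector_add_component vec_component by auto
  then show ?thesis unfolding lattice_square_def by (auto simp only: mem_box_cart)
qed

lemma open_square_box: "open_square h \<alpha> = box (\<alpha> - vec (h / 2)) (\<alpha> + vec (h / 2))"
proof -
  have "\<bar>x $ i - \<alpha> $ i\<bar> < h / 2 \<longleftrightarrow> (\<alpha> - vec (h / 2)) $ i < x $ i \<and> x $ i < (\<alpha> + vec (h / 2)) $ i" for x i
    unfolding abs_less_iff vector_minus_component vector_add_component vec_component by auto
  then show ?thesis unfolding open_square_def by (auto simp only: mem_box_cart)
qed

lemma open_square_borel [measurable]: "open_square h \<alpha> \<in> sets borel"
  by (simp add: open_square_box)

lemma open_square_disjoint:
  assumes "0 < h" "\<alpha> \<in> lattice_points h" "\<beta> \<in> lattice_points h" "y \<in> open_square h \<alpha>" "y \<in> open_square h \<beta>"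
  shows "\<alpha> = \<beta>"
proof -
  have "\<alpha> $ i = \<beta> $ i" for i
  proof -
    obtain k l :: int where kl: "\<alpha> $ i = h * of_int k" "\<beta> $ i = h * of_int l"
      using assms(2,3) unfolding lattice_points_def by blast
    have "\<bar>y $ i - \<alpha> $ i\<bar> < h / 2" "\<bar>y $ i - \<beta> $ i\<bar> < h / 2"
      using assms(4,5) unfolding open_square_def by blast+
    then have "\<bar>h * of_int k - h * of_int l\<bar> < h" unfolding kl by linarith
    then have "h * \<bar>of_int k - of_int l\<bar> < h * 1"
      using \<open>0 < h\<close> by (simp add: abs_mult flip: right_diff_distrib)
    then have "\<bar>of_int k - of_int l :: real\<bar> < 1" using \<open>0 < h\<close> mult_less_cancel_left_pos by blast
    then have "k = l" by linarith
    then show ?thesis by (simp add: kl)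
  qed
  then show ?thesis by (simp add: vec_eq_iff)
qed

lemma norm_diff_open_square:
  assumes "y \<in> open_square h \<alpha>"
  shows "norm (\<alpha> - y) \<le> h"
proof -
  have "\<bar>(\<alpha> - y) $ 1\<bar> + \<bar>(\<alpha> - y) $ 2\<bar> \<le> h"
  proof -
    have "\<bar>y $ 1 - \<alpha> $ 1\<bar> < h / 2" "\<bar>y $ 2 - \<alpha> $ 2\<bar> < h / 2"
      using assms unfolding open_square_def by blast+
    then show ?thesis unfolding vector_minus_component by linarith
  qed
  then show ?thesis using norm_le_l1_cart[of "\<alpha> - y"] by (simp add: UNIV_2)
qed

text \<open>The square and its interior differ by a null set, so the absolute integral can be taken
  over the interior.\<close>

lemma circulation_le:
  assumes [measurable]: "w \<in> borel_measurable borel"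
  shows "ennreal \<bar>circulation h w \<alpha>\<bar> \<le> (\<integral>\<^sup>+y. indicator (open_square h \<alpha>) y * ennreal \<bar>w y\<bar> \<partial>lborel)"
proof -
  let ?Q = "lattice_square h \<alpha>"
  have Q[measurable]: "?Q \<in> sets borel" by (simp add: lattice_square_cbox)
  have "circulation h w \<alpha> = (LINT y|lborel. indicator ?Q y *\<^sub>R w y)"
    unfolding circulation_def set_lebesgue_integral_def by (subst integral_completion) auto
  then have "ennreal \<bar>circulation h w \<alpha>\<bar> = ennreal (norm (LINT y|lborel. indicator ?Q y *\<^sub>R w y))" by simp
  also have "\<dots> \<le> (\<integral>\<^sup>+y. ennreal (norm (indicator ?Q y *\<^sub>R w y)) \<partial>lborel)"
    by (cases "integrable lborel (\<lambda>y. indicator ?Q y *\<^sub>R w y)")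
      (rule integral_norm_bound_ennreal, auto simp: not_integrable_integral_eq)
  also have "\<dots> = (\<integral>\<^sup>+y. indicator (open_square h \<alpha>) y * ennreal \<bar>w y\<bar> \<partial>lborel)"
  proof (rule nn_integral_cong_AE)
    have "AE y in lborel. y \<notin> ?Q - open_square h \<alpha>"
      unfolding lattice_square_cbox open_square_box by (rule AE_not_in[OF null_sets_cbox_Diff_box])
    then show "AE y in lborel. ennreal (norm (indicator ?Q y *\<^sub>R w y)) = indicator (open_square h \<alpha>) y * ennreal \<bar>w y\<bar>"
    proof eventually_elim
      case (elim y)
      have "open_square h \<alpha> \<subseteq> ?Q" unfolding lattice_square_cbox open_square_box by (rule box_subset_cbox)
      with elim show ?case by (auto simp: indicator_def)
    qed
  qed
  finally show ?thesis .
qed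

text \<open>At most one summand is nonzero at \<open>y\<close>. Over an infinite index set the sum
  is 0 by convention, which respects the bound too.\<close>

lemma sum_indicator_open_square_le:
  fixes f :: "real^2 \<Rightarrow> ennreal"
  assumes "0 < h" "I \<subseteq> lattice_points h" and f: "\<And>\<alpha>. \<alpha> \<in> I \<Longrightarrow> y \<in> open_square h \<alpha> \<Longrightarrow> f \<alpha> \<le> c"
  shows "(\<Sum>\<alpha>\<in>I. indicator (open_square h \<alpha>) y * f \<alpha>) \<le> c"
proof (cases "finite I \<and> (\<exists>\<alpha>\<in>I. y \<in> open_square h \<alpha>)")
  case True
  then obtain \<alpha> where \<alpha>: "\<alpha> \<in> I" "y \<in> open_square h \<alpha>" by blast
  have "indicator (open_square h \<beta>) y * f \<beta> = 0" if "\<beta> \<in> I - {\<alpha>}" for \<beta>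
    using open_square_disjoint[of h \<alpha> \<beta> y] assms(1,2) that \<alpha> by (auto simp: indicator_def)
  then have "(\<Sum>\<beta>\<in>I. indicator (open_square h \<beta>) y * f \<beta>) = (\<Sum>\<beta>\<in>{\<alpha>}. indicator (open_square h \<beta>) y * f \<beta>)"
    using True \<alpha> by (intro sum.mono_neutral_right) auto
  also have "\<dots> \<le> c" using f \<alpha> by simp
  finally show ?thesis .
next
  case False
  then have "(\<Sum>\<alpha>\<in>I. indicator (open_square h \<alpha>) y * f \<alpha>) = 0"
    by (cases "finite I") (auto simp: indicator_def intro!: sum.neutral)
  then show ?thesis by simp
qed

lemma blob_centers_lattice: "blob_centers h w \<subseteq> lattice_points h"
  by (auto simp: blob_centers_def)

lemma sum_circulation_le:
  assumes w[measurable]: "w \<in> borel_measurable borel" and "0 < h"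
    and M: "(\<integral>\<^sup>+y. ennreal \<bar>w y\<bar> \<partial>lborel) \<le> ennreal M" "0 \<le> M"
  shows "(\<Sum>\<alpha>\<in>blob_centers h w. \<bar>circulation h w \<alpha>\<bar>) \<le> M"
proof -
  let ?I = "blob_centers h w"
  have "ennreal (\<Sum>\<alpha>\<in>?I. \<bar>circulation h w \<alpha>\<bar>) = (\<Sum>\<alpha>\<in>?I. ennreal \<bar>circulation h w \<alpha>\<bar>)"
    by (simp add: sum_ennreal)
  also have "\<dots> \<le> (\<Sum>\<alpha>\<in>?I. \<integral>\<^sup>+y. indicator (open_square h \<alpha>) y * ennreal \<bar>w y\<bar> \<partial>lborel)"
    by (intro sum_mono circulation_le w)
  also have "\<dots> = (\<integral>\<^sup>+y. (\<Sum>\<alpha>\<in>?I. indicator (open_square h \<alpha>) y * ennreal \<bar>w y\<bar>) \<partial>lborel)"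
    by (rule nn_integral_sum[symmetric]) measurable
  also have "\<dots> \<le> (\<integral>\<^sup>+y. ennreal \<bar>w y\<bar> \<partial>lborel)"
    by (intro nn_integral_mono sum_indicator_open_square_le[OF \<open>0 < h\<close> blob_centers_lattice]) simp
  finally have "ennreal (\<Sum>\<alpha>\<in>?I. \<bar>circulation h w \<alpha>\<bar>) \<le> ennreal M" using M(1) by (rule order_trans)
  then show ?thesis using M by simp
qed

text \<open>Constant on a ball enlarged by \<open>D * \<epsilon>\<close>, so that it dominates the
  rescaled mollifier even when that one is displaced by this distance. Height of order
  \<open>1 / \<epsilon>\<^sup>2\<close> and area of order \<open>\<epsilon>\<^sup>2\<close> make the
  mass independent of \<open>\<epsilon>\<close>.\<close>

definition bump :: "real \<Rightarrow> real \<Rightarrow> real \<Rightarrow> real^2 \<Rightarrow> ennreal" where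
  "bump B D \<epsilon> z = ennreal (B / \<epsilon>\<^sup>2) * indicator (cball 0 ((1 + D) * \<epsilon>)) z"

lemma borel_measurable_bump [measurable]: "bump B D \<epsilon> \<in> borel_measurable borel"
  unfolding bump_def by measurable

lemma nn_integral_bump:
  assumes "0 \<le> B" "0 \<le> D" "0 < \<epsilon>"
  shows "(\<integral>\<^sup>+z. bump B D \<epsilon> z \<partial>lborel) = ennreal (B * pi * (1 + D)\<^sup>2)"
proof -
  have "(\<integral>\<^sup>+z. bump B D \<epsilon> z \<partial>lborel) = ennreal (B / \<epsilon>\<^sup>2) * ennreal (pi * ((1 + D) * \<epsilon>)\<^sup>2)"
    unfolding bump_def using assms by (simp add: nn_integral_cmult_indicator emeasure_cball_real2)
  also have "\<dots> = ennreal (B / \<epsilon>\<^sup>2 * (pi * ((1 + D) * \<epsilon>)\<^sup>2))"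
    using assms by (intro ennreal_mult[symmetric]) auto
  also have "B / \<epsilon>\<^sup>2 * (pi * ((1 + D) * \<epsilon>)\<^sup>2) = B * pi * (1 + D)\<^sup>2"
    using assms by (simp add: power_mult_distrib)
  finally show ?thesis .
qed

lemma rescale_le_bump:
  assumes \<phi>: "standard_mollifier \<phi>" and B: "\<And>x. \<bar>\<phi> x\<bar> \<le> B" and "0 < \<epsilon>" and close: "norm (p - q) \<le> D * \<epsilon>"
  shows "ennreal (rescale \<epsilon> \<phi> (x - p)) \<le> bump B D \<epsilon> (x - q)"
proof (cases "norm (x - p) \<le> \<epsilon>")
  case True
  then have "norm (x - q) \<le> (1 + D) * \<epsilon>"
    using close norm_triangle_ineq[of "x - p" "p - q"] by (simp add: distrib_right)
  moreover have "rescale \<epsilon> \<phi> (x - p) \<le> B / \<epsilon>\<^sup>2"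
    unfolding rescale_def using B[of "(x - p) /\<^sub>R \<epsilon>"] by (intro divide_right_mono) auto
  ultimately show ?thesis by (simp add: bump_def ennreal_leI)
next
  case False
  then have "1 < norm (x - p) / \<epsilon>" using \<open>0 < \<epsilon>\<close> by (simp add: field_simps)
  also have "\<dots> = norm ((x - p) /\<^sub>R \<epsilon>)" using \<open>0 < \<epsilon>\<close> by (simp add: divide_inverse mult.commute)
  finally have "1 < norm ((x - p) /\<^sub>R \<epsilon>)" .
  then have "rescale \<epsilon> \<phi> (x - p) = 0" by (simp add: rescale_def standard_mollifier_outside[OF \<phi>])
  then show ?thesis by simp
qed

text \<open>Each circulation is spread back over its square as an integral of \<open>w\<close>. For
  \<open>y\<close> in that square the vortex is close to \<open>\<Phi> y\<close>, so the bump
  centered there dominates the blob.\<close>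

lemma blob_vorticity_le_transported_bump:
  assumes \<phi>: "standard_mollifier \<phi>" and B: "\<And>x. \<bar>\<phi> x\<bar> \<le> B" and "0 < \<epsilon>" "0 < h"
    and w[measurable]: "w \<in> borel_measurable borel" and \<Phi>[measurable]: "\<Phi> \<in> borel_measurable borel"
    and close: "\<And>\<alpha> y. \<alpha> \<in> blob_centers h w \<Longrightarrow> y \<in> open_square h \<alpha> \<Longrightarrow> norm (Y \<alpha> - \<Phi> y) \<le> D * \<epsilon>"
  shows "ennreal \<bar>blob_vorticity \<phi> \<epsilon> h w Y x\<bar> \<le> (\<integral>\<^sup>+y. ennreal \<bar>w y\<bar> * bump B D \<epsilon> (x - \<Phi> y) \<partial>lborel)"
proof -
  let ?I = "blob_centers h w" and ?r = "\<lambda>\<alpha>. rescale \<epsilon> \<phi> (x - Y \<alpha>)"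
  have r0: "0 \<le> ?r \<alpha>" for \<alpha> by (rule rescale_nonneg[OF \<phi>])
  have "\<bar>blob_vorticity \<phi> \<epsilon> h w Y x\<bar> \<le> (\<Sum>\<alpha>\<in>?I. \<bar>circulation h w \<alpha>\<bar> * ?r \<alpha>)"
    unfolding blob_vorticity_def using r0 by (intro order_trans[OF sum_abs]) (simp add: abs_mult)
  then have "ennreal \<bar>blob_vorticity \<phi> \<epsilon> h w Y x\<bar> \<le> ennreal (\<Sum>\<alpha>\<in>?I. \<bar>circulation h w \<alpha>\<bar> * ?r \<alpha>)"
    by (rule ennreal_leI)
  also have "\<dots> = (\<Sum>\<alpha>\<in>?I. ennreal \<bar>circulation h w \<alpha>\<bar> * ennreal (?r \<alpha>))"
    using r0 by (simp add: ennreal_mult flip: sum_ennreal)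
  also have "\<dots> \<le> (\<Sum>\<alpha>\<in>?I. (\<integral>\<^sup>+y. indicator (open_square h \<alpha>) y * ennreal \<bar>w y\<bar> \<partial>lborel) * ennreal (?r \<alpha>))"
    by (intro sum_mono mult_right_mono circulation_le w) simp
  also have "\<dots> = (\<integral>\<^sup>+y. (\<Sum>\<alpha>\<in>?I. indicator (open_square h \<alpha>) y * (ennreal \<bar>w y\<bar> * ennreal (?r \<alpha>))) \<partial>lborel)"
    by (subst nn_integral_sum) (auto simp: nn_integral_multc mult.assoc[symmetric])
  also have "\<dots> \<le> (\<integral>\<^sup>+y. ennreal \<bar>w y\<bar> * bump B D \<epsilon> (x - \<Phi> y) \<partial>lborel)"
  proof (intro nn_integral_mono sum_indicator_open_square_le[OF \<open>0 < h\<close> blob_centers_lattice] mult_left_mono)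
    fix y \<alpha> assume "\<alpha> \<in> ?I" "y \<in> open_square h \<alpha>"
    then show "ennreal (?r \<alpha>) \<le> bump B D \<epsilon> (x - \<Phi> y)"
      by (intro rescale_le_bump[OF \<phi> B \<open>0 < \<epsilon>\<close>] close)
  qed simp
  finally show ?thesis .
qed

text \<open>The discretization tolerance is chosen equal to \<open>h\<close>. Together with the
  distance from a vortex to the points of its square this gives an initial error of at most
  \<open>2 * h\<close>, which is the origin of \<open>2 * C\<close> in the bump.\<close>

lemma blob_transport:
  assumes \<phi>: "standard_mollifier \<phi>" and B: "\<And>x. \<bar>\<phi> x\<bar> \<le> B"
    and K: "\<And>\<epsilon>. 0 < \<epsilon> \<Longrightarrow> solenoidal (K / \<epsilon>\<^sup>2) (convolve biot_savart (rescale \<epsilon> \<phi>))" and "0 \<le> K"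
    and "0 < T" "0 \<le> M" "0 < C" and C0: "T * M * K \<le> C0"
    and \<epsilon>: "0 < \<epsilon>" "\<epsilon> < 1" and h: "0 < h" "h \<le> C * \<epsilon> ^ 4 * exp (- (C0 / \<epsilon>\<^sup>2))"
    and w: "w \<in> borel_measurable borel" "(\<integral>\<^sup>+y. ennreal \<bar>w y\<bar> \<partial>lborel) \<le> ennreal M"
    and X: "blob_trajectories T \<phi> \<epsilon> h w X" and t: "t \<in> {0<..<T}"
  obtains \<Phi> where "\<Phi> \<in> borel_measurable borel"
    "\<And>F. F \<in> borel_measurable borel \<Longrightarrow> (\<integral>\<^sup>+y. F (\<Phi> y) \<partial>lborel) \<le> 2 * (\<integral>\<^sup>+y. F y \<partial>lborel)"
    "\<And>L. 0 \<le> L \<Longrightarrow> (\<integral>\<^sup>+y. ennreal (min \<bar>w y\<bar> L) * ennreal (norm (\<Phi> y - y)) \<partial>lborel) \<le>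
      ennreal (T * (2 * L * (M * near_mass) + M * M))"
    "\<And>x. ennreal \<bar>blob_vorticity \<phi> \<epsilon> h w (X t) x\<bar> \<le>
      (\<integral>\<^sup>+y. ennreal \<bar>w y\<bar> * bump B (2 * C) \<epsilon> (x - \<Phi> y) \<partial>lborel)"
proof (cases "finite (blob_centers h w)")
  case False
  \<comment> \<open>A sum over an infinite index set is 0 by convention, and then the identity
    serves as \<open>\<Phi>\<close>.\<close>
  then have "blob_vorticity \<phi> \<epsilon> h w (X t) x = 0" for x by (simp add: blob_vorticity_def)
  then show thesis by (intro that[of "\<lambda>y. y"]) (auto simp: mult_le_cancel_right1 intro: order_trans[OF _ mult_right_mono[of 1 2]])
next
  case True
  let ?I = "blob_centers h w"
  note [measurable] = w(1)
  have t': "t \<in> {0<..T}" using t by simp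
  have \<kappa>: "(\<integral>\<^sup>+z. smeared_kernel \<epsilon> \<phi> z \<partial>lborel) \<le> ennreal near_mass"
    by (simp add: nn_integral_smeared_kernel[OF \<phi> \<epsilon>(1)])
  have K\<epsilon>: "0 \<le> K / \<epsilon>\<^sup>2" using \<open>0 \<le> K\<close> by simp
  have der: "((\<lambda>s. X s \<alpha>) has_vector_derivative
      (\<Sum>\<beta>\<in>?I. circulation h w \<beta> *\<^sub>R convolve biot_savart (rescale \<epsilon> \<phi>) (X s \<alpha> - X s \<beta>))) (at s within {0..T})"
    if "\<alpha> \<in> ?I" "s \<in> {0..T}" for \<alpha> s
    using X that unfolding blob_trajectories_def blob_velocity_def by blast
  have X0: "X 0 \<alpha> = \<alpha>" if "\<alpha> \<in> ?I" for \<alpha>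
    using X that unfolding blob_trajectories_def by blast
  obtain \<Phi> where \<Phi>: "\<Phi> \<in> borel_measurable borel"
    "\<And>F. F \<in> borel_measurable borel \<Longrightarrow> (\<integral>\<^sup>+y. F (\<Phi> y) \<partial>lborel) \<le> 2 * (\<integral>\<^sup>+y. F y \<partial>lborel)"
    and close: "\<And>\<alpha> y. \<alpha> \<in> ?I \<Longrightarrow> norm (X t \<alpha> - \<Phi> y) \<le> exp (T * (M * (K / \<epsilon>\<^sup>2))) * (norm (X 0 \<alpha> - y) + h)"
    and disp: "\<And>q L. q \<in> borel_measurable borel \<Longrightarrow> (\<And>y. q y \<le> L) \<Longrightarrow>
      (\<integral>\<^sup>+y. q y * ennreal (norm (\<Phi> y - y)) \<partial>lborel) \<le>
        ennreal T * (2 * L * (ennreal M * ennreal near_mass) + ennreal M * (\<integral>\<^sup>+y. q y \<partial>lborel))"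
    by (rule point_vortex_flow_approximation[OF True K[OF \<epsilon>(1)] K\<epsilon> sum_circulation_le[OF w(1) h(1) w(2) \<open>0 \<le> M\<close>]
        borel_measurable_smeared_kernel[OF \<phi>] norm_convolve_biot_savart_le[OF \<phi> \<epsilon>(1)] \<kappa> der t' h(1)]) blast+
  show thesis
  proof (rule that[OF \<Phi>])
    fix L :: real assume "0 \<le> L"
    let ?q = "\<lambda>y. ennreal (min \<bar>w y\<bar> L)"
    have "(\<integral>\<^sup>+y. ?q y \<partial>lborel) \<le> ennreal M"
      by (rule order_trans[OF nn_integral_mono w(2)]) (simp add: ennreal_leI)
    then have qM: "ennreal M * (\<integral>\<^sup>+y. ?q y \<partial>lborel) \<le> ennreal M * ennreal M"
      by (rule mult_left_mono) simp
    have "(\<integral>\<^sup>+y. ?q y * ennreal (norm (\<Phi> y - y)) \<partial>lborel) \<le>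
        ennreal T * (2 * ennreal L * (ennreal M * ennreal near_mass) + ennreal M * (\<integral>\<^sup>+y. ?q y \<partial>lborel))"
      by (rule disp) (simp_all add: ennreal_leI)
    also have "\<dots> \<le> ennreal T * (2 * ennreal L * (ennreal M * ennreal near_mass) + ennreal M * ennreal M)"
      by (rule mult_left_mono[OF add_left_mono[OF qM]]) simp
    also have "\<dots> = ennreal (T * (2 * L * (M * near_mass) + M * M))"
      using \<open>0 < T\<close> \<open>0 \<le> M\<close> \<open>0 \<le> L\<close> near_mass_nonneg by (simp add: ennreal_mult)
    finally show "(\<integral>\<^sup>+y. ?q y * ennreal (norm (\<Phi> y - y)) \<partial>lborel) \<le> ennreal (T * (2 * L * (M * near_mass) + M * M))" .
  next
    fix x
    show "ennreal \<bar>blob_vorticity \<phi> \<epsilon> h w (X t) x\<bar> \<le> (\<integral>\<^sup>+y. ennreal \<bar>w y\<bar> * bump B (2 * C) \<epsilon> (x - \<Phi> y) \<partial>lborel)"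
    proof (rule blob_vorticity_le_transported_bump[OF \<phi> B \<epsilon>(1) h(1) w(1) \<Phi>(1)])
      fix \<alpha> y assume \<alpha>: "\<alpha> \<in> ?I" and y: "y \<in> open_square h \<alpha>"
      \<comment> \<open>The Gronwall exponent is absorbed by \<open>C0\<close>, so the two
        exponentials cancel and a power of \<open>\<epsilon>\<close> remains.\<close>
      have "T * (M * (K / \<epsilon>\<^sup>2)) \<le> C0 / \<epsilon>\<^sup>2"
        using divide_right_mono[OF C0, of "\<epsilon>\<^sup>2"] by (simp add: mult.assoc)
      then have "exp (T * (M * (K / \<epsilon>\<^sup>2))) \<le> exp (C0 / \<epsilon>\<^sup>2)" by simp
      moreover have "norm (X 0 \<alpha> - y) + h \<le> 2 * (C * \<epsilon> ^ 4 * exp (- (C0 / \<epsilon>\<^sup>2)))"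
        using norm_diff_open_square[OF y] h(2) by (simp add: X0[OF \<alpha>])
      ultimately have "exp (T * (M * (K / \<epsilon>\<^sup>2))) * (norm (X 0 \<alpha> - y) + h) \<le>
          exp (C0 / \<epsilon>\<^sup>2) * (2 * (C * \<epsilon> ^ 4 * exp (- (C0 / \<epsilon>\<^sup>2))))"
        using h(1) by (intro mult_mono) auto
      also have "\<dots> = (2 * C) * \<epsilon> ^ 4" by (simp add: exp_minus)
      also have "\<dots> \<le> (2 * C) * \<epsilon> ^ 1"
        using \<epsilon> \<open>0 < C\<close> by (intro mult_left_mono power_decreasing) auto
      finally show "norm (X t \<alpha> - \<Phi> y) \<le> 2 * C * \<epsilon>" using close[OF \<alpha>, of y] by simp
    qed
  qed
qed

section \<open>From time slices to space-time\<close>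

text \<open>Tonelli's theorem. Measurability is asked for only after the cutoff, because the
  trajectories are controlled only for times in \<open>{0..T}\<close>.\<close>

lemma nn_integral_strip:
  fixes g :: "real \<times> (real^2) \<Rightarrow> ennreal"
  assumes g: "(\<lambda>z. indicator ({0<..<T} \<times> UNIV) z * g z) \<in> borel_measurable borel"
  shows "(\<integral>\<^sup>+z. indicator ({0<..<T} \<times> UNIV) z * g z \<partial>lborel) =
    (\<integral>\<^sup>+t. indicator {0<..<T} t * (\<integral>\<^sup>+x. g (t, x) \<partial>lborel) \<partial>lborel)"
proof -
  let ?G = "\<lambda>z. indicator ({0<..<T} \<times> UNIV) z * g z"
  have G: "?G \<in> borel_measurable (lborel \<Otimes>\<^sub>M lborel)" using g by (simp add: lborel_prod)
  have "(\<integral>\<^sup>+z. ?G z \<partial>lborel) = (\<integral>\<^sup>+z. ?G z \<partial>(lborel \<Otimes>\<^sub>M lborel))" by (simp add: lborel_prod)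
  also have "\<dots> = (\<integral>\<^sup>+t. \<integral>\<^sup>+x. ?G (t, x) \<partial>lborel \<partial>lborel)"
    by (rule lborel.nn_integral_fst[OF G, symmetric])
  also have "\<dots> = (\<integral>\<^sup>+t. indicator {0<..<T} t * (\<integral>\<^sup>+x. g (t, x) \<partial>lborel) \<partial>lborel)"
    by (intro nn_integral_cong) (auto simp: indicator_def)
  finally show ?thesis .
qed

text \<open>The comparison is made for nonnegative integrals, so the set may be enlarged to one with
  Borel slices. Should the left-hand integrand fail to be integrable, its integral is 0 by
  convention and the bound still holds.\<close>

lemma set_integral_abs_le:
  fixes f :: "'a::euclidean_space \<Rightarrow> real"
  assumes "A \<subseteq> N" and "(\<integral>\<^sup>+z. indicator N z * ennreal \<bar>f z\<bar> \<partial>lborel) \<le> ennreal r" and "0 \<le> r"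
  shows "(LINT z:A|lebesgue. \<bar>f z\<bar>) \<le> r"
  unfolding set_lebesgue_integral_def
proof (rule integral_real_bounded[OF \<open>0 \<le> r\<close>])
  have "(\<integral>\<^sup>+z. ennreal (indicator A z *\<^sub>R \<bar>f z\<bar>) \<partial>lebesgue) \<le> (\<integral>\<^sup>+z. indicator N z * ennreal \<bar>f z\<bar> \<partial>lborel)"
    unfolding nn_integral_completion using \<open>A \<subseteq> N\<close>
    by (intro nn_integral_mono) (auto simp: indicator_def)
  then show "(\<integral>\<^sup>+z. ennreal (indicator A z *\<^sub>R \<bar>f z\<bar>) \<partial>lebesgue) \<le> ennreal r"
    using assms(2) by (rule order_trans)
qed

text \<open>The bound \<open>small\<close> is linear in the measure of the slice because the slices of a small set of
  space-time need not be small.\<close>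

lemma equi_integrable_from_slices:
  fixes f :: "'i \<Rightarrow> real \<times> (real^2) \<Rightarrow> real"
  assumes "0 < T"
    and meas: "\<And>i. i \<in> I \<Longrightarrow> (\<lambda>z. indicator ({0<..<T} \<times> UNIV) z *\<^sub>R f i z) \<in> borel_measurable borel"
    and bound: "\<And>i t. i \<in> I \<Longrightarrow> t \<in> {0<..<T} \<Longrightarrow> (\<integral>\<^sup>+x. ennreal \<bar>f i (t, x)\<bar> \<partial>lborel) \<le> ennreal b"
    and small: "\<And>\<eta>. 0 < \<eta> \<Longrightarrow> \<exists>c>0. \<forall>i\<in>I. \<forall>t\<in>{0<..<T}. \<forall>A\<in>sets borel.
      (\<integral>\<^sup>+x. indicator A x * ennreal \<bar>f i (t, x)\<bar> \<partial>lborel) \<le> ennreal c * emeasure lborel A + ennreal \<eta>"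
    and tail: "\<And>\<eta>. 0 < \<eta> \<Longrightarrow> \<exists>R>0. \<forall>i\<in>I. \<forall>t\<in>{0<..<T}.
      (\<integral>\<^sup>+x. indicator (UNIV - ball 0 R) x * ennreal \<bar>f i (t, x)\<bar> \<partial>lborel) \<le> ennreal \<eta>"
  shows "equi_integrable T (f ` I)"
proof -
  define S where "S = {0<..<T} \<times> (UNIV :: (real^2) set)"
  have S[measurable]: "S \<in> sets borel" unfolding S_def by (intro borel_open open_Times) auto
  define b' where "b' = max b 0"
  have time: "(\<integral>\<^sup>+t. indicator {0<..<T} t * ennreal c \<partial>lborel) = ennreal (T * c)" if "0 \<le> c" for c
    using \<open>0 < T\<close> that by (simp add: nn_integral_multc ennreal_mult)
  have fm: "(\<lambda>z. indicator S z * (indicator N z * ennreal \<bar>f i z\<bar>)) \<in> borel_measurable borel"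
    if "i \<in> I" "N \<in> sets borel" for i N
  proof -
    note [measurable] = meas[OF that(1), folded S_def] that(2)
    have "(\<lambda>z. indicator N z * ennreal \<bar>indicator S z *\<^sub>R f i z\<bar>) \<in> borel_measurable borel" by measurable
    also have "(\<lambda>z. indicator N z * ennreal \<bar>indicator S z *\<^sub>R f i z\<bar>) =
        (\<lambda>z. indicator S z * (indicator N z * ennreal \<bar>f i z\<bar>))"
      by (auto simp: indicator_def)
    finally show ?thesis .
  qed
  have total: "(\<integral>\<^sup>+z. indicator S z * ennreal \<bar>f i z\<bar> \<partial>lborel) \<le> ennreal (T * b')" if i: "i \<in> I" for i
  proof -
    have "(\<integral>\<^sup>+z. indicator S z * ennreal \<bar>f i z\<bar> \<partial>lborel) =
        (\<integral>\<^sup>+t. indicator {0<..<T} t * (\<integral>\<^sup>+x. ennreal \<bar>f i (t, x)\<bar> \<partial>lborel) \<partial>lborel)"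
      unfolding S_def by (rule nn_integral_strip) (use fm[OF i, of UNIV] in \<open>simp add: S_def\<close>)
    also have "\<dots> \<le> (\<integral>\<^sup>+t. indicator {0<..<T} t * ennreal b' \<partial>lborel)"
    proof (rule nn_integral_mono)
      fix t
      show "indicator {0<..<T} t * (\<integral>\<^sup>+x. ennreal \<bar>f i (t, x)\<bar> \<partial>lborel) \<le> indicator {0<..<T} t * ennreal b'"
        using bound[OF i, of t] by (cases "t \<in> {0<..<T}") (auto simp: b'_def ennreal_leI intro: order_trans)
    qed
    also have "\<dots> = ennreal (T * b')" by (rule time) (simp add: b'_def)
    finally show ?thesis .
  qed
  have integrable: "set_integrable lebesgue S (f i)" if i: "i \<in> I" for i
    unfolding set_integrable_def
  proof -
    have "integrable lborel (\<lambda>z. indicator S z *\<^sub>R f i z)"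
    proof (rule integrableI_bounded)
      show "(\<lambda>z. indicator S z *\<^sub>R f i z) \<in> borel_measurable lborel" using meas[OF i] by (simp add: S_def)
      have "(\<integral>\<^sup>+z. ennreal (norm (indicator S z *\<^sub>R f i z)) \<partial>lborel) = (\<integral>\<^sup>+z. indicator S z * ennreal \<bar>f i z\<bar> \<partial>lborel)"
        by (intro nn_integral_cong) (auto simp: indicator_def)
      then show "(\<integral>\<^sup>+z. ennreal (norm (indicator S z *\<^sub>R f i z)) \<partial>lborel) < \<infinity>"
        using total[OF i] by (simp add: order_le_less_trans)
    qed
    then show "integrable lebesgue (\<lambda>z. indicator S z *\<^sub>R f i z)"
      by (simp add: integrable_completion borel_measurable_integrable)
  qed
  have norm: "(LINT z:S|lebesgue. \<bar>f i z\<bar>) \<le> T * b'" if "i \<in> I" for i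
    by (rule set_integral_abs_le[OF order.refl total[OF that]]) (use \<open>0 < T\<close> in \<open>simp add: b'_def\<close>)
  have uniform: "\<exists>\<gamma>>0. \<exists>R>0. \<forall>i\<in>I.
        (\<forall>A\<in>sets lebesgue. A \<subseteq> S \<longrightarrow> emeasure lebesgue A \<le> ennreal \<gamma> \<longrightarrow> (LINT z:A|lebesgue. \<bar>f i z\<bar>) \<le> \<eta>) \<and>
        (LINT z:{0<..<T} \<times> (UNIV - ball 0 R)|lebesgue. \<bar>f i z\<bar>) \<le> \<eta>" if "0 < \<eta>" for \<eta>
  proof -
    \<comment> \<open>Integration in time multiplies the slice error by \<open>T\<close>; the other
      half of \<open>\<eta>\<close> is left for the term linear in the measure of the set.\<close>
    define \<eta>' where "\<eta>' = \<eta> / (2 * T)"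
    have \<eta>': "0 < \<eta>'" "T * \<eta>' = \<eta> / 2" using that \<open>0 < T\<close> by (auto simp: \<eta>'_def)
    obtain c where c: "0 < c" "\<And>i t A. i \<in> I \<Longrightarrow> t \<in> {0<..<T} \<Longrightarrow> A \<in> sets borel \<Longrightarrow>
        (\<integral>\<^sup>+x. indicator A x * ennreal \<bar>f i (t, x)\<bar> \<partial>lborel) \<le> ennreal c * emeasure lborel A + ennreal \<eta>'"
      using small[OF \<eta>'(1)] by blast
    obtain R where R: "0 < R" "\<And>i t. i \<in> I \<Longrightarrow> t \<in> {0<..<T} \<Longrightarrow>
        (\<integral>\<^sup>+x. indicator (UNIV - ball 0 R) x * ennreal \<bar>f i (t, x)\<bar> \<partial>lborel) \<le> ennreal \<eta>'"
      using tail[OF \<eta>'(1)] by blast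
    define \<gamma> where "\<gamma> = \<eta> / (2 * c)"
    have \<gamma>: "0 < \<gamma>" "c * \<gamma> = \<eta> / 2" using that c(1) by (auto simp: \<gamma>_def)
    have smallset: "(LINT z:A|lebesgue. \<bar>f i z\<bar>) \<le> \<eta>"
      if i: "i \<in> I" and A: "A \<in> sets lebesgue" "A \<subseteq> S" "emeasure lebesgue A \<le> ennreal \<gamma>" for i A
    proof -
      \<comment> \<open>A Borel hull of the same measure replaces the Lebesgue set, so that all its
        slices are Borel.\<close>
      obtain N where N: "A \<subseteq> N" "N \<in> sets lborel" "emeasure lebesgue A = emeasure lborel N"
        using completion_upper[OF A(1)] by metis
      then have Nb[measurable]: "N \<in> sets borel" by simp
      have slice[measurable]: "Pair t -` N \<in> sets borel" for t
      proof (rule measurable_sets_borel[OF _ Nb])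
        show "Pair t \<in> borel_measurable borel"
          by (intro borel_measurable_continuous_onI continuous_intros)
      qed
      have "(\<integral>\<^sup>+z. indicator (S \<inter> N) z * ennreal \<bar>f i z\<bar> \<partial>lborel) =
          (\<integral>\<^sup>+z. indicator S z * (indicator N z * ennreal \<bar>f i z\<bar>) \<partial>lborel)"
        by (intro nn_integral_cong) (simp add: indicator_inter_arith mult.assoc)
      also have "\<dots> = (\<integral>\<^sup>+t. indicator {0<..<T} t * (\<integral>\<^sup>+x. indicator N (t, x) * ennreal \<bar>f i (t, x)\<bar> \<partial>lborel) \<partial>lborel)"
        unfolding S_def by (rule nn_integral_strip) (use fm[OF i Nb] in \<open>simp add: S_def\<close>)
      also have "\<dots> \<le> (\<integral>\<^sup>+t. ennreal c * emeasure lborel (Pair t -` N) + indicator {0<..<T} t * ennreal \<eta>' \<partial>lborel)"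
      proof (rule nn_integral_mono)
        fix t
        have "(\<lambda>x. indicator N (t, x) * ennreal \<bar>f i (t, x)\<bar>) = (\<lambda>x. indicator (Pair t -` N) x * ennreal \<bar>f i (t, x)\<bar>)"
          by (auto simp: indicator_def)
        then show "indicator {0<..<T} t * (\<integral>\<^sup>+x. indicator N (t, x) * ennreal \<bar>f i (t, x)\<bar> \<partial>lborel) \<le>
            ennreal c * emeasure lborel (Pair t -` N) + indicator {0<..<T} t * ennreal \<eta>'"
          using c(2)[OF i _ slice, of t] by (cases "t \<in> {0<..<T}") auto
      qed
      also have "\<dots> = ennreal c * (\<integral>\<^sup>+t. emeasure lborel (Pair t -` N) \<partial>lborel) + ennreal (T * \<eta>')"
      proof -
        have N2: "N \<in> sets (lborel \<Otimes>\<^sub>M (lborel :: (real^2) measure))" using N(2) by (simp only: lborel_prod)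
        then have [measurable]: "(\<lambda>t. emeasure lborel (Pair t -` N)) \<in> borel_measurable lborel"
          by (rule lborel.measurable_emeasure_Pair)
        show ?thesis
          using \<eta>' by (subst nn_integral_add) (auto simp: nn_integral_cmult time)
      qed
      \<comment> \<open>The slice measures enter linearly, hence they add up to the measure of the
        whole set.\<close>
      also have "(\<integral>\<^sup>+t. emeasure lborel (Pair t -` N) \<partial>lborel) = emeasure lborel N"
      proof -
        have "N \<in> sets (lborel \<Otimes>\<^sub>M (lborel :: (real^2) measure))" using N(2) by (simp only: lborel_prod)
        from lborel.emeasure_pair_measure_alt[OF this] show ?thesis by (simp add: lborel_prod)
      qed
      also have "ennreal c * emeasure lborel N + ennreal (T * \<eta>') \<le> ennreal c * ennreal \<gamma> + ennreal (T * \<eta>')"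
        using A(3) N(3) by (intro add_right_mono mult_left_mono) auto
      also have "\<dots> = ennreal (c * \<gamma> + T * \<eta>')"
        using c(1) \<gamma>(1) \<eta>'(1) \<open>0 < T\<close> by (simp add: ennreal_mult ennreal_plus)
      also have "c * \<gamma> + T * \<eta>' = \<eta>" unfolding \<gamma>(2) \<eta>'(2) by simp
      finally show ?thesis
        using N(1) A(2) \<open>0 < \<eta>\<close> by (intro set_integral_abs_le[of A "S \<inter> N"]) auto
    qed
    have tailset: "(LINT z:{0<..<T} \<times> (UNIV - ball 0 R)|lebesgue. \<bar>f i z\<bar>) \<le> \<eta>" if i: "i \<in> I" for i
    proof (rule set_integral_abs_le[OF order.refl])
      let ?N = "UNIV \<times> (UNIV - ball 0 R) :: (real \<times> (real^2)) set"
      have Nb: "?N \<in> sets borel" by (intro borel_closed closed_Times) (auto simp: closed_Diff)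
      have "(\<integral>\<^sup>+z. indicator ({0<..<T} \<times> (UNIV - ball 0 R)) z * ennreal \<bar>f i z\<bar> \<partial>lborel) =
          (\<integral>\<^sup>+z. indicator S z * (indicator ?N z * ennreal \<bar>f i z\<bar>) \<partial>lborel)"
        by (intro nn_integral_cong) (auto simp: indicator_def S_def)
      also have "\<dots> = (\<integral>\<^sup>+t. indicator {0<..<T} t * (\<integral>\<^sup>+x. indicator ?N (t, x) * ennreal \<bar>f i (t, x)\<bar> \<partial>lborel) \<partial>lborel)"
        unfolding S_def by (rule nn_integral_strip) (use fm[OF i Nb] in \<open>simp add: S_def\<close>)
      also have "\<dots> \<le> (\<integral>\<^sup>+t. indicator {0<..<T} t * ennreal \<eta>' \<partial>lborel)"
      proof (rule nn_integral_mono)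
        fix t
        have "(\<lambda>x. indicator ?N (t, x) * ennreal \<bar>f i (t, x)\<bar>) = (\<lambda>x. indicator (UNIV - ball 0 R) x * ennreal \<bar>f i (t, x)\<bar>)"
          by (auto simp: indicator_def)
        then show "indicator {0<..<T} t * (\<integral>\<^sup>+x. indicator ?N (t, x) * ennreal \<bar>f i (t, x)\<bar> \<partial>lborel) \<le>
            indicator {0<..<T} t * ennreal \<eta>'"
          using R(2)[OF i, of t] by (cases "t \<in> {0<..<T}") auto
      qed
      also have "\<dots> = ennreal (\<eta> / 2)" using \<eta>'(1) by (simp only: time less_imp_le \<eta>'(2))
      also have "\<dots> \<le> ennreal \<eta>" using \<open>0 < \<eta>\<close> by (intro ennreal_leI) simp
      finally show "(\<integral>\<^sup>+z. indicator ({0<..<T} \<times> (UNIV - ball 0 R)) z * ennreal \<bar>f i z\<bar> \<partial>lborel) \<le> ennreal \<eta>" .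
    qed (use \<open>0 < \<eta>\<close> in simp)
    show ?thesis
    proof (rule exI[of _ \<gamma>], rule conjI[OF \<gamma>(1)], rule exI[of _ R], rule conjI[OF R(1)], intro ballI conjI impI)
      show "(LINT z:A|lebesgue. \<bar>f i z\<bar>) \<le> \<eta>"
        if "i \<in> I" "A \<in> sets lebesgue" "A \<subseteq> S" "emeasure lebesgue A \<le> ennreal \<gamma>" for i A
        by (rule smallset[OF that])
      show "(LINT z:{0<..<T} \<times> (UNIV - ball 0 R)|lebesgue. \<bar>f i z\<bar>) \<le> \<eta>" if "i \<in> I" for i
        by (rule tailset[OF that])
    qed
  qed
  show ?thesis
    unfolding equi_integrable_def S_def[symmetric] ball_simps(9)
  proof (intro conjI)
    show "\<forall>i\<in>I. set_integrable lebesgue S (f i)" using integrable by blast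
    show "\<exists>B. \<forall>i\<in>I. (LINT z:S|lebesgue. \<bar>f i z\<bar>) \<le> B" using norm by blast
    show "\<forall>\<eta>>0. \<exists>\<gamma>>0. \<exists>R>0. \<forall>i\<in>I.
        (\<forall>A\<in>sets lebesgue. A \<subseteq> S \<longrightarrow> emeasure lebesgue A \<le> ennreal \<gamma> \<longrightarrow> (LINT z:A|lebesgue. \<bar>f i z\<bar>) \<le> \<eta>) \<and>
        (LINT z:{0<..<T} \<times> (UNIV - ball 0 R)|lebesgue. \<bar>f i z\<bar>) \<le> \<eta>"
      by (intro allI impI uniform)
  qed
qed

text \<open>The trajectories are differentiable and thus continuous in time, so the vorticity is
  jointly continuous on the open strip.\<close>

lemma blob_vorticity_strip_borel:
  assumes \<phi>: "standard_mollifier \<phi>" and "0 < \<epsilon>" and X: "blob_trajectories T \<phi> \<epsilon> h w X"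
  shows "(\<lambda>z. indicator ({0<..<T} \<times> UNIV) z *\<^sub>R (case z of (t, x) \<Rightarrow> blob_vorticity \<phi> \<epsilon> h w (X t) x))
    \<in> borel_measurable borel"
proof (rule borel_measurable_continuous_on_indicator)
  show "{0<..<T} \<times> (UNIV :: (real^2) set) \<in> sets borel" by (intro borel_open open_Times) auto
  have "C_k 0 \<phi>" using \<phi> unfolding standard_mollifier_def smooth_def by blast
  then have \<phi>c: "continuous_on UNIV \<phi>" by simp
  have Xc: "continuous_on {0..T} (\<lambda>s. X s \<alpha>)" if "\<alpha> \<in> blob_centers h w" for \<alpha>
    using X that has_vector_derivative_continuous continuous_on_eq_continuous_within
    unfolding blob_trajectories_def by blast
  show "continuous_on ({0<..<T} \<times> UNIV) (\<lambda>z. case z of (t, x) \<Rightarrow> blob_vorticity \<phi> \<epsilon> h w (X t) x)"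
    unfolding blob_vorticity_def rescale_def split_beta
    by (intro continuous_intros continuous_on_compose2[OF \<phi>c] continuous_on_compose2[OF Xc]) (use \<open>0 < \<epsilon>\<close> in auto)
qed

text \<open>Fixing \<open>T\<close>, \<open>M\<close> and \<open>\<phi>\<close> before the
  existential quantifier expresses that the threshold for \<open>C\<^sub>0\<close> depends on
  nothing else.\<close>

theorem lemma3p5:
  fixes T M :: real and \<phi> :: "real^2 \<Rightarrow> real"
  assumes "T > 0" and "standard_mollifier \<phi>"
  shows "\<exists>C\<^sub>m>0. \<forall>C\<^sub>0\<ge>C\<^sub>m. \<forall>C>0.
    \<forall>(\<omega>\<^sub>0 :: real^2 \<Rightarrow> real) (j :: real^2 \<Rightarrow> real) (\<delta> :: real \<Rightarrow> real) (h :: real \<Rightarrow> real)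
      (X :: real \<Rightarrow> real \<Rightarrow> real^2 \<Rightarrow> real^2).
      L1_compact_support \<omega>\<^sub>0 \<longrightarrow>
      (LINT x|lebesgue. \<bar>\<omega>\<^sub>0 x\<bar>) = M \<longrightarrow>
      standard_mollifier j \<longrightarrow>
      (\<forall>\<epsilon>\<in>{0<..<1}. \<delta> \<epsilon> \<in> {0<..<1}) \<longrightarrow>
      (\<delta> \<longlongrightarrow> 0) (at_right 0) \<longrightarrow>
      (\<forall>\<epsilon>\<in>{0<..<1}. h \<epsilon> \<in> {0<..<1} \<and> h \<epsilon> \<le> C * \<epsilon> ^ 4 * exp (- (C\<^sub>0 / \<epsilon>\<^sup>2))) \<longrightarrow>
      (\<forall>\<epsilon>\<in>{0<..<1}.
         blob_trajectories T \<phi> \<epsilon> (h \<epsilon>) (convolve \<omega>\<^sub>0 (rescale (\<delta> \<epsilon>) j)) (X \<epsilon>)) \<longrightarrow>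
      equi_integrable T
        ((\<lambda>\<epsilon> (t, x). blob_vorticity \<phi> \<epsilon> (h \<epsilon>) (convolve \<omega>\<^sub>0 (rescale (\<delta> \<epsilon>) j)) (X \<epsilon> t) x)
           ` {0<..<1})"
proof -
  note \<phi> = \<open>standard_mollifier \<phi>\<close>
  obtain K where "0 \<le> K" and K: "\<And>\<epsilon>. 0 < \<epsilon> \<Longrightarrow> solenoidal (K / \<epsilon>\<^sup>2) (convolve biot_savart (rescale \<epsilon> \<phi>))"
    using solenoidal_convolve_biot_savart[OF \<phi>] by metis
  obtain B0 where B0: "\<And>x. \<bar>\<phi> x\<bar> \<le> B0" using standard_mollifier_bounded[OF \<phi>] by metis
  \<comment> \<open>The maximum makes the bump mass \<open>P\<close> below strictly positive, so
    that tolerances can be divided by it.\<close>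
  define B where "B = max B0 1"
  have B: "\<And>x. \<bar>\<phi> x\<bar> \<le> B" "0 < B" using B0 by (auto simp: B_def max.coboundedI1)
  show ?thesis
  \<comment> \<open>The product is the Gronwall exponent without its factor
    \<open>1 / \<epsilon>\<^sup>2\<close>. The sign of \<open>M\<close> is not known before an
    initial vorticity is introduced, hence the absolute value; the 1 makes the constant
    positive.\<close>
  proof (intro exI[of _ "T * \<bar>M\<bar> * K + 1"] conjI allI impI)
    show "0 < T * \<bar>M\<bar> * K + 1" using \<open>0 < T\<close> \<open>0 \<le> K\<close> by (simp add: add_nonneg_pos)
    fix C0 C :: real and \<omega>\<^sub>0 j :: "real^2 \<Rightarrow> real" and \<delta> h :: "real \<Rightarrow> real" and X :: "real \<Rightarrow> real \<Rightarrow> real^2 \<Rightarrow> real^2"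
    assume C0: "T * \<bar>M\<bar> * K + 1 \<le> C0" and C: "0 < C" and \<omega>: "L1_compact_support \<omega>\<^sub>0"
      and M: "(LINT x|lebesgue. \<bar>\<omega>\<^sub>0 x\<bar>) = M" and j: "standard_mollifier j"
      and \<delta>: "\<forall>\<epsilon>\<in>{0<..<1}. \<delta> \<epsilon> \<in> {0<..<1}"
      and h: "\<forall>\<epsilon>\<in>{0<..<1}. h \<epsilon> \<in> {0<..<1} \<and> h \<epsilon> \<le> C * \<epsilon> ^ 4 * exp (- (C0 / \<epsilon>\<^sup>2))"
      and X: "\<forall>\<epsilon>\<in>{0<..<1}. blob_trajectories T \<phi> \<epsilon> (h \<epsilon>) (convolve \<omega>\<^sub>0 (rescale (\<delta> \<epsilon>) j)) (X \<epsilon>)"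
    have M0: "0 \<le> M" unfolding M[symmetric] by simp
    define w where "w \<epsilon> = convolve \<omega>\<^sub>0 (rescale (\<delta> \<epsilon>) j)" for \<epsilon>
    define f where "f \<epsilon> = (\<lambda>(t, x). blob_vorticity \<phi> \<epsilon> (h \<epsilon>) (w \<epsilon>) (X \<epsilon> t) x)" for \<epsilon>
    obtain R0 where R0: "0 < R0"
      and cb: "\<And>\<delta>. 0 < \<delta> \<Longrightarrow> convolve \<omega>\<^sub>0 (rescale \<delta> j) \<in> borel_measurable borel"
      and cM: "\<And>\<delta>. 0 < \<delta> \<Longrightarrow> (\<integral>\<^sup>+x. ennreal \<bar>convolve \<omega>\<^sub>0 (rescale \<delta> j) x\<bar> \<partial>lborel) \<le> ennreal M"
      and c0: "\<And>\<delta> x. \<delta> \<in> {0<..<1} \<Longrightarrow> R0 < norm x \<Longrightarrow> convolve \<omega>\<^sub>0 (rescale \<delta> j) x = 0"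
      and cL: "\<And>\<eta>. 0 < \<eta> \<Longrightarrow> \<exists>L\<ge>0. \<forall>\<delta>>0.
        (\<integral>\<^sup>+x. ennreal (max 0 (\<bar>convolve \<omega>\<^sub>0 (rescale \<delta> j) x\<bar> - L)) \<partial>lborel) \<le> ennreal \<eta>"
      using regularized_vorticity_bounds[OF \<omega> j] unfolding M by blast
    have \<delta>0: "0 < \<delta> \<epsilon>" if "\<epsilon> \<in> {0<..<1}" for \<epsilon> using \<delta> that by auto
    have wb: "w \<epsilon> \<in> borel_measurable borel" if "\<epsilon> \<in> {0<..<1}" for \<epsilon>
      unfolding w_def by (rule cb[OF \<delta>0[OF that]])
    have wM: "(\<integral>\<^sup>+x. ennreal \<bar>w \<epsilon> x\<bar> \<partial>lborel) \<le> ennreal M" if "\<epsilon> \<in> {0<..<1}" for \<epsilon>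
      unfolding w_def by (rule cM[OF \<delta>0[OF that]])
    have w0: "w \<epsilon> x = 0" if "\<epsilon> \<in> {0<..<1}" "R0 < norm x" for \<epsilon> x
      unfolding w_def using c0 \<delta> that by blast
    have wL: "\<exists>L\<ge>0. \<forall>\<epsilon>\<in>{0<..<1}. (\<integral>\<^sup>+x. ennreal (max 0 (\<bar>w \<epsilon> x\<bar> - L)) \<partial>lborel) \<le> ennreal \<eta>"
      if "0 < \<eta>" for \<eta>
      unfolding w_def using cL[OF that] \<delta>0 by blast
    define P where "P = B * pi * (1 + 2 * C)\<^sup>2"
    have P: "0 < P" unfolding P_def using B(2) C by (intro mult_pos_pos) auto
    have bumpP: "(\<integral>\<^sup>+z. bump B (2 * C) \<epsilon> z \<partial>lborel) \<le> ennreal P" if "\<epsilon> \<in> {0<..<1}" for \<epsilon>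
      using that B(2) C by (simp add: nn_integral_bump P_def)
    define D where "D L = T * (2 * L * (M * near_mass) + M * M)" for L
    have D0: "0 \<le> D L" if "0 \<le> L" for L
      using \<open>0 < T\<close> M0 that near_mass_nonneg by (simp add: D_def)
    have transport: "\<exists>\<Phi>. \<Phi> \<in> borel_measurable borel \<and>
        (\<forall>F\<in>borel_measurable borel. (\<integral>\<^sup>+y. F (\<Phi> y) \<partial>lborel) \<le> 2 * (\<integral>\<^sup>+y. F y \<partial>lborel)) \<and>
        (\<forall>L\<ge>0. (\<integral>\<^sup>+y. ennreal (min \<bar>w \<epsilon> y\<bar> L) * ennreal (norm (\<Phi> y - y)) \<partial>lborel) \<le> ennreal (D L)) \<and>
        (\<forall>x. ennreal \<bar>f \<epsilon> (t, x)\<bar> \<le> (\<integral>\<^sup>+y. ennreal \<bar>w \<epsilon> y\<bar> * bump B (2 * C) \<epsilon> (x - \<Phi> y) \<partial>lborel))"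
      if \<epsilon>: "\<epsilon> \<in> {0<..<1}" and t: "t \<in> {0<..<T}" for \<epsilon> t
    proof -
      have hyps: "T * M * K \<le> C0" "0 < \<epsilon>" "\<epsilon> < 1" "0 < h \<epsilon>" "h \<epsilon> \<le> C * \<epsilon> ^ 4 * exp (- (C0 / \<epsilon>\<^sup>2))"
        using \<epsilon> h C0 M0 by auto
      have tr: "blob_trajectories T \<phi> \<epsilon> (h \<epsilon>) (w \<epsilon>) (X \<epsilon>)" using X \<epsilon> unfolding w_def by blast
      show ?thesis
        unfolding f_def D_def prod.case
        by (rule blob_transport[OF \<phi> B(1) K \<open>0 \<le> K\<close> \<open>0 < T\<close> M0 C hyps wb[OF \<epsilon>] wM[OF \<epsilon>] tr t]) blast+
    qed
    have mass: "(\<integral>\<^sup>+x. indicator A x * ennreal \<bar>f \<epsilon> (t, x)\<bar> \<partial>lborel) \<le>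
        2 * ennreal L * ennreal P * emeasure lborel A + ennreal P * ennreal \<eta>"
      if \<epsilon>: "\<epsilon> \<in> {0<..<1}" and t: "t \<in> {0<..<T}" and A: "A \<in> sets borel" and L: "0 \<le> L"
        and \<eta>: "(\<integral>\<^sup>+x. ennreal (max 0 (\<bar>w \<epsilon> x\<bar> - L)) \<partial>lborel) \<le> ennreal \<eta>" for \<epsilon> t A L \<eta>
    proof -
      obtain \<Phi> where \<Phi>: "\<Phi> \<in> borel_measurable borel"
        "\<And>F. F \<in> borel_measurable borel \<Longrightarrow> (\<integral>\<^sup>+y. F (\<Phi> y) \<partial>lborel) \<le> 2 * (\<integral>\<^sup>+y. F y \<partial>lborel)"
        and le: "\<And>x. ennreal \<bar>f \<epsilon> (t, x)\<bar> \<le> (\<integral>\<^sup>+y. ennreal \<bar>w \<epsilon> y\<bar> * bump B (2 * C) \<epsilon> (x - \<Phi> y) \<partial>lborel)"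
        using transport[OF \<epsilon> t] by blast
      have "(\<integral>\<^sup>+x. indicator A x * ennreal \<bar>f \<epsilon> (t, x)\<bar> \<partial>lborel) \<le>
          (\<integral>\<^sup>+x. indicator A x * (\<integral>\<^sup>+y. ennreal \<bar>w \<epsilon> y\<bar> * bump B (2 * C) \<epsilon> (x - \<Phi> y) \<partial>lborel) \<partial>lborel)"
        by (intro nn_integral_mono mult_left_mono le) simp
      also have "\<dots> \<le> 2 * ennreal L * ennreal P * emeasure lborel A + ennreal P * ennreal \<eta>"
        by (rule transported_mass_on_set[OF \<Phi>(1) borel_measurable_bump wb[OF \<epsilon>] A \<Phi>(2) bumpP[OF \<epsilon>] L \<eta>])
      finally show ?thesis .
    qed
    have "equi_integrable T (f ` {0<..<1})"
    proof (rule equi_integrable_from_slices[OF \<open>0 < T\<close>])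
      show "(\<lambda>z. indicator ({0<..<T} \<times> UNIV) z *\<^sub>R f \<epsilon> z) \<in> borel_measurable borel" if "\<epsilon> \<in> {0<..<1}" for \<epsilon>
        unfolding f_def w_def by (rule blob_vorticity_strip_borel[OF \<phi>]) (use X that in auto)
      \<comment> \<open>At level 0 the whole of \<open>w\<close> counts as excess, and the term with
        the infinite measure of the plane vanishes because 0 times infinity is 0 in
        \<open>ennreal\<close>.\<close>
      show "(\<integral>\<^sup>+x. ennreal \<bar>f \<epsilon> (t, x)\<bar> \<partial>lborel) \<le> ennreal (P * M)"
        if "\<epsilon> \<in> {0<..<1}" "t \<in> {0<..<T}" for \<epsilon> t
        using mass[OF that, of UNIV 0 M] wM[OF that(1)] P M0 by (simp add: ennreal_mult)
    next
      fix \<eta> :: real assume "0 < \<eta>"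
      then have "0 < \<eta> / P" using P by simp
      then obtain L where L: "0 \<le> L" "\<And>\<epsilon>. \<epsilon> \<in> {0<..<1} \<Longrightarrow> (\<integral>\<^sup>+x. ennreal (max 0 (\<bar>w \<epsilon> x\<bar> - L)) \<partial>lborel) \<le> ennreal (\<eta> / P)"
        using wL by blast
      have "(\<integral>\<^sup>+x. indicator A x * ennreal \<bar>f \<epsilon> (t, x)\<bar> \<partial>lborel) \<le> ennreal (2 * L * P + 1) * emeasure lborel A + ennreal \<eta>"
        if \<epsilon>: "\<epsilon> \<in> {0<..<1}" and t: "t \<in> {0<..<T}" and A: "A \<in> sets borel" for \<epsilon> t A
      proof -
        have "2 * ennreal L * ennreal P = ennreal (2 * L * P)"
          using L(1) P by (simp add: ennreal_mult)
        also have "\<dots> \<le> ennreal (2 * L * P + 1)" by (intro ennreal_leI) simp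
        finally have c: "2 * ennreal L * ennreal P \<le> ennreal (2 * L * P + 1)" .
        have e: "ennreal P * ennreal (\<eta> / P) = ennreal \<eta>"
          using P by (simp flip: ennreal_mult')
        have "2 * ennreal L * ennreal P * emeasure lborel A \<le> ennreal (2 * L * P + 1) * emeasure lborel A"
          by (rule mult_right_mono[OF c]) simp
        then show ?thesis
          using mass[OF \<epsilon> t A L(1) L(2)[OF \<epsilon>]] unfolding e by (meson add_right_mono order_trans)
      qed
      then show "\<exists>c>0. \<forall>\<epsilon>\<in>{0<..<1}. \<forall>t\<in>{0<..<T}. \<forall>A\<in>sets borel.
          (\<integral>\<^sup>+x. indicator A x * ennreal \<bar>f \<epsilon> (t, x)\<bar> \<partial>lborel) \<le> ennreal c * emeasure lborel A + ennreal \<eta>"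
        using L(1) P by (intro exI[of _ "2 * L * P + 1"]) (auto simp: add_nonneg_pos)
    next
      fix \<eta> :: real assume "0 < \<eta>"
      then have "0 < \<eta> / (2 * P)" using P by simp
      then obtain L where L: "0 \<le> L" "\<And>\<epsilon>. \<epsilon> \<in> {0<..<1} \<Longrightarrow> (\<integral>\<^sup>+x. ennreal (max 0 (\<bar>w \<epsilon> x\<bar> - L)) \<partial>lborel) \<le> ennreal (\<eta> / (2 * P))"
        using wL by blast
      \<comment> \<open>Chosen so that the Chebyshev term \<open>D L / a\<close> is at most
        \<open>\<eta> / (2 * P)\<close>, the same share as the excess above \<open>L\<close>; adding
        1 keeps \<open>a\<close> positive.\<close>
      define a where "a = 2 * P * (D L + 1) / \<eta>"
      have a: "0 < a" using P D0[OF L(1)] \<open>0 < \<eta>\<close> by (simp add: a_def)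
      have "1 / a * D L \<le> 1 / a * (D L + 1)" using a by (intro mult_left_mono) auto
      also have "\<dots> = \<eta> / (2 * P)"
        using P D0[OF L(1)] \<open>0 < \<eta>\<close> by (simp add: a_def add_nonneg_pos less_imp_neq[symmetric])
      finally have aD: "1 / a * D L \<le> \<eta> / (2 * P)" .
      have "(\<integral>\<^sup>+x. indicator (UNIV - ball 0 (R0 + (1 + 2 * C) + a)) x * ennreal \<bar>f \<epsilon> (t, x)\<bar> \<partial>lborel) \<le> ennreal \<eta>"
        if \<epsilon>: "\<epsilon> \<in> {0<..<1}" and t: "t \<in> {0<..<T}" for \<epsilon> t
      proof -
        obtain \<Phi> where \<Phi>: "\<Phi> \<in> borel_measurable borel"
          and disp: "(\<integral>\<^sup>+y. ennreal (min \<bar>w \<epsilon> y\<bar> L) * ennreal (norm (\<Phi> y - y)) \<partial>lborel) \<le> ennreal (D L)"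
          and le: "\<And>x. ennreal \<bar>f \<epsilon> (t, x)\<bar> \<le> (\<integral>\<^sup>+y. ennreal \<bar>w \<epsilon> y\<bar> * bump B (2 * C) \<epsilon> (x - \<Phi> y) \<partial>lborel)"
          using transport[OF \<epsilon> t] L(1) by blast
        \<comment> \<open>A common support radius for all \<open>\<epsilon>\<close> below 1, needed
          for a radius in the tail bound that does not depend on \<open>\<epsilon>\<close>.\<close>
        have far: "bump B (2 * C) \<epsilon> z = 0" if "1 + 2 * C < norm z" for z
        proof -
          have "(1 + 2 * C) * \<epsilon> \<le> 1 + 2 * C" using \<epsilon> C by (simp add: mult_left_le)
          then show ?thesis using that by (simp add: bump_def)
        qed
        have "(\<integral>\<^sup>+x. indicator (UNIV - ball 0 (R0 + (1 + 2 * C) + a)) x * ennreal \<bar>f \<epsilon> (t, x)\<bar> \<partial>lborel) \<le>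
          (\<integral>\<^sup>+x. indicator (UNIV - ball 0 (R0 + (1 + 2 * C) + a)) x *
            (\<integral>\<^sup>+y. ennreal \<bar>w \<epsilon> y\<bar> * bump B (2 * C) \<epsilon> (x - \<Phi> y) \<partial>lborel) \<partial>lborel)"
          by (intro nn_integral_mono mult_left_mono le) simp
        also have "\<dots> \<le> ennreal P * (ennreal (\<eta> / (2 * P)) + ennreal (1 / a) * ennreal (D L))"
          by (rule transported_mass_tail[OF \<Phi> borel_measurable_bump wb[OF \<epsilon>] bumpP[OF \<epsilon>] L(1) L(2)[OF \<epsilon>] far w0[OF \<epsilon>] a disp])
        also have "\<dots> = ennreal (P * (\<eta> / (2 * P) + 1 / a * D L))"
          using P a D0[OF L(1)] \<open>0 < \<eta>\<close> by (simp flip: ennreal_mult ennreal_plus)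
        also have "\<dots> \<le> ennreal \<eta>"
        proof (rule ennreal_leI)
          have "P * (\<eta> / (2 * P) + 1 / a * D L) \<le> P * (\<eta> / (2 * P) + \<eta> / (2 * P))"
            using P by (intro mult_left_mono add_left_mono aD) simp
          also have "\<dots> = \<eta>" using P by simp
          finally show "P * (\<eta> / (2 * P) + 1 / a * D L) \<le> \<eta>" .
        qed
        finally show ?thesis .
      qed
      then show "\<exists>R>0. \<forall>\<epsilon>\<in>{0<..<1}. \<forall>t\<in>{0<..<T}.
          (\<integral>\<^sup>+x. indicator (UNIV - ball 0 R) x * ennreal \<bar>f \<epsilon> (t, x)\<bar> \<partial>lborel) \<le> ennreal \<eta>"
        using R0 C a by (intro exI[of _ "R0 + (1 + 2 * C) + a"]) auto
    qed
    then show "equi_integrable T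
        ((\<lambda>\<epsilon> (t, x). blob_vorticity \<phi> \<epsilon> (h \<epsilon>) (convolve \<omega>\<^sub>0 (rescale (\<delta> \<epsilon>) j)) (X \<epsilon> t) x) ` {0<..<1})"
      unfolding f_def w_def by simp
  qed
qed

end
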